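(* Let $\Lambda$ be a CSP and $\delta>0$. If there is an $\alpha$ approximation algorithm for unweighted regular instances of Max-CSP $\Lambda$ whose common variable degree is at most $O(\log(1/\delta)/\delta^2)$, then there is a randomized polynomial-time algorithm which, given a weighted instance $\mathcal F$ of Max-CSP $\Lambda$ on $n$ variables, outputs an assignment $\chi$ with $\mathrm{Val}_\chi(\mathcal F)\ge(\alpha-\delta)\,\mathrm{Opt}(\mathcal F)$ with probability at least $1-O(2^{-n})$.
   Context: A CSP over the language $\Sigma=[q]$, $q\in\mathbb{N}$, is a finite collection $\Lambda$ of predicates $P:[q]^k\to\{0,1\}$ (with $k=\mathrm{ar}(P)$ varying). An instance of $\Lambda$ consists of variables $x_1,\dots,x_n$ taking values in $\Sigma$ and constraints $C_1,\dots,C_m$, where $C_r=(P_r,S_r)$ with $P_r\in\Lambda$ and $S_r$ an ordered tuple of $\mathrm{ar}(P_r)$ distinct variables (the scope). In a weighted instance each constraint has a weight $w_r\ge 0$ with $\sum_r w_r=1$; an unweighted instance is one with $w_r=1/m$ for all $r$. The degree of a variable $x_i$ is the number of constraints whose scope contains $x_i$; an instance is regular if all variables have the same degree. For an assignment $\chi$, $\mathrm{Val}_\chi(\mathcal F)=\sum_r w_r P_r(\chi(S_r))$, and for Max-CSP $\mathrm{Opt}(\mathcal F)=\max_\chi \mathrm{Val}_\chi(\mathcal F)$. An $\alpha$ approximation algorithm for a class of instances is a polynomial-time algorithm outputting an assignment $\chi$ with $\mathrm{Val}_\chi(\mathcal F)\ge \alpha\cdot\mathrm{Opt}(\mathcal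 F)$ on every instance of the class (by convention $\alpha<1$). *)

theory Defs
  imports "HOL-Probability.Probability" "HOL-Computational_Algebra.Polynomial" "HOL-Library.Log_Nat"
begin

section \<open>Machine model\<close>

text \<open>
  Algorithms are structured programs over S-expressions with natural numbers at the leaves,
  under a logarithmic cost measure: numbers count with their binary length, and every primitive
  step is charged the full size of its argument and of its result. Hence the running time bounds
  the size of all intermediate data, and (all primitives being computable in polynomial time on
  binary representations) the running time is polynomially related to that of Turing machines.
\<close>

datatype data = Num nat | Pr data data

fun dsize :: "data \<Rightarrow> nat" where
  "dsize (Num n) = 1 + floorlog 2 n"
| "dsize (Pr x y) = 1 + dsize x + dsize y"

datatype prim = Id | Lit nat | Fst | Snd | IsNum | Add | Sub | Mul | Div | Less

fun on_nums :: "(nat \<Rightarrow> nat \<Rightarrow> nat) \<Rightarrow> data \<Rightarrow> data" where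
  "on_nums f (Pr (Num a) (Num b)) = Num (f a b)"
| "on_nums f _ = Num 0"

fun prim_app :: "prim \<Rightarrow> data \<Rightarrow> data" where
  "prim_app Id x = x"
| "prim_app (Lit n) x = Num n"
| "prim_app Fst x = (case x of Num n \<Rightarrow> Num 0 | Pr y z \<Rightarrow> y)"
| "prim_app Snd x = (case x of Num n \<Rightarrow> Num 0 | Pr y z \<Rightarrow> z)"
| "prim_app IsNum x = (case x of Num n \<Rightarrow> Num 1 | Pr y z \<Rightarrow> Num 0)"
| "prim_app Add x = on_nums (+) x"
| "prim_app Sub x = on_nums (-) x"
| "prim_app Mul x = on_nums (*) x"
| "prim_app Div x = on_nums (div) x"
| "prim_app Less x = on_nums (\<lambda>a b. of_bool (a < b)) x"

datatype prog =
    Prim prim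
  | Seq prog prog
  | Fork prog prog
  | Cond prog prog prog
  | While prog prog

text \<open>
  \<open>run p x y t\<close>: on input \<open>x\<close> the program \<open>p\<close> halts with output \<open>y\<close> after time \<open>t\<close>.
  In tests, \<open>Num 0\<close> is false and everything else is true.
\<close>

inductive run :: "prog \<Rightarrow> data \<Rightarrow> data \<Rightarrow> nat \<Rightarrow> bool" where
  run_Prim: "run (Prim f) x (prim_app f x) (1 + dsize x + dsize (prim_app f x))"
| run_Seq: "run f x y s \<Longrightarrow> run g y z t \<Longrightarrow> run (Seq f g) x z (1 + s + t)"
| run_Fork: "run f x y s \<Longrightarrow> run g x z t \<Longrightarrow> run (Fork f g) x (Pr y z) (1 + s + t)"
| run_Cond_True: "run b x v s \<Longrightarrow> v \<noteq> Num 0 \<Longrightarrow> run f x y t \<Longrightarrow> run (Cond b f g) x y (1 + s + t)"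
| run_Cond_False: "run b x (Num 0) s \<Longrightarrow> run g x y t \<Longrightarrow> run (Cond b f g) x y (1 + s + t)"
| run_While_True:
    "run b x v s \<Longrightarrow> v \<noteq> Num 0 \<Longrightarrow> run f x y t \<Longrightarrow> run (While b f) y z u \<Longrightarrow>
     run (While b f) x z (1 + s + t + u)"
| run_While_False: "run b x (Num 0) s \<Longrightarrow> run (While b f) x x (1 + s)"

inductive_cases run_PrimE: "run (Prim f) x y t"
inductive_cases run_SeqE: "run (Seq f g) x y t"
inductive_cases run_ForkE: "run (Fork f g) x y t"
inductive_cases run_CondE: "run (Cond b f g) x y t"
inductive_cases run_WhileE: "run (While b f) x y t"

lemma run_deterministic: "run p x y t \<Longrightarrow> run p x y' t' \<Longrightarrow> y' = y \<and> t' = t"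
proof (induction arbitrary: y' t' rule: run.induct)
  case run_Prim
  then show ?case by (auto elim: run_PrimE)
next
  case run_Seq
  from run_Seq.prems show ?case by (rule run_SeqE) (metis plus_1_eq_Suc add_Suc run_Seq.IH)
next
  case run_Fork
  from run_Fork.prems show ?case by (rule run_ForkE) (metis plus_1_eq_Suc add_Suc run_Fork.IH)
next
  case run_Cond_True
  from run_Cond_True.prems show ?case
    by (rule run_CondE) (metis plus_1_eq_Suc add_Suc run_Cond_True.IH run_Cond_True.hyps(2))+
next
  case run_Cond_False
  from run_Cond_False.prems show ?case
    by (rule run_CondE) (metis plus_1_eq_Suc add_Suc run_Cond_False.IH)+
next
  case run_While_True
  from run_While_True.prems show ?case
    by (rule run_WhileE) (metis plus_1_eq_Suc add_Suc run_While_True.IH run_While_True.hyps(2))+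
next
  case run_While_False
  from run_While_False.prems show ?case
    by (rule run_WhileE) (metis plus_1_eq_Suc add_Suc run_While_False.IH)+
qed

lemma dsize_le_time: "run p x y t \<Longrightarrow> dsize x \<le> t \<and> dsize y \<le> t"
  by (induction rule: run.induct) auto


section \<open>Constraint satisfaction problems\<close>

text \<open>
  The alphabet \<open>[q]\<close> is \<open>{..<q}\<close> and the variables of an instance are \<open>0, \<dots>, n - 1\<close>. A CSP is the
  list of its predicates, so that a constraint refers to its predicate by position; only the
  values of \<open>holds\<close> on lists over \<open>{..<q}\<close> of length \<open>arity\<close> matter.
\<close>

record csp_pred =
  arity :: nat
  holds :: "nat list \<Rightarrow> bool"

type_synonym csp = "csp_pred list"

record constr =
  pred_ix :: nat
  scope :: "nat list"
  weight :: rat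

record inst =
  nvars :: nat
  constrs :: "constr list"

definition weighted_instance :: "csp \<Rightarrow> inst \<Rightarrow> bool" where
  "weighted_instance \<Lambda> F \<longleftrightarrow>
     (\<forall>c \<in> set (constrs F).
        pred_ix c < length \<Lambda> \<and>
        length (scope c) = arity (\<Lambda> ! pred_ix c) \<and>
        distinct (scope c) \<and> set (scope c) \<subseteq> {..<nvars F} \<and>
        weight c \<ge> 0) \<and>
     (\<Sum>c\<leftarrow>constrs F. weight c) = 1"

definition unweighted_instance :: "csp \<Rightarrow> inst \<Rightarrow> bool" where
  "unweighted_instance \<Lambda> F \<longleftrightarrow>
     weighted_instance \<Lambda> F \<and>
     (\<forall>c \<in> set (constrs F). weight c = 1 / of_nat (length (constrs F)))"

definition var_degree :: "inst \<Rightarrow> nat \<Rightarrow> nat" where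
  "var_degree F i = length (filter (\<lambda>c. i \<in> set (scope c)) (constrs F))"

definition regular_of_degree :: "inst \<Rightarrow> nat \<Rightarrow> bool" where
  "regular_of_degree F d \<longleftrightarrow> (\<forall>i<nvars F. var_degree F i = d)"

definition assignments :: "nat \<Rightarrow> inst \<Rightarrow> nat list set" where
  "assignments q F = {\<xi>. length \<xi> = nvars F \<and> set \<xi> \<subseteq> {..<q}}"

definition Val :: "csp \<Rightarrow> inst \<Rightarrow> nat list \<Rightarrow> real" where
  "Val \<Lambda> F \<xi> =
     (\<Sum>c\<leftarrow>constrs F.
        of_rat (weight c) * of_bool (holds (\<Lambda> ! pred_ix c) (map (\<lambda>i. \<xi> ! i) (scope c))))"

definition Opt :: "nat \<Rightarrow> csp \<Rightarrow> inst \<Rightarrow> real" where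
  "Opt q \<Lambda> F = Max (Val \<Lambda> F ` assignments q F)"


section \<open>Encodings and approximation algorithms\<close>

fun enc_list :: "data list \<Rightarrow> data" where
  "enc_list [] = Num 0"
| "enc_list (x # xs) = Pr x (enc_list xs)"

definition enc_nats :: "nat list \<Rightarrow> data" where
  "enc_nats xs = enc_list (map Num xs)"

definition enc_bits :: "bool list \<Rightarrow> data" where
  "enc_bits r = enc_nats (map of_bool r)"

text \<open>Only used for nonnegative numbers.\<close>

definition enc_rat :: "rat \<Rightarrow> data" where
  "enc_rat w = (case quotient_of w of (a, b) \<Rightarrow> Pr (Num (nat a)) (Num (nat b)))"

definition enc_constr :: "constr \<Rightarrow> data" where
  "enc_constr c = Pr (Num (pred_ix c)) (Pr (enc_nats (scope c)) (enc_rat (weight c)))"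

text \<open>The variables are listed explicitly, so that the input size is at least their number.\<close>

definition enc_inst :: "inst \<Rightarrow> data" where
  "enc_inst F = Pr (enc_nats [0..<nvars F]) (enc_list (map enc_constr (constrs F)))"

definition approx_algorithm :: "nat \<Rightarrow> csp \<Rightarrow> inst set \<Rightarrow> real \<Rightarrow> prog \<Rightarrow> bool" where
  "approx_algorithm q \<Lambda> \<F> \<alpha> p \<longleftrightarrow>
     (\<exists>b :: nat poly. \<forall>F \<in> \<F>. \<exists>\<xi> \<in> assignments q F. \<exists>t.
        run p (enc_inst F) (enc_nats \<xi>) t \<and> t \<le> poly b (dsize (enc_inst F)) \<and>
        Val \<Lambda> F \<xi> \<ge> \<alpha> * Opt q \<Lambda> F)"

text \<open>
  A randomized polynomial-time algorithm receives, besides its input, a uniformly random bit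
  string whose length is a polynomial in the input size, and halts within a polynomial time bound
  for every outcome of the random bits.
\<close>

definition random_bits :: "nat \<Rightarrow> bool list pmf" where
  "random_bits l = pmf_of_set {r. length r = l}"

definition rand_approx_algorithm ::
  "nat \<Rightarrow> csp \<Rightarrow> inst set \<Rightarrow> real \<Rightarrow> (inst \<Rightarrow> real) \<Rightarrow> prog \<Rightarrow> bool" where
  "rand_approx_algorithm q \<Lambda> \<F> \<beta> \<rho> p \<longleftrightarrow>
     (\<exists>b l :: nat poly. \<forall>F \<in> \<F>.
        (\<forall>r. length r = poly l (dsize (enc_inst F)) \<longrightarrow>
           (\<exists>y t. run p (Pr (enc_inst F) (enc_bits r)) y t \<and> t \<le> poly b (dsize (enc_inst F)))) \<and>
        measure_pmf.prob (random_bits (poly l (dsize (enc_inst F))))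
          {r. \<exists>\<xi> \<in> assignments q F. \<exists>t.
                run p (Pr (enc_inst F) (enc_bits r)) (enc_nats \<xi>) t \<and>
                Val \<Lambda> F \<xi> \<ge> \<beta> * Opt q \<Lambda> F} \<ge> \<rho> F)"

end

theory Submission
  imports Defs
begin

text \<open>
  After discarding unsatisfiable constraints, the weights are rounded to multiples of a small
  fraction of the largest weight, which is a lower bound for the optimum. This replaces the instance by
  a list of \<open>M\<close> equally weighted constraints, \<open>M\<close> at least the number of variables. Each variable is
  replaced by a cloud of copies, one for each of its occurrences, and every copy is put \<open>D\<close> times
  into an urn of its variable. Now \<open>D\<close> copies of each constraint draw their
  variables from the urns without replacement; as every urn is emptied exactly, the resulting
  instance is \<open>D\<close>-regular. Assigning to all copies the value of their variable shows that its optimum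
  is not smaller. Conversely, an assignment of the copies is turned into one of the variables by picking a
  random copy from each cloud, derandomized by conditional expectations. Its expected value \<open>P\<close> is
  also the expected value of the sampled instance under the given assignment of the copies, and
  the exponential moment of the latter is bounded draw by draw with Hoeffding's lemma: a single draw
  moves the conditional expectation within an interval of length 2. Hence the sampled value exceeds \<open>P\<close>
  by \<open>\<epsilon>\<close> with probability at most \<open>exp (- \<epsilon>\<^sup>2 D M / (2 K))\<close>, which for \<open>D\<close> of
  order \<open>1 / \<epsilon>\<^sup>2\<close> beats the union bound over the at most \<open>q\<^sup>K\<^sup>M\<close> assignments of the copies.

  The bound on the degree degenerates for \<open>\<delta>\<close> close to 1, but if \<open>\<alpha> - \<delta> < q\<^sup>-\<^sup>K\<close>, then a derandomized
  uniform assignment is good enough.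
\<close>

section \<open>Polynomial-time computable functions\<close>

text \<open>Independent sampling would equalize the degrees only approximately; emptying urns makes
  them exact, at the price of a dependent sample. Its conditional expectations stay simple because
  the variables of a scope are distinct: a single constraint always sees independent uniform draws
  from the current urns, and linearity does the rest. Distinctness also ensures that no copy occurs
  twice in a sampled scope.

  The sampling error is additive, a multiple of the number of constraints. It becomes multiplicative
  because a uniform assignment satisfies each remaining constraint with probability at least q^-K,
  \<open>K\<close> bounding the arities. The optimum is thus at least a q^-K fraction of the total,
  and \<epsilon> is taken to be \<delta> / (2 q^K).

  The randomness is a single number read in mixed radix. The number of outcomes is a product of urn
  sizes and rarely a power of two; reading random bits modulo it costs a factor 2 in the failure
  probability. Having at least as many constraints as variables turns a tail exponential in the
  former into 2^-n.\<close>

class encodable =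
  fixes enc :: "'a \<Rightarrow> data"

instantiation nat :: encodable
begin
definition enc_nat_eq [simp]: "enc = Num"
instance ..
end

instantiation bool :: encodable
begin
definition enc_bool_eq [simp]: "enc b = Num (of_bool b)"
instance ..
end

instantiation prod :: (encodable, encodable) encodable
begin
definition enc_prod_eq [simp]: "enc z = Pr (enc (fst z)) (enc (snd z))"
instance ..
end

instantiation list :: (encodable) encodable
begin
definition enc_list_eq [simp]: "enc xs = enc_list (map enc xs)"
instance ..
end

text \<open>The bound is required for every value of the type, not only for encodings of instances.
  Several definitions below have an unusual form because they must stay polynomial on malformed data
  too.\<close>

definition ptime :: "('a::encodable \<Rightarrow> 'b::encodable) \<Rightarrow> bool" where
  "ptime f \<longleftrightarrow> (\<exists>p. \<exists>b :: nat poly. \<forall>x. \<exists>t. run p (enc x) (enc (f x)) t \<and> t \<le> poly b (dsize (enc x)))"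

abbreviation esize :: "'a::encodable \<Rightarrow> nat" where
  "esize x \<equiv> dsize (enc x)"

lemma dsize_pos [simp]: "0 < dsize d"
  by (cases d) auto

lemma poly_nat_mono: "m \<le> n \<Longrightarrow> poly (p :: nat poly) m \<le> poly p n"
  by (induction p) (auto intro!: add_mono mult_mono)

lemma ptimeI:
  assumes "\<And>x. \<exists>t. run p (enc x) (enc (f x)) t \<and> t \<le> poly b (esize x)"
  shows "ptime f"
  using assms unfolding ptime_def by blast

lemma ptime_esize_bound:
  assumes "ptime f"
  obtains b :: "nat poly" where "\<And>x. esize (f x) \<le> poly b (esize x)"
  using assms unfolding ptime_def by (meson dsize_le_time le_trans)

lemma ptime_prim:
  assumes "\<And>x. prim_app f (enc x) = enc (g x)" "\<And>x. esize (g x) \<le> poly b (esize x)"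
  shows "ptime g"
proof (rule ptimeI[where p = "Prim f" and b = "[:1, 1:] + b"])
  fix x
  have "run (Prim f) (enc x) (enc (g x)) (1 + esize x + esize (g x))"
    using run_Prim[of f "enc x"] by (simp only: assms)
  then show "\<exists>t. run (Prim f) (enc x) (enc (g x)) t \<and> t \<le> poly ([:1, 1:] + b) (esize x)"
    using assms(2)[of x] by (intro exI conjI) (auto simp: algebra_simps)
qed

lemma ptime_id: "ptime (\<lambda>x. x)"
  by (rule ptime_prim[where f = Id and b = "[:0, 1:]"]) auto

text \<open>The intermediate value is no larger than the time spent on producing it, so composing
  the two polynomials suffices.\<close>

lemma ptime_comp:
  assumes "ptime f" "ptime g"
  shows "ptime (\<lambda>x. f (g x))"
proof -
  obtain p b where p: "\<And>x. \<exists>t. run p (enc x) (enc (f x)) t \<and> t \<le> poly b (esize x)"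
    using assms(1) unfolding ptime_def by blast
  obtain p' b' where p': "\<And>x. \<exists>t. run p' (enc x) (enc (g x)) t \<and> t \<le> poly b' (esize x)"
    using assms(2) unfolding ptime_def by blast
  show ?thesis
  proof (rule ptimeI[where p = "Seq p' p" and b = "1 + b' + pcompose b b'"])
    fix x
    obtain t where t: "run p' (enc x) (enc (g x)) t" "t \<le> poly b' (esize x)"
      using p' by blast
    obtain u where u: "run p (enc (g x)) (enc (f (g x))) u" "u \<le> poly b (esize (g x))"
      using p by blast
    have "esize (g x) \<le> poly b' (esize x)"
      using dsize_le_time[OF t(1)] t(2) by linarith
    then have "u \<le> poly (pcompose b b') (esize x)"
      using u(2) poly_nat_mono[of "esize (g x)" "poly b' (esize x)" b] by (simp add: poly_pcompose)
    then show "\<exists>t. run (Seq p' p) (enc x) (enc (f (g x))) t \<and> t \<le> poly (1 + b' + pcompose b b') (esize x)"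
      using run_Seq[OF t(1) u(1)] t(2) by (intro exI conjI) auto
  qed
qed

lemma ptime_Pair:
  assumes "ptime f" "ptime g"
  shows "ptime (\<lambda>x. (f x, g x))"
proof -
  obtain p b where p: "\<And>x. \<exists>t. run p (enc x) (enc (f x)) t \<and> t \<le> poly b (esize x)"
    using assms(1) unfolding ptime_def by blast
  obtain p' b' where p': "\<And>x. \<exists>t. run p' (enc x) (enc (g x)) t \<and> t \<le> poly b' (esize x)"
    using assms(2) unfolding ptime_def by blast
  show ?thesis
  proof (rule ptimeI[where p = "Fork p p'" and b = "1 + b + b'"])
    fix x
    obtain t where t: "run p (enc x) (enc (f x)) t" "t \<le> poly b (esize x)"
      using p by blast
    obtain u where u: "run p' (enc x) (enc (g x)) u" "u \<le> poly b' (esize x)"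
      using p' by blast
    show "\<exists>t. run (Fork p p') (enc x) (enc (f x, g x)) t \<and> t \<le> poly (1 + b + b') (esize x)"
      using run_Fork[OF t(1) u(1)] t(2) u(2) by (intro exI conjI) auto
  qed
qed

fun literal :: "data \<Rightarrow> prog" where
  "literal (Num n) = Prim (Lit n)"
| "literal (Pr d e) = Fork (literal d) (literal e)"

lemma run_literal: "\<exists>b :: nat poly. \<forall>x. \<exists>t. run (literal d) x d t \<and> t \<le> poly b (dsize x)"
proof (induction d)
  case (Num n)
  show ?case
  proof (intro exI allI conjI)
    fix x
    show "run (literal (Num n)) x (Num n) (1 + dsize x + dsize (Num n))"
      using run_Prim[of "Lit n" x] by simp
    show "1 + dsize x + dsize (Num n) \<le> poly [:1 + dsize (Num n), 1:] (dsize x)"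
      by simp
  qed
next
  case (Pr d e)
  then obtain b b' :: "nat poly" where b: "\<forall>x. \<exists>t. run (literal d) x d t \<and> t \<le> poly b (dsize x)"
    "\<forall>x. \<exists>t. run (literal e) x e t \<and> t \<le> poly b' (dsize x)"
    by blast
  have "\<exists>t. run (literal (Pr d e)) x (Pr d e) t \<and> t \<le> poly (1 + b + b') (dsize x)" for x
  proof -
    obtain t u where tu: "run (literal d) x d t" "t \<le> poly b (dsize x)"
       "run (literal e) x e u" "u \<le> poly b' (dsize x)"
      using b by blast
    show ?thesis
      using run_Fork[OF tu(1,3)] tu(2,4) by (intro exI[of _ "1 + t + u"] conjI) auto
  qed
  then show ?case by blast
qed

lemma ptime_const: "ptime (\<lambda>x. c)"
  using run_literal[of "enc c"] unfolding ptime_def by blast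

lemma ptime_if:
  assumes "ptime c" "ptime f" "ptime g"
  shows "ptime (\<lambda>x. if c x then f x else g x)"
proof -
  obtain p b where p: "\<And>x. \<exists>t. run p (enc x) (enc (f x)) t \<and> t \<le> poly b (esize x)"
    using assms(2) unfolding ptime_def by blast
  obtain p' b' where p': "\<And>x. \<exists>t. run p' (enc x) (enc (g x)) t \<and> t \<le> poly b' (esize x)"
    using assms(3) unfolding ptime_def by blast
  obtain p0 b0 where p0: "\<And>x. \<exists>t. run p0 (enc x) (enc (c x)) t \<and> t \<le> poly b0 (esize x)"
    using assms(1) unfolding ptime_def by blast
  show ?thesis
  proof (rule ptimeI[where p = "Cond p0 p p'" and b = "1 + b0 + b + b'"])
    fix x
    obtain s where s: "run p0 (enc x) (Num (of_bool (c x))) s" "s \<le> poly b0 (esize x)"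
      using p0[of x] by auto
    obtain t where t: "run p (enc x) (enc (f x)) t" "t \<le> poly b (esize x)"
      using p by blast
    obtain u where u: "run p' (enc x) (enc (g x)) u" "u \<le> poly b' (esize x)"
      using p' by blast
    show "\<exists>t. run (Cond p0 p p') (enc x) (enc (if c x then f x else g x)) t \<and> t \<le> poly (1 + b0 + b + b') (esize x)"
    proof (cases "c x")
      case True
      then show ?thesis
        using run_Cond_True[OF s(1) _ t(1)] s t u by (intro exI[of _ "1 + s + t"] conjI) auto
    next
      case False
      then show ?thesis
        using run_Cond_False[of p0 "enc x" s p' "enc (g x)" u] s t u by (intro exI[of _ "1 + s + u"] conjI) auto
    qed
  qed
qed

text \<open>Stated for a composed argument, like most rules below, so that resolution can follow the
  syntax of an expression down to its input.\<close>

lemma ptime_fst: "ptime f \<Longrightarrow> ptime (\<lambda>x. fst (f x))"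
  by (rule ptime_comp[where f = fst], rule ptime_prim[where f = Fst and b = "[:0, 1:]"]) auto

lemma ptime_snd: "ptime f \<Longrightarrow> ptime (\<lambda>x. snd (f x))"
  by (rule ptime_comp[where f = snd], rule ptime_prim[where f = Snd and b = "[:0, 1:]"]) auto

section \<open>Arithmetic, comparisons and Boolean connectives\<close>

lemma floorlog2_le_iff: "floorlog 2 n \<le> k \<longleftrightarrow> n < 2 ^ k"
  using floorlog_leD[of 2 n k] floorlog_leI[of n 2 k] by auto

lemma less_power_floorlog: "n < 2 ^ floorlog 2 n"
  using floorlog2_le_iff by blast

lemma floorlog_add_le: "floorlog 2 (m + n) \<le> 1 + floorlog 2 m + floorlog 2 n"
proof -
  have "m + n < 2 ^ floorlog 2 m + 2 ^ floorlog 2 n"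
    using less_power_floorlog add_strict_mono by blast
  also have "\<dots> \<le> 2 ^ (floorlog 2 m + floorlog 2 n) + 2 ^ (floorlog 2 m + floorlog 2 n)"
    by (intro add_mono power_increasing) auto
  finally show ?thesis
    by (simp add: floorlog2_le_iff)
qed

lemma floorlog_mult_le: "floorlog 2 (m * n) \<le> floorlog 2 m + floorlog 2 n"
  unfolding floorlog2_le_iff power_add
  by (intro mult_strict_mono' less_power_floorlog) auto

lemma ptime_add:
  assumes "ptime f" "ptime g" shows "ptime (\<lambda>x. f x + g x :: nat)"
proof -
  have "ptime (\<lambda>z. fst z + snd z :: nat)"
    by (rule ptime_prim[where f = Add and b = "[:2, 1:]"])
      (auto simp: le_SucI floorlog_add_le intro: order.trans[OF floorlog_add_le])
  from ptime_comp[OF this ptime_Pair[OF assms]] show ?thesis by simp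
qed

lemma ptime_mult:
  assumes "ptime f" "ptime g" shows "ptime (\<lambda>x. f x * g x :: nat)"
proof -
  have "ptime (\<lambda>z. fst z * snd z :: nat)"
    by (rule ptime_prim[where f = Mul and b = "[:2, 1:]"])
      (auto intro: order.trans[OF floorlog_mult_le])
  from ptime_comp[OF this ptime_Pair[OF assms]] show ?thesis by simp
qed

lemma ptime_div:
  assumes "ptime f" "ptime g" shows "ptime (\<lambda>x. f x div g x :: nat)"
proof -
  have "ptime (\<lambda>z. fst z div snd z :: nat)"
    by (rule ptime_prim[where f = Div and b = "[:2, 1:]"])
      (auto intro: order.trans[OF floorlog_mono[OF div_le_dividend]])
  from ptime_comp[OF this ptime_Pair[OF assms]] show ?thesis by simp
qed

lemma ptime_diff:
  assumes "ptime f" "ptime g" shows "ptime (\<lambda>x. f x - g x :: nat)"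
proof -
  have "ptime (\<lambda>z. fst z - snd z :: nat)"
    by (rule ptime_prim[where f = Sub and b = "[:2, 1:]"])
      (auto intro: order.trans[OF floorlog_mono[OF diff_le_self]])
  from ptime_comp[OF this ptime_Pair[OF assms]] show ?thesis by simp
qed

lemma ptime_mod:
  assumes "ptime f" "ptime g" shows "ptime (\<lambda>x. f x mod g x :: nat)"
  unfolding minus_div_mult_eq_mod[symmetric] by (intro ptime_diff ptime_mult ptime_div assms)

lemma esize_bool: "esize (b :: bool) \<le> 2"
  by (cases b) (auto simp: floorlog2_le_iff)

lemma ptime_less:
  assumes "ptime f" "ptime g" shows "ptime (\<lambda>x. f x < (g x :: nat))"
proof -
  have "ptime (\<lambda>z. fst z < (snd z :: nat))"
    by (rule ptime_prim[where f = Less and b = "[:2:]"]) (use esize_bool in auto)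
  from ptime_comp[OF this ptime_Pair[OF assms]] show ?thesis by simp
qed

lemma ptime_Not:
  assumes "ptime b" shows "ptime (\<lambda>x. \<not> b x)"
proof -
  have "(\<lambda>x. \<not> b x) = (\<lambda>x. if b x then False else True)" by auto
  then show ?thesis
    using assms by (simp only: ptime_if ptime_const)
qed

lemma ptime_conj:
  assumes "ptime b" "ptime c" shows "ptime (\<lambda>x. b x \<and> c x)"
proof -
  have "(\<lambda>x. b x \<and> c x) = (\<lambda>x. if b x then c x else False)" by auto
  then show ?thesis
    using assms by (simp only: ptime_if ptime_const)
qed

lemma ptime_of_bool: "ptime b \<Longrightarrow> ptime (\<lambda>x. of_bool (b x) :: nat)"
  by (rule ptime_comp[where f = of_bool], rule ptime_prim[where f = Id and b = "[:0, 1:]"]) auto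

lemma ptime_le: "ptime f \<Longrightarrow> ptime g \<Longrightarrow> ptime (\<lambda>x. f x \<le> (g x :: nat))"
  unfolding not_less[symmetric] by (intro ptime_Not ptime_less)

lemma ptime_nat_eq: "ptime f \<Longrightarrow> ptime g \<Longrightarrow> ptime (\<lambda>x. f x = (g x :: nat))"
  unfolding eq_iff by (intro ptime_conj ptime_le)

section \<open>Lists and loops\<close>

lemma ptime_Cons: "ptime f \<Longrightarrow> ptime g \<Longrightarrow> ptime (\<lambda>x. f x # g x)"
  by (rule ptime_comp[where f = "\<lambda>z. fst z # snd z" and g = "\<lambda>x. (f x, g x)", simplified fst_conv snd_conv])
    (auto intro!: ptime_prim[where f = Id and b = "[:0, 1:]"] ptime_Pair)

lemma ptime_null: "ptime f \<Longrightarrow> ptime (\<lambda>x. f x = [])"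
proof (rule ptime_comp[where f = "\<lambda>xs. xs = []"])
  show "ptime (\<lambda>xs :: 'b list. xs = [])"
  proof (rule ptime_prim[where f = IsNum and b = "[:2:]"])
    fix xs :: "'b list"
    show "prim_app IsNum (enc xs) = enc (xs = [])"
      by (cases xs) auto
  qed (use esize_bool in auto)
qed

lemma ptime_tl: "ptime f \<Longrightarrow> ptime (\<lambda>x. tl (f x))"
proof (rule ptime_comp[where f = tl])
  show "ptime (tl :: 'b list \<Rightarrow> _)"
  proof (rule ptime_prim[where f = Snd and b = "[:0, 1:]"])
    fix xs :: "'b list"
    show "prim_app Snd (enc xs) = enc (tl xs)" "esize (tl xs) \<le> poly [:0, 1:] (esize xs)"
      by (cases xs; simp)+
  qed
qed

text \<open>\<open>hd []\<close> is unspecified but constant, so a literal computes it.\<close>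

lemma ptime_hd: "ptime f \<Longrightarrow> ptime (\<lambda>x. hd (f x))"
proof (rule ptime_comp[where f = hd])
  show "ptime (hd :: 'b list \<Rightarrow> _)"
  proof -
    obtain c :: "nat poly" where c: "\<forall>x. \<exists>t. run (literal (enc (hd [] :: 'b))) x (enc (hd [] :: 'b)) t \<and> t \<le> poly c (dsize x)"
      using run_literal by blast
    let ?p = "Cond (Prim IsNum) (literal (enc (hd [] :: 'b))) (Prim Fst)"
    show ?thesis
    proof (rule ptimeI[where p = ?p and b = "[:5, 3:] + c"])
      fix xs :: "'b list"
      show "\<exists>t. run ?p (enc xs) (enc (hd xs)) t \<and> t \<le> poly ([:5, 3:] + c) (esize xs)"
      proof (cases xs)
        case Nil
        obtain t where "run (literal (enc (hd [] :: 'b))) (Num 0) (enc (hd [] :: 'b)) t" "t \<le> poly c (dsize (Num 0))"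
          using c by blast
        moreover have "run (Prim IsNum) (Num 0) (Num 1) (1 + dsize (Num 0) + dsize (Num 1))"
          using run_Prim[of IsNum "Num 0"] by simp
        ultimately show ?thesis
          using run_Cond_True[of "Prim IsNum" "Num 0" "Num 1" "1 + dsize (Num 0) + dsize (Num 1)"] esize_bool[of True]
          by (intro exI[of _ "1 + (1 + dsize (Num 0) + dsize (Num 1)) + t"]) (auto simp: Nil)
      next
        case (Cons y ys)
        have "run (Prim IsNum) (enc xs) (Num 0) (1 + esize xs + dsize (Num 0))"
          using run_Prim[of IsNum "enc xs"] by (simp add: Cons)
        moreover have "run (Prim Fst) (enc xs) (enc (hd xs)) (1 + esize xs + esize (hd xs))"
          using run_Prim[of Fst "enc xs"] by (simp add: Cons)
        ultimately have "run ?p (enc xs) (enc (hd xs)) (1 + (1 + esize xs + dsize (Num 0)) + (1 + esize xs + esize (hd xs)))"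
          by (rule run_Cond_False)
        then show ?thesis
          by (intro exI conjI) (assumption, simp add: Cons floorlog_def)
      qed
    qed
  qed
qed

text \<open>A common bound \<open>S\<close> on all intermediate states bounds the cost of every
  round uniformly, since polynomials over the naturals are monotone.\<close>

lemma run_While_funpow:
  fixes f :: "'a::encodable \<Rightarrow> 'a"
  assumes test: "\<And>x. \<exists>t. run c (enc x) (enc (T x)) t \<and> t \<le> poly b (esize x)"
    and body: "\<And>x. \<exists>t. run p (enc x) (enc (f x)) t \<and> t \<le> poly b' (esize x)"
    and T: "\<And>i. i < n \<Longrightarrow> T ((f ^^ i) x)" "\<not> T ((f ^^ n) x)"
    and size: "\<And>i. i \<le> n \<Longrightarrow> esize ((f ^^ i) x) \<le> S"
  shows "\<exists>t. run (While c p) (enc x) (enc ((f ^^ n) x)) t \<and> t \<le> (n + 1) * (1 + poly b S + poly b' S)"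
  using T size
proof (induction n arbitrary: x)
  case (0 x)
  obtain t where t: "run c (enc x) (enc (T x)) t" "t \<le> poly b (esize x)"
    using test by blast
  have "t \<le> poly b S"
    using t(2) poly_nat_mono[of "esize x" S b] 0(3)[of 0] by simp
  then show ?case
    using run_While_False[of c "enc x" t p] t 0(2) by auto
next
  case (Suc n x)
  obtain t where t: "run c (enc x) (enc (T x)) t" "t \<le> poly b (esize x)"
    using test by blast
  obtain u where u: "run p (enc x) (enc (f x)) u" "u \<le> poly b' (esize x)"
    using body by blast
  have le: "t \<le> poly b S" "u \<le> poly b' S"
    using t(2) u(2) poly_nat_mono[of "esize x" S] Suc.prems(3)[of 0] by (meson le_trans funpow_0 zero_le order.refl | simp)+
  have "\<exists>t. run (While c p) (enc (f x)) (enc ((f ^^ n) (f x))) t \<and> t \<le> (n + 1) * (1 + poly b S + poly b' S)"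
  proof (rule Suc.IH)
    show "T ((f ^^ i) (f x))" if "i < n" for i
      using Suc.prems(1)[of "Suc i"] that by (simp add: funpow_swap1)
    show "\<not> T ((f ^^ n) (f x))"
      using Suc.prems(2) by (simp add: funpow_swap1)
    show "esize ((f ^^ i) (f x)) \<le> S" if "i \<le> n" for i
      using Suc.prems(3)[of "Suc i"] that by (simp add: funpow_swap1)
  qed
  then obtain v where v: "run (While c p) (enc (f x)) (enc ((f ^^ n) (f x))) v" "v \<le> (n + 1) * (1 + poly b S + poly b' S)"
    by blast
  have "enc (T x) \<noteq> Num 0"
    using Suc.prems(1)[of 0] by simp
  from run_While_True[OF t(1) this u(1) v(1)] show ?case
    using le v(2) by (intro exI[of _ "1 + t + u + v"]) (auto simp: funpow_swap1 algebra_simps)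
qed

text \<open>Sizes of all intermediate states are bounded by hypothesis: a polynomial-time body alone
  could double its state in every round.\<close>

lemma ptime_while:
  fixes f :: "'a::encodable \<Rightarrow> 'a" and b :: "nat poly"
  assumes "ptime T" "ptime f"
    and "\<And>x i. i < N x \<Longrightarrow> T ((f ^^ i) x)" "\<And>x. \<not> T ((f ^^ N x) x)"
    and bound: "\<And>x. N x \<le> esize x" "\<And>x i. i \<le> N x \<Longrightarrow> esize ((f ^^ i) x) \<le> poly b (esize x)"
  shows "ptime (\<lambda>x. (f ^^ N x) x)"
proof -
  obtain p c where p: "\<And>x. \<exists>t. run p (enc x) (enc (T x)) t \<and> t \<le> poly c (esize x)"
    using assms(1) unfolding ptime_def by blast
  obtain p' c' where p': "\<And>x. \<exists>t. run p' (enc x) (enc (f x)) t \<and> t \<le> poly c' (esize x)"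
    using assms(2) unfolding ptime_def by blast
  show ?thesis
  proof (rule ptimeI[where p = "While p p'" and b = "[:1, 1:] * (1 + pcompose c b + pcompose c' b)"])
    fix x
    obtain t where t: "run (While p p') (enc x) (enc ((f ^^ N x) x)) t"
      "t \<le> (N x + 1) * (1 + poly c (poly b (esize x)) + poly c' (poly b (esize x)))"
      using run_While_funpow[where T = T and f = f and n = "N x" and x = x and S = "poly b (esize x)",
          OF p p' assms(3) assms(4) bound(2)] by blast
    note t(2)
    also have "\<dots> \<le> (esize x + 1) * (1 + poly c (poly b (esize x)) + poly c' (poly b (esize x)))"
      using bound(1)[of x] by (intro mult_right_mono) auto
    also have "\<dots> = poly ([:1, 1:] * (1 + pcompose c b + pcompose c' b)) (esize x)"
      by (simp add: poly_pcompose)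
    finally show "\<exists>t. run (While p p') (enc x) (enc ((f ^^ N x) x)) t \<and>
        t \<le> poly ([:1, 1:] * (1 + pcompose c b + pcompose c' b)) (esize x)"
      using t(1) by blast
  qed
qed

lemma esize_Cons [simp]: "esize (x # xs) = 1 + esize x + esize xs"
  by simp

lemma length_le_esize: "length xs \<le> esize xs"
  by (induction xs) auto

lemma esize_drop: "esize (drop n xs) \<le> esize xs"
proof (induction xs arbitrary: n)
  case (Cons x xs)
  show ?case
  proof (cases n)
    case (Suc k)
    then show ?thesis using Cons[of k] by simp
  qed simp
qed simp

text \<open>The loop state holds the environment \<open>e\<close>, which the step may consult, the
  accumulator and the rest of the list.\<close>

lemma ptime_foldl_pair:
  fixes step :: "'e::encodable \<Rightarrow> 's::encodable \<Rightarrow> 'a::encodable \<Rightarrow> 's" and b :: "nat poly"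
  assumes step: "ptime (\<lambda>z. step (fst z) (fst (snd z)) (snd (snd z)))"
    and bound: "\<And>e s xs i. i \<le> length xs \<Longrightarrow> esize (foldl (step e) s (take i xs)) \<le> poly b (esize (e, s, xs))"
  shows "ptime (\<lambda>z. foldl (step (fst z)) (fst (snd z)) (snd (snd z)))"
proof -
  define f where "f = (\<lambda>z :: 'e \<times> 's \<times> 'a list. (fst z, step (fst z) (fst (snd z)) (hd (snd (snd z))), tl (snd (snd z))))"
  have iter: "(f ^^ i) z = (fst z, foldl (step (fst z)) (fst (snd z)) (take i (snd (snd z))), drop i (snd (snd z)))"
    if "i \<le> length (snd (snd z))" for i z
    using that
  proof (induction i)
    case (Suc i)
    then show ?case
      by (simp add: f_def take_Suc_conv_app_nth hd_drop_conv_nth drop_Suc tl_drop)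
  qed simp
  have step': "ptime (\<lambda>z :: 'e \<times> 's \<times> 'a list. step (fst z) (fst (snd z)) (hd (snd (snd z))))"
    using ptime_comp[OF step, where g = "\<lambda>z :: 'e \<times> 's \<times> 'a list. (fst z, fst (snd z), hd (snd (snd z)))"]
    by (simp add: ptime_Pair ptime_fst ptime_snd ptime_hd ptime_id)
  have "ptime (\<lambda>z. (f ^^ length (snd (snd z))) z)"
  proof (rule ptime_while[where T = "\<lambda>z. snd (snd z) \<noteq> []" and b = "[:1, 1:] + [:0, 1:] + b"])
    show "ptime (\<lambda>z :: 'e \<times> 's \<times> 'a list. snd (snd z) \<noteq> [])"
      by (intro ptime_Not ptime_null ptime_snd ptime_id)
    show "ptime f"
      unfolding f_def by (intro ptime_Pair ptime_fst ptime_id ptime_tl ptime_snd step')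
  next
    fix z :: "'e \<times> 's \<times> 'a list" and i
    assume "i < length (snd (snd z))"
    then show "snd (snd ((f ^^ i) z)) \<noteq> []"
      by (simp add: iter)
  next
    fix z :: "'e \<times> 's \<times> 'a list"
    show "\<not> snd (snd ((f ^^ length (snd (snd z))) z)) \<noteq> []"
      by (simp add: iter)
    show "length (snd (snd z)) \<le> esize z"
      using length_le_esize[of "snd (snd z)"] by simp
  next
    fix z :: "'e \<times> 's \<times> 'a list" and i
    assume i: "i \<le> length (snd (snd z))"
    have "esize (foldl (step (fst z)) (fst (snd z)) (take i (snd (snd z)))) \<le> poly b (esize z)"
      using bound[OF i, of "fst z" "fst (snd z)"] by simp
    then show "esize ((f ^^ i) z) \<le> poly ([:1, 1:] + [:0, 1:] + b) (esize z)"
      using iter[OF i] esize_drop[of i "snd (snd z)"] by simp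
  qed
  from ptime_fst[OF ptime_snd[OF this]] show ?thesis
    by (simp add: iter)
qed

text \<open>The amount by which a step may enlarge the accumulator does not depend on the
  accumulator. Summed over the list this stays polynomial, whereas a constant growth factor would
  not.\<close>

lemma ptime_foldl:
  fixes step :: "'e::encodable \<Rightarrow> 's::encodable \<Rightarrow> 'a::encodable \<Rightarrow> 's" and b :: "nat poly"
  assumes "ptime (\<lambda>z. step (fst z) (fst (snd z)) (snd (snd z)))"
    and growth: "\<And>e s x. esize (step e s x) \<le> esize s + poly b (esize e + esize x)"
    and "ptime s" "ptime xs"
  shows "ptime (\<lambda>e. foldl (step e) (s e) (xs e))"
proof -
  have "esize (foldl (step e) s xs) \<le> esize s + length xs * poly b (esize e + esize xs)" for e s xs
  proof (induction xs arbitrary: s)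
    case (Cons x xs)
    have 1: "poly b (esize e + esize xs) \<le> poly b (esize e + esize (x # xs))"
      "poly b (esize e + esize x) \<le> poly b (esize e + esize (x # xs))"
      by (intro poly_nat_mono; simp)+
    have "esize (foldl (step e) s (x # xs)) \<le> esize (step e s x) + length xs * poly b (esize e + esize xs)"
      using Cons[of "step e s x"] by simp
    also have "\<dots> \<le> esize s + poly b (esize e + esize (x # xs)) + length xs * poly b (esize e + esize (x # xs))"
      using growth[of e s x] 1 by (intro add_mono mult_left_mono) auto
    finally show ?case by simp
  qed simp
  note * = this
  have bnd: "esize (foldl (step e) s (take i xs)) \<le> poly ([:0, 1:] + [:0, 1:] * b) (esize (e, s, xs))" for e s xs i
  proof -
    have tk: "esize (take i xs) \<le> esize xs"
    proof (induction xs arbitrary: i)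
      case (Cons x xs)
      show ?case using Cons[of "i - 1"] by (cases i) auto
    qed simp
    have "esize (foldl (step e) s (take i xs)) \<le> esize s + length (take i xs) * poly b (esize e + esize (take i xs))"
      by (rule *)
    also have "\<dots> \<le> esize (e, s, xs) + esize (e, s, xs) * poly b (esize (e, s, xs))"
      using tk length_le_esize[of "take i xs"] by (intro add_mono mult_mono poly_nat_mono) auto
    finally show ?thesis by simp
  qed
  from ptime_comp[OF ptime_foldl_pair[OF assms(1) bnd], of "\<lambda>e. (e, s e, xs e)"] show ?thesis
    using assms(3,4) by (simp add: ptime_Pair ptime_id)
qed

section \<open>Maps with a threaded state, and the list functions derived from them\<close>

fun mapaccum :: "('s \<Rightarrow> 'a \<Rightarrow> 'b \<times> 's) \<Rightarrow> 's \<Rightarrow> 'a list \<Rightarrow> 'b list" where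
  "mapaccum f s [] = []"
| "mapaccum f s (x # xs) = fst (f s x) # mapaccum f (snd (f s x)) xs"

named_theorems ptime_intros

lemmas [ptime_intros] = ptime_id ptime_const ptime_Pair ptime_fst ptime_snd ptime_if ptime_add
  ptime_mult ptime_div ptime_mod ptime_less ptime_le ptime_nat_eq ptime_Not ptime_conj ptime_of_bool
  ptime_Cons ptime_null ptime_hd ptime_tl

lemma ptime_disj [ptime_intros]:
  assumes "ptime b" "ptime c" shows "ptime (\<lambda>x. b x \<or> c x)"
proof -
  have "(\<lambda>x. b x \<or> c x) = (\<lambda>x. if b x then True else c x)" by auto
  then show ?thesis
    using assms by (simp only: ptime_if ptime_const)
qed

lemma esize_append: "esize (xs @ ys) + 1 = esize xs + esize ys"
  by (induction xs) (auto simp: floorlog_def)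

lemma ptime_rev_append: "ptime f \<Longrightarrow> ptime g \<Longrightarrow> ptime (\<lambda>x. rev (f x) @ g x)"
proof -
  assume *: "ptime f" "ptime g"
  have "foldl (\<lambda>acc x. x # acc) ys xs = rev xs @ ys" for xs ys :: "'b list"
    by (induction xs arbitrary: ys) auto
  then show ?thesis
    using ptime_foldl[where step = "\<lambda>_ acc x. x # acc" and b = "[:1, 1:]", OF _ _ *(2,1)]
    by (simp add: ptime_intros)
qed

lemma ptime_rev [ptime_intros]: "ptime f \<Longrightarrow> ptime (\<lambda>x. rev (f x))"
  using ptime_rev_append[OF _ ptime_const[of "[]"], of f] by simp

lemma ptime_append [ptime_intros]: "ptime f \<Longrightarrow> ptime g \<Longrightarrow> ptime (\<lambda>x. f x @ g x)"
  using ptime_rev_append[OF ptime_rev, of f g] by simp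

lemma ptime_concat [ptime_intros]:
  assumes "ptime f" shows "ptime (\<lambda>x. concat (f x))"
proof -
  have "foldl (@) ys xs = ys @ concat xs" for xs and ys :: "'b list"
    by (induction xs arbitrary: ys) auto
  moreover have "ptime (\<lambda>e. foldl (@) [] (f e))"
  proof (rule ptime_foldl[where step = "\<lambda>_ acc x. acc @ x" and b = "[:0, 1:]"])
    fix e :: 'a and s x :: "'b list"
    show "esize (s @ x) \<le> esize s + poly [:0, 1:] (esize e + esize x)"
      using esize_append[of s x] by simp
  qed (intro ptime_intros assms)+
  ultimately show ?thesis by simp
qed

text \<open>Only the threaded state has to grow slowly. The outputs are collected beside it and
  never fed back, so each may be as large as the running time of \<open>f\<close> permits.\<close>

lemma ptime_mapaccum:
  fixes f :: "'e::encodable \<Rightarrow> 's::encodable \<Rightarrow> 'a::encodable \<Rightarrow> 'b::encodable \<times> 's" and b :: "nat poly"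
  assumes f: "ptime (\<lambda>z. f (fst z) (fst (snd z)) (snd (snd z)))"
    and growth: "\<And>e s x. esize (snd (f e s x)) \<le> esize s + poly b (esize e + esize x)"
    and s: "ptime s" and xs: "ptime xs"
  shows "ptime (\<lambda>e. mapaccum (f e) (s e) (xs e))"
proof -
  define step where "step = (\<lambda>e st x. (snd (f e (fst st) x), fst (f e (fst st) x) # snd st))"
  obtain c where c: "\<And>z. esize (f (fst z) (fst (snd z)) (snd (snd z))) \<le> poly c (esize z)"
    using ptime_esize_bound[OF f] by blast
  \<comment> \<open>A bound for the state throughout: it starts below \<open>n\<close>, and each of
    at most \<open>n\<close> steps adds at most \<open>poly b n\<close>.\<close>
  define S where "S n = n + n * poly b n" for n
  have inv: "esize (fst (foldl (step e) st (take i xs))) \<le> n + i * poly b n \<and>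
      esize (snd (foldl (step e) st (take i xs))) \<le> n + i * (1 + poly c (2 + n + S n + n))"
    if "i \<le> length xs" and n: "n = esize (e, st, xs)" for e st xs i n
    using that(1)
  proof (induction i)
    case (Suc i)
    let ?st = "foldl (step e) st (take i xs)"
    have i: "i < length xs" using Suc.prems by simp
    have x: "esize e + esize (xs ! i) \<le> n"
    proof -
      have "esize (xs ! i) \<le> esize (drop i xs)"
        using i by (simp flip: Cons_nth_drop_Suc)
      then show ?thesis using esize_drop[of i xs] by (simp add: n)
    qed
    have IH: "esize (fst ?st) \<le> n + i * poly b n" "esize (snd ?st) \<le> n + i * (1 + poly c (2 + n + S n + n))"
      using Suc by simp_all
    have "poly b (esize e + esize (xs ! i)) \<le> poly b n"
      using x by (rule poly_nat_mono)
    then have 1: "esize (snd (f e (fst ?st) (xs ! i))) \<le> n + Suc i * poly b n"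
      using growth[of e "fst ?st" "xs ! i"] IH(1) by simp
    have "length xs \<le> n"
      using length_le_esize[of xs] by (simp add: n)
    then have "i * poly b n \<le> n * poly b n"
      using i by (intro mult_right_mono) auto
    then have "esize (fst ?st) \<le> S n"
      using IH(1) unfolding S_def by linarith
    then have "esize (e, fst ?st, xs ! i) \<le> 2 + n + S n + n"
      using x by simp
    then have "esize (f e (fst ?st) (xs ! i)) \<le> poly c (2 + n + S n + n)"
      using c[of "(e, fst ?st, xs ! i)"] poly_nat_mono[of _ _ c, THEN [2] le_trans]
      by (simp del: enc_prod_eq)
    then have "esize (fst (f e (fst ?st) (xs ! i))) \<le> poly c (2 + n + S n + n)"
      by simp
    then have 2: "esize (fst (f e (fst ?st) (xs ! i)) # snd ?st) \<le> n + Suc i * (1 + poly c (2 + n + S n + n))"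
      using IH(2) by simp
    show ?case
      using 1 2 i by (simp add: take_Suc_conv_app_nth step_def)
  qed (simp add: n)
  have "ptime (\<lambda>z. foldl (step (fst z)) (fst (snd z)) (snd (snd z)))"
  proof (rule ptime_foldl_pair[where b = "1 + ([:0,1:] + [:0,1:] * b) + ([:0,1:] + [:0,1:] * (1 + pcompose c ([:2,3:] + [:0,1:] * b)))"])
    have *: "ptime (\<lambda>z :: 'e \<times> ('s \<times> 'b list) \<times> 'a. f (fst z) (fst (fst (snd z))) (snd (snd z)))"
      using ptime_comp[OF f, where g = "\<lambda>z :: 'e \<times> ('s \<times> 'b list) \<times> 'a. (fst z, fst (fst (snd z)), snd (snd z))"]
      by (simp add: ptime_intros)
    show "ptime (\<lambda>z. step (fst z) (fst (snd z)) (snd (snd z)))"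
      unfolding step_def by (intro ptime_intros *)
  next
    fix e :: 'e and st :: "'s \<times> 'b list" and xs :: "'a list" and i
    assume i: "i \<le> length xs"
    define n where "n = esize (e, st, xs)"
    have "i \<le> n"
      using i length_le_esize[of xs] by (simp add: n_def)
    then have mono: "n + i * k \<le> n + n * k" for k :: nat
      by (intro add_left_mono mult_right_mono) simp_all
    have "esize (fst (foldl (step e) st (take i xs))) \<le> n + n * poly b n"
      "esize (snd (foldl (step e) st (take i xs))) \<le> n + n * (1 + poly c (2 + n + S n + n))"
      using inv[OF i n_def] mono le_trans by blast+
    moreover have "2 + n + S n + n = poly ([:2,3:] + [:0,1:] * b) n"
      by (simp add: S_def algebra_simps)
    ultimately have "esize (fst (foldl (step e) st (take i xs))) \<le> poly ([:0,1:] + [:0,1:] * b) n"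
      "esize (snd (foldl (step e) st (take i xs))) \<le> poly ([:0,1:] + [:0,1:] * (1 + pcompose c ([:2,3:] + [:0,1:] * b))) n"
      by (simp_all add: poly_pcompose)
    then show "esize (foldl (step e) st (take i xs)) \<le>
      poly (1 + ([:0,1:] + [:0,1:] * b) + ([:0,1:] + [:0,1:] * (1 + pcompose c ([:2,3:] + [:0,1:] * b)))) (esize (e, st, xs))"
      unfolding n_def[symmetric] by simp
  qed
  from ptime_comp[OF this, where g = "\<lambda>e. (e, (s e, []), xs e)"]
  have "ptime (\<lambda>e. foldl (step e) (s e, []) (xs e))"
    using s xs by (simp add: ptime_intros)
  then have "ptime (\<lambda>e. rev (snd (foldl (step e) (s e, []) (xs e))))"
    by (intro ptime_intros)
  moreover have "snd (foldl (step e) (s, ys) xs) = rev (mapaccum (f e) s xs) @ ys" for e s ys xs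
    by (induction xs arbitrary: s ys) (auto simp: step_def)
  ultimately show ?thesis by simp
qed

lemma mapaccum_const: "mapaccum (\<lambda>s x. (f x, s)) s xs = map f xs"
  by (induction xs) auto

lemma ptime_map [ptime_intros]:
  assumes "ptime (\<lambda>z. f (fst z) (snd z))" "ptime xs"
  shows "ptime (\<lambda>e. map (f e) (xs e))"
proof -
  have "ptime (\<lambda>e. mapaccum (\<lambda>s x. (f e x, s)) (0 :: nat) (xs e))"
  proof (rule ptime_mapaccum[where b = 0])
    show "ptime (\<lambda>z. (f (fst z) (snd (snd z)), fst (snd z) :: nat))"
      using ptime_comp[OF assms(1), where g = "\<lambda>z :: _ \<times> nat \<times> _. (fst z, snd (snd z))"]
      by (simp add: ptime_intros)
  qed (auto intro!: ptime_intros assms)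
  then show ?thesis by (simp only: mapaccum_const)
qed

lemma ptime_filter [ptime_intros]:
  assumes "ptime (\<lambda>z. P (fst z) (snd z))" "ptime xs"
  shows "ptime (\<lambda>e. filter (P e) (xs e))"
proof -
  have "filter Q ys = concat (map (\<lambda>y. if Q y then [y] else []) ys)" for Q and ys :: "'b list"
    by (induction ys) auto
  then show ?thesis by (simp only: ptime_intros assms)
qed

lemma ptime_length [ptime_intros]:
  assumes "ptime xs" shows "ptime (\<lambda>e. length (xs e))"
proof -
  have "foldl (\<lambda>n x. n + 1) m ys = m + length ys" for m :: nat and ys :: "'b list"
    by (induction ys arbitrary: m) auto
  moreover have "ptime (\<lambda>e. foldl (\<lambda>n x. n + 1) 0 (xs e) :: nat)"
  proof (rule ptime_foldl[where step = "\<lambda>_ n x. n + 1" and b = "[:2:]"])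
    show "esize (s + 1 :: nat) \<le> esize s + poly [:2:] (esize e + esize x)" for s :: nat and e :: 'a and x :: 'b
      using floorlog_add_le[of s 1] esize_bool[of True] by simp
  qed (intro ptime_intros assms)+
  ultimately show ?thesis by simp
qed

lemma ptime_sum_list [ptime_intros]:
  assumes "ptime xs" shows "ptime (\<lambda>e. sum_list (xs e) :: nat)"
proof -
  have "foldl (+) m ys = m + sum_list ys" for m :: nat and ys
    by (induction ys arbitrary: m) auto
  moreover have "ptime (\<lambda>e. foldl (+) 0 (xs e) :: nat)"
  proof (rule ptime_foldl[where step = "\<lambda>_. (+)" and b = "[:1, 1:]"])
    show "esize (s + x :: nat) \<le> esize s + poly [:1, 1:] (esize e + esize x)" for s x and e :: 'a
      using floorlog_add_le[of s x] by simp
  qed (intro ptime_intros assms)+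
  ultimately show ?thesis by simp
qed

lemma ptime_prod_list [ptime_intros]:
  assumes "ptime xs" shows "ptime (\<lambda>e. prod_list (xs e) :: nat)"
proof -
  have "foldl (*) m ys = m * prod_list ys" for m :: nat and ys
    by (induction ys arbitrary: m) auto
  moreover have "ptime (\<lambda>e. foldl (*) 1 (xs e) :: nat)"
  proof (rule ptime_foldl[where step = "\<lambda>_. (*)" and b = "[:1, 1:]"])
    show "esize (s * x :: nat) \<le> esize s + poly [:1, 1:] (esize e + esize x)" for s x and e :: 'a
      using floorlog_mult_le[of s x] by simp
  qed (intro ptime_intros assms)+
  ultimately show ?thesis by simp
qed

definition bits_to_nat :: "bool list \<Rightarrow> nat" where
  "bits_to_nat = foldl (\<lambda>n b. 2 * n + of_bool b) 0"

lemma ptime_bits_to_nat [ptime_intros]: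
  assumes "ptime r" shows "ptime (\<lambda>e. bits_to_nat (r e))"
  unfolding bits_to_nat_def
proof (rule ptime_foldl[where step = "\<lambda>_ n b. 2 * n + of_bool b" and b = "[:3, 1:]"])
  show "esize (2 * n + of_bool b :: nat) \<le> esize n + poly [:3, 1:] (esize e + esize b)" for n b and e :: 'a
  proof -
    have "floorlog 2 (2 * n + of_bool b) \<le> 1 + floorlog 2 (2 * n) + floorlog 2 (of_bool b)"
      by (rule floorlog_add_le)
    moreover have "floorlog 2 (2 * n) \<le> floorlog 2 2 + floorlog 2 n"
      by (rule floorlog_mult_le)
    moreover have "floorlog 2 2 \<le> 2"
      by (simp add: floorlog2_le_iff)
    ultimately show ?thesis by simp
  qed
qed (intro ptime_intros assms)+

lemma mapaccum_enumerate: "mapaccum (\<lambda>n x. ((n, x), Suc n)) n xs = List.enumerate n xs"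
  by (induction xs arbitrary: n) auto

lemma ptime_enumerate [ptime_intros]:
  assumes "ptime xs" shows "ptime (\<lambda>e. List.enumerate 0 (xs e))"
proof -
  have "ptime (\<lambda>e. mapaccum (\<lambda>n x. ((n, x), n + 1)) (0 :: nat) (xs e))"
  proof (rule ptime_mapaccum[where f = "\<lambda>_ n x. ((n, x), n + 1)" and b = "[:2:]"])
    show "esize (snd ((s, x), s + 1)) \<le> esize s + poly [:2:] (esize e + esize x)" for s :: nat and e :: 'a and x :: 'b
      using floorlog_add_le[of s 1] esize_bool[of True] by simp
  qed (intro ptime_intros assms)+
  then show ?thesis by (simp add: mapaccum_enumerate)
qed

text \<open>Only ranges up to the length of a list are available: for a number \<open>n\<close> in
  binary, \<open>[0..<n]\<close> is exponentially long.\<close>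

lemma ptime_upt [ptime_intros]:
  assumes "ptime xs" shows "ptime (\<lambda>e. [0..<length (xs e)])"
proof -
  have eq: "(\<lambda>e. [0..<length (xs e)]) = (\<lambda>e. map fst (List.enumerate 0 (xs e)))"
    by simp
  show ?thesis
    unfolding eq by (intro ptime_intros assms)
qed

text \<open>The number \<open>n e\<close> is in binary and may be exponential in the input size, so
  it cannot count the rounds of a loop. Filtering the positions of the list avoids this.\<close>

lemma ptime_drop [ptime_intros]:
  assumes "ptime n" "ptime xs" shows "ptime (\<lambda>e. drop (n e) (xs e))"
proof -
  have "map snd (filter (\<lambda>z. m \<le> fst z) (List.enumerate k ys)) = drop (m - k) ys" for m k and ys :: "'b list"
  proof (induction ys arbitrary: k)
    case (Cons y ys)
    show ?case
      using Cons[of "Suc k"] by (cases "m - k") (auto simp: Suc_diff_le diff_Suc split: nat.splits)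
  qed simp
  then have eq: "(\<lambda>e. drop (n e) (xs e)) = (\<lambda>e. map snd (filter (\<lambda>z. n e \<le> fst z) (List.enumerate 0 (xs e))))"
    by (metis diff_zero)
  show ?thesis
    unfolding eq by (intro ptime_intros ptime_comp[OF assms(1) ptime_fst[OF ptime_id]] assms(2))
qed

lemma ptime_take [ptime_intros]:
  assumes "ptime n" "ptime xs" shows "ptime (\<lambda>e. take (n e) (xs e))"
proof -
  have "take m ys = rev (drop (length ys - m) (rev ys))" for m and ys :: "'b list"
    by (cases "m \<le> length ys") (simp_all add: rev_drop)
  moreover have "ptime (\<lambda>e. rev (drop (length (xs e) - n e) (rev (xs e))))"
    by (intro ptime_intros ptime_diff assms)
  ultimately show ?thesis by simp
qed

lemma ptime_list_update [ptime_intros]: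
  assumes "ptime xs" "ptime i" "ptime v" shows "ptime (\<lambda>e. (xs e)[i e := v e])"
proof -
  have "ys[j := w] = map (\<lambda>z. if fst z = j then w else snd z) (List.enumerate 0 ys)" for ys :: "'b list" and j w
    by (rule nth_equalityI) (auto simp: nth_list_update nth_enumerate_eq)
  then have eq: "(\<lambda>e. (xs e)[i e := v e]) = (\<lambda>e. map (\<lambda>z. if fst z = i e then v e else snd z) (List.enumerate 0 (xs e)))"
    by auto
  show ?thesis
    unfolding eq
    by (intro ptime_intros ptime_comp[OF assms(2) ptime_fst[OF ptime_id]] ptime_comp[OF assms(3) ptime_fst[OF ptime_id]] assms(1))
qed

lemma ptime_remove1 [ptime_intros]:
  assumes "ptime x" "ptime xs" shows "ptime (\<lambda>e. remove1 (x e :: nat) (xs e))"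
proof -
  define f :: "nat \<Rightarrow> bool \<Rightarrow> nat \<Rightarrow> nat list \<times> bool"
    where "f = (\<lambda>v found y. if \<not> found \<and> y = v then ([], True) else ([y], found))"
  have True': "concat (mapaccum (f v) True ys) = ys" for v ys
    by (induction ys) (auto simp: f_def)
  have eq: "remove1 v ys = concat (mapaccum (f v) False ys)" for v ys
  proof (induction ys)
    case (Cons y ys)
    then show ?case using True'[of v ys] by (auto simp: f_def)
  qed simp
  show ?thesis
    unfolding eq
  proof (rule ptime_concat, rule ptime_mapaccum[where b = "[:2:]"])
    show "ptime (\<lambda>z. f (x (fst z)) (fst (snd z)) (snd (snd z)))"
      unfolding f_def by (intro ptime_intros ptime_comp[OF assms(1) ptime_fst[OF ptime_id]])
    show "esize (snd (f (x e) s y)) \<le> esize s + poly [:2:] (esize e + esize y)" for e s y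
      using esize_bool[of "snd (f (x e) s y)"] by (simp del: enc_bool_eq)
  qed (intro ptime_intros assms)+
qed

lemma ptime_eq_const_nats: "ptime f \<Longrightarrow> ptime (\<lambda>x. f x = (c :: nat list))"
proof (induction c arbitrary: f)
  case Nil
  then show ?case by (rule ptime_null)
next
  case (Cons a c)
  have eq: "(\<lambda>x. f x = a # c) = (\<lambda>x. f x \<noteq> [] \<and> hd (f x) = a \<and> tl (f x) = c)"
    by (metis list.collapse list.distinct(1) list.sel(1,3))
  show ?case
    unfolding eq by (intro ptime_intros Cons)
qed

text \<open>The table is a constant, so membership unfolds into a finite disjunction that becomes
  part of the program.\<close>

lemma ptime_mem_const:
  assumes "ptime f" "ptime g"
  shows "ptime (\<lambda>x. (f x :: nat, g x :: nat list) \<in> set T)"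
proof (induction T)
  case Nil
  show ?case by (simp add: ptime_const)
next
  case (Cons a T)
  have eq: "(\<lambda>x. (f x, g x) \<in> set (a # T)) = (\<lambda>x. (f x = fst a \<and> g x = snd a) \<or> (f x, g x) \<in> set T)"
    by (auto simp: fun_eq_iff prod_eq_iff)
  show ?case
    unfolding eq by (intro ptime_intros assms ptime_eq_const_nats Cons)
qed

lemma ptime_mem_const_nats:
  assumes "ptime f"
  shows "ptime (\<lambda>x. (f x :: nat) \<in> set T)"
proof (induction T)
  case Nil
  show ?case by (simp add: ptime_const)
next
  case (Cons a T)
  have eq: "(\<lambda>x. f x \<in> set (a # T)) = (\<lambda>x. f x = a \<or> f x \<in> set T)"
    by auto
  show ?case
    unfolding eq by (intro ptime_intros assms Cons)
qed

section \<open>Independent draws and conditional expectations\<close>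

text \<open>For distinct \<open>s\<close> and nonempty lists, the expectation of \<open>g\<close> at
  independent uniform draws, one from each list \<open>U i\<close> with \<open>i\<close> in
  \<open>s\<close>, entries counted with multiplicity.\<close>

fun avg :: "(nat \<Rightarrow> nat list) \<Rightarrow> nat list \<Rightarrow> (nat list \<Rightarrow> real) \<Rightarrow> real" where
  "avg U [] g = g []"
| "avg U (i # s) g = (\<Sum>v\<leftarrow>U i. avg U s (\<lambda>vs. g (v # vs))) / real (length (U i))"

lemma avg_cong: "(\<And>i. i \<in> set s \<Longrightarrow> U i = U' i) \<Longrightarrow> avg U s g = avg U' s g"
  by (induction s arbitrary: g) auto

lemma avg_upd_irrelevant: "i \<notin> set s \<Longrightarrow> avg (U(i := xs)) s g = avg U s g"
  by (rule avg_cong) auto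

lemma sum_list_divide_distrib: "(\<Sum>x\<leftarrow>xs. f x / c) = (\<Sum>x\<leftarrow>xs. f x) / (c :: real)"
  by (induction xs) (auto simp: add_divide_distrib)

text \<open>The law of total expectation, conditioning on the draw from \<open>U i\<close>.
  Distinctness of \<open>s\<close> ensures that this list is drawn from only once, so that replacing
  it by a singleton is the same as conditioning.\<close>

lemma avg_split:
  assumes "distinct s" "i \<in> set s"
  shows "avg U s g = (\<Sum>a\<leftarrow>U i. avg (U(i := [a])) s g) / real (length (U i))"
  using assms
proof (induction s arbitrary: g)
  case (Cons j s)
  show ?case
  proof (cases "j = i")
    case True
    with Cons.prems have "avg (U(i := [a])) (j # s) g = avg U s (\<lambda>vs. g (a # vs))" for a
      by (simp add: avg_upd_irrelevant del: fun_upd_apply add: fun_upd_same)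
    then have "(\<Sum>a\<leftarrow>U i. avg (U(i := [a])) (j # s) g) = (\<Sum>a\<leftarrow>U i. avg U s (\<lambda>vs. g (a # vs)))"
      by (simp only:)
    then show ?thesis
      unfolding True by (simp only: avg.simps)
  next
    case False
    then have "avg U s h = (\<Sum>a\<leftarrow>U i. avg (U(i := [a])) s h) / real (length (U i))" for h
      using Cons.IH[of h] Cons.prems by (metis distinct.simps(2) set_ConsD)
    then have "avg U (j # s) g =
        (\<Sum>v\<leftarrow>U j. (\<Sum>a\<leftarrow>U i. avg (U(i := [a])) s (\<lambda>vs. g (v # vs)))) / real (length (U i)) / real (length (U j))"
      by (simp add: sum_list_divide_distrib)
    also have "(\<Sum>v\<leftarrow>U j. (\<Sum>a\<leftarrow>U i. avg (U(i := [a])) s (\<lambda>vs. g (v # vs)))) =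
        (\<Sum>a\<leftarrow>U i. (\<Sum>v\<leftarrow>U j. avg (U(i := [a])) s (\<lambda>vs. g (v # vs))))"
      by (simp add: sum_list_sum_nth sum.swap[of _ "{0..<length (U j)}"])
    finally have *: "avg U (j # s) g = (\<Sum>a\<leftarrow>U i. (\<Sum>v\<leftarrow>U j. avg (U(i := [a])) s (\<lambda>vs. g (v # vs)))) /
        real (length (U j)) / real (length (U i))"
      by (simp only: divide_divide_eq_left mult.commute)
    have "avg (U(i := [a])) (j # s) g =
        (\<Sum>v\<leftarrow>U j. avg (U(i := [a])) s (\<lambda>vs. g (v # vs))) / real (length (U j))" for a
      by (simp only: avg.simps fun_upd_other[OF False])
    then show ?thesis
      by (simp only: * sum_list_divide_distrib)
  qed
qed simp

lemma sum_list_unit_interval: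
  fixes f :: "'a \<Rightarrow> real"
  assumes "\<And>x. x \<in> set xs \<Longrightarrow> 0 \<le> f x \<and> f x \<le> 1"
  shows "0 \<le> (\<Sum>x\<leftarrow>xs. f x)" "(\<Sum>x\<leftarrow>xs. f x) \<le> real (length xs)"
  using assms by (induction xs) (auto intro: add_nonneg_nonneg add_mono simp: add.commute)

lemma avg_bounds:
  assumes "\<And>vs. 0 \<le> g vs" "\<And>vs. g vs \<le> 1"
  shows "0 \<le> avg U s g \<and> avg U s g \<le> 1"
  using assms
proof (induction s arbitrary: g)
  case (Cons i s)
  have "0 \<le> avg U s (\<lambda>vs. g (v # vs)) \<and> avg U s (\<lambda>vs. g (v # vs)) \<le> 1" for v
    by (rule Cons.IH) (use Cons.prems in auto)
  then show ?case
    using sum_list_unit_interval[of "U i" "\<lambda>v. avg U s (\<lambda>vs. g (v # vs))"]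
    by (auto simp: divide_le_eq)
qed auto

lemma avg_singletons: "(\<And>i. i \<in> set s \<Longrightarrow> U i = [f i]) \<Longrightarrow> avg U s g = g (map f s)"
  by (induction s arbitrary: g) auto

text \<open>The satisfying tuple \<open>vs\<close> alone has this probability under uniform
  draws.\<close>

lemma avg_uniform_ge:
  assumes "\<And>i. i \<in> set s \<Longrightarrow> U i = [0..<q]" "\<And>vs. 0 \<le> g vs" "\<And>vs. g vs \<le> 1"
    and "length vs = length s" "set vs \<subseteq> {..<q}" "g vs = 1"
  shows "1 / real q ^ length s \<le> avg U s g"
  using assms
proof (induction s arbitrary: g vs)
  case (Cons i s)
  then obtain v vs' where vs: "vs = v # vs'" "length vs' = length s"
    by (cases vs) auto
  have "1 / real q ^ length s \<le> avg U s (\<lambda>ws. g (v # ws))"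
    by (rule Cons.IH[of _ vs']) (use Cons.prems vs in auto)
  also have "\<dots> \<le> (\<Sum>x\<leftarrow>U i. avg U s (\<lambda>ws. g (x # ws)))"
  proof (rule member_le_sum_list)
    show "avg U s (\<lambda>ws. g (v # ws)) \<in> set (map (\<lambda>x. avg U s (\<lambda>ws. g (x # ws))) (U i))"
      using Cons.prems(1)[of i] Cons.prems(5) vs by auto
    show "0 \<le> x" if "x \<in> set (map (\<lambda>x. avg U s (\<lambda>ws. g (x # ws))) (U i))" for x
      using that avg_bounds Cons.prems(2,3) by fastforce
  qed
  finally have "1 / real q ^ length s / real q \<le> (\<Sum>x\<leftarrow>U i. avg U s (\<lambda>ws. g (x # ws))) / real q"
    by (rule divide_right_mono) simp
  then show ?case
    using Cons.prems(1)[of i] by (simp add: field_simps)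
qed auto

text \<open>The method of conditional expectations: the left-hand side is the mean of the right-hand
  sides over the entries \<open>a\<close> of \<open>U i\<close>, so they cannot all be
  smaller.\<close>

lemma conditional_choice:
  fixes its :: "(nat list \<times> (nat list \<Rightarrow> real)) list"
  assumes "U i \<noteq> []" "\<And>s g. (s, g) \<in> set its \<Longrightarrow> distinct s"
  shows "\<exists>a \<in> set (U i). (\<Sum>(s, g)\<leftarrow>its. avg U s g) \<le> (\<Sum>(s, g)\<leftarrow>its. avg (U(i := [a])) s g)"
proof (rule ccontr)
  define P where "P V = (\<Sum>(s, g)\<leftarrow>its. avg V s g)" for V
  assume "\<not> ?thesis"
  then have less: "P (U(i := [a])) < P U" if "a \<in> set (U i)" for a
    using that by (auto simp: P_def not_le)
  have "real (length (U i)) * avg U s g = (\<Sum>a\<leftarrow>U i. avg (U(i := [a])) s g)" if "distinct s" for s g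
  proof (cases "i \<in> set s")
    case True
    then show ?thesis
      using avg_split[OF that True, of U g] assms(1) by simp
  next
    case False
    then show ?thesis by (simp add: avg_upd_irrelevant sum_list_triv)
  qed
  with assms(2) have "real (length (U i)) * P U = (\<Sum>a\<leftarrow>U i. P (U(i := [a])))"
    unfolding P_def by (induction its) (force simp: sum_list_addf distrib_left)+
  also have "\<dots> < (\<Sum>a\<leftarrow>U i. P U)"
    using assms(1) less by (intro sum_list_strict_mono) auto
  finally show False
    by (simp add: sum_list_triv)
qed

section \<open>Concentration of draws without replacement\<close>

text \<open>Hoeffding's exponent \<open>l^2 (b - a)^2 / 8\<close> for a uniformly random index; an
  interval of length 2 gives \<open>l^2 / 2\<close>.\<close>

lemma hoeffding_finite:
  fixes Y :: "nat \<Rightarrow> real"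
  assumes "m > 0" "l > 0" and Y: "\<And>j. j < m \<Longrightarrow> a \<le> Y j \<and> Y j \<le> a + 2"
  shows "(\<Sum>j<m. exp (l * Y j)) \<le> real m * exp (l * ((\<Sum>j<m. Y j) / real m) + l\<^sup>2 / 2)"
proof -
  let ?p = "pmf_of_set {..<m}"
  have ne: "{..<m} \<noteq> {}" using assms by auto
  interpret interval_bounded_random_variable "measure_pmf ?p" Y a "a + 2"
    by unfold_locales (use ne Y in \<open>auto simp: AE_measure_pmf_iff\<close>)
  define \<mu> where "\<mu> = (\<Sum>j<m. Y j) / real m"
  have \<mu>: "measure_pmf.expectation ?p Y = \<mu>"
    using ne by (simp add: integral_pmf_of_set \<mu>_def)
  have "nn_integral ?p (\<lambda>j. ennreal (exp (l * (Y j - \<mu>)))) \<le> ennreal (exp (l\<^sup>2 / 2))"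
    using Hoeffdings_lemma_nn_integral[OF assms(2)] unfolding \<mu> by (simp add: power2_eq_square)
  also have "nn_integral ?p (\<lambda>j. ennreal (exp (l * (Y j - \<mu>)))) = ennreal ((\<Sum>j<m. exp (l * (Y j - \<mu>))) / real m)"
    using ne assms(1)
    by (simp add: nn_integral_pmf_of_set sum_ennreal divide_ennreal sum_nonneg ennreal_of_nat_eq_real_of_nat)
  finally have "(\<Sum>j<m. exp (l * (Y j - \<mu>))) / real m \<le> exp (l\<^sup>2 / 2)"
    by simp
  then have "(\<Sum>j<m. exp (l * (Y j - \<mu>))) \<le> real m * exp (l\<^sup>2 / 2)"
    using assms(1) by (simp add: divide_le_eq mult.commute)
  then have "exp (l * \<mu>) * (\<Sum>j<m. exp (l * (Y j - \<mu>))) \<le> exp (l * \<mu>) * (real m * exp (l\<^sup>2 / 2))"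
    by (rule mult_left_mono) simp
  then show ?thesis
    unfolding \<mu>_def[symmetric] by (simp add: sum_distrib_left exp_add algebra_simps flip: exp_add)
qed

text \<open>One number supplies all random choices: its remainder modulo the size of the urn selects
  the token, and the quotient is left for the later draws.\<close>

definition draw_step :: "(nat \<Rightarrow> nat) \<Rightarrow> nat \<times> nat list \<Rightarrow> nat \<Rightarrow> nat \<times> (nat \<times> nat list)" where
  "draw_step w st i =
     (let urn = filter (\<lambda>u. w u = i) (snd st); u = hd (drop (fst st mod length urn) urn)
      in (u, (fst st div length urn, remove1 u (snd st))))"

definition draws :: "(nat \<Rightarrow> nat) \<Rightarrow> nat \<Rightarrow> nat list \<Rightarrow> nat list \<Rightarrow> nat list" where
  "draws w R pool slots = mapaccum (draw_step w) (R, pool) slots"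

lemma draws_Nil [simp]: "draws w R pool [] = []"
  by (simp add: draws_def)

lemma draws_Cons:
  fixes w pool i R
  defines "urn \<equiv> filter (\<lambda>u. w u = i) pool"
  assumes "urn \<noteq> []"
  shows "draws w R pool (i # slots) =
    urn ! (R mod length urn) # draws w (R div length urn) (remove1 (urn ! (R mod length urn)) pool) slots"
proof -
  have "R mod length urn < length urn"
    using assms(2) by simp
  then show ?thesis
    unfolding draws_def by (simp add: draw_step_def Let_def urn_def[symmetric] hd_drop_conv_nth)
qed

text \<open>The invariant of the drawing process: each urn holds as many tokens as there are slots
  still to be filled from it. Hence no draw meets an empty urn, and nothing is left at the
  end.\<close>

definition balanced :: "(nat \<Rightarrow> nat) \<Rightarrow> nat list \<Rightarrow> nat list \<Rightarrow> bool" where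
  "balanced w pool slots \<longleftrightarrow> (\<forall>i. length (filter (\<lambda>u. w u = i) pool) = count_list slots i)"

lemma filter_remove1_commute: "filter P (remove1 x xs) = (if P x then remove1 x (filter P xs) else filter P xs)"
  by (induction xs) auto

lemma balanced_remove1:
  assumes "balanced w pool (i # slots)" "u \<in> set pool" "w u = i"
  shows "balanced w (remove1 u pool) slots"
  unfolding balanced_def
proof
  fix j
  have "length (filter (\<lambda>u. w u = j) pool) = count_list (i # slots) j"
    using assms(1) by (simp add: balanced_def)
  then show "length (filter (\<lambda>u. w u = j) (remove1 u pool)) = count_list slots j"
    using assms(2,3) by (auto simp: filter_remove1_commute length_remove1)
qed

lemma balanced_ConsE:
  assumes "balanced w pool (i # slots)" "j < Suc (count_list slots i)"
  shows "length (filter (\<lambda>u. w u = i) pool) = Suc (count_list slots i)"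
    "filter (\<lambda>u. w u = i) pool ! j \<in> set pool" "w (filter (\<lambda>u. w u = i) pool ! j) = i"
proof -
  show l: "length (filter (\<lambda>u. w u = i) pool) = Suc (count_list slots i)"
    using assms(1) by (simp add: balanced_def)
  then have "filter (\<lambda>u. w u = i) pool ! j \<in> set (filter (\<lambda>u. w u = i) pool)"
    using assms(2) by (intro nth_mem) simp
  then show "filter (\<lambda>u. w u = i) pool ! j \<in> set pool" "w (filter (\<lambda>u. w u = i) pool ! j) = i"
    by auto
qed

text \<open>The number of ways in which the urns can be emptied when they are visited in the order of the slots.\<close>

fun num_draws :: "nat list \<Rightarrow> nat" where
  "num_draws [] = 1"
| "num_draws (i # slots) = Suc (count_list slots i) * num_draws slots"

lemma num_draws_pos [simp]: "0 < num_draws slots"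
  by (induction slots) auto

text \<open>Needed for the number of random bits: the logarithm of the factorial is polynomial in
  the number of slots.\<close>

lemma num_draws_le_fact: "num_draws slots \<le> fact (length slots)"
proof (induction slots)
  case (Cons i slots)
  then show ?case
    using count_le_length[of slots i] by (auto intro!: mult_mono add_mono)
qed simp

lemma draws_balanced_Cons:
  assumes "balanced w pool (i # slots)"
  shows "draws w R pool (i # slots) =
    filter (\<lambda>u. w u = i) pool ! (R mod Suc (count_list slots i)) #
    draws w (R div Suc (count_list slots i)) (remove1 (filter (\<lambda>u. w u = i) pool ! (R mod Suc (count_list slots i))) pool) slots"
  using draws_Cons[of w i pool R slots] balanced_ConsE(1)[OF assms, of 0] by force

text \<open>Only the mixed-radix digits with the urn sizes as radices are ever read, and these
  depend on \<open>R\<close> modulo the product of the sizes.\<close>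

lemma draws_periodic:
  assumes "balanced w pool slots"
  shows "draws w (R + k * num_draws slots) pool slots = draws w R pool slots"
  using assms
proof (induction slots arbitrary: R pool)
  case (Cons i slots)
  define m where "m = Suc (count_list slots i)"
  define u where "u = filter (\<lambda>u. w u = i) pool ! (R mod m)"
  have eq: "R + k * num_draws (i # slots) = R + m * (k * num_draws slots)"
    by (simp add: m_def algebra_simps)
  have "(R + m * (k * num_draws slots)) mod m = R mod m"
    "(R + m * (k * num_draws slots)) div m = R div m + k * num_draws slots"
    by (simp_all add: m_def del: mult_Suc)
  moreover have "balanced w (remove1 u pool) slots"
    using balanced_ConsE[OF Cons.prems, of "R mod m"] balanced_remove1[OF Cons.prems, of u]
    unfolding u_def m_def by simp
  ultimately show ?case
    unfolding eq draws_balanced_Cons[OF Cons.prems] m_def[symmetric] u_def[symmetric]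
    using Cons.IH[of "remove1 u pool" "R div m"] by (simp add: u_def)
qed simp

text \<open>Balance with no slots left forces the pool to be empty, so a complete run is a
  permutation of the pool. This is the source of exact regularity.\<close>

lemma mset_draws:
  assumes "balanced w pool slots"
  shows "mset (draws w R pool slots) = mset pool"
  using assms
proof (induction slots arbitrary: R pool)
  case Nil
  then have "filter (\<lambda>u. w u = w (hd pool)) pool = []"
    by (simp add: balanced_def)
  then show ?case
    by (cases pool) auto
next
  case (Cons i slots)
  define m where "m = Suc (count_list slots i)"
  define u where "u = filter (\<lambda>u. w u = i) pool ! (R mod m)"
  have u: "u \<in> set pool" "w u = i"
    using balanced_ConsE[OF Cons.prems, of "R mod m"] unfolding u_def m_def by simp_all
  have "mset (draws w (R div m) (remove1 u pool) slots) = mset (remove1 u pool)"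
    by (rule Cons.IH) (rule balanced_remove1[OF Cons.prems u])
  then show ?case
    unfolding draws_balanced_Cons[OF Cons.prems] m_def[symmetric] u_def[symmetric]
    using u by simp
qed

lemma owners_draws:
  assumes "balanced w pool slots"
  shows "map w (draws w R pool slots) = slots"
  using assms
proof (induction slots arbitrary: R pool)
  case (Cons i slots)
  define m where "m = Suc (count_list slots i)"
  define u where "u = filter (\<lambda>u. w u = i) pool ! (R mod m)"
  have u: "u \<in> set pool" "w u = i"
    using balanced_ConsE[OF Cons.prems, of "R mod m"] unfolding u_def m_def by simp_all
  have "map w (draws w (R div m) (remove1 u pool) slots) = slots"
    by (rule Cons.IH) (rule balanced_remove1[OF Cons.prems u])
  then show ?case
    unfolding draws_balanced_Cons[OF Cons.prems] m_def[symmetric] u_def[symmetric]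
    using u by simp
qed simp

section \<open>The exponential moment of the sampled value\<close>

text \<open>A single draw of copy \<open>j\<close> from an urn of \<open>m + 1\<close> copies of a
  variable. Here \<open>h j\<close> is the resulting expectation for the current constraint,
  \<open>c\<close> collects the later constraints without the variable, and \<open>f j\<close> is
  the expectation of those containing it if it took the value of copy \<open>j\<close>. Once
  \<open>j\<close> is gone, the latter have expectation \<open>(A - f j) / m\<close>. As
  \<open>h j\<close> and \<open>f j / m\<close> lie in [0, 1], the total stays within distance 1 of
  \<open>c + A / m\<close>. Its mean is the expectation before the draw, because the terms
  \<open>A - f j\<close> add up to \<open>m * A\<close>.\<close>

lemma exp_sum_without_replacement:
  fixes h f :: "nat \<Rightarrow> real" and m :: nat
  defines "A \<equiv> \<Sum>j<Suc m. f j"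
  assumes "l > 0" and h: "\<And>j. j < Suc m \<Longrightarrow> 0 \<le> h j \<and> h j \<le> 1"
    and f: "\<And>j. j < Suc m \<Longrightarrow> 0 \<le> f j \<and> f j \<le> real m"
  shows "(\<Sum>j<Suc m. exp (l * (h j + c + (A - f j) / real m))) \<le>
    real (Suc m) * exp (l * ((\<Sum>j<Suc m. h j) / real (Suc m) + c + A / real (Suc m)) + l\<^sup>2 / 2)"
proof -
  let ?Y = "\<lambda>j. h j + c + (A - f j) / real m"
  have f': "0 \<le> f j / real m \<and> f j / real m \<le> 1" if "j < Suc m" for j
    using f[OF that] by (cases "m = 0") (auto simp: divide_le_eq)
  have "(\<Sum>j<Suc m. exp (l * ?Y j)) \<le>
      real (Suc m) * exp (l * ((\<Sum>j<Suc m. ?Y j) / real (Suc m)) + l\<^sup>2 / 2)"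
  proof (rule hoeffding_finite[where a = "c + A / real m - 1"])
    fix j assume "j < Suc m"
    then show "c + A / real m - 1 \<le> ?Y j \<and> ?Y j \<le> c + A / real m - 1 + 2"
      using f'[of j] h[of j] by (simp add: diff_divide_distrib)
  qed (use \<open>l > 0\<close> in auto)
  moreover have "(\<Sum>j<Suc m. ?Y j) / real (Suc m) = (\<Sum>j<Suc m. h j) / real (Suc m) + c + A / real (Suc m)"
  proof -
    have "(\<Sum>j<Suc m. (A - f j) / real m) = A"
    proof (cases "m = 0")
      \<comment> \<open>The bound by \<open>m\<close> forces \<open>f 0 = 0\<close>, hence
        \<open>A = 0\<close>, which agrees with the value of a division by zero.\<close>
      case True
      then show ?thesis
        using f[of 0] by (simp add: A_def)
    next
      case False
      have "(\<Sum>j<Suc m. A - f j) = real m * A"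
        unfolding sum_subtractf A_def[symmetric] by (simp add: algebra_simps)
      then show ?thesis
        using False by (simp flip: sum_divide_distrib)
    qed
    then have "(\<Sum>j<Suc m. ?Y j) = (\<Sum>j<Suc m. h j) + real (Suc m) * c + A"
      by (simp add: sum.distrib del: sum.lessThan_Suc)
    then show ?thesis
      by (simp add: add_divide_distrib del: sum.lessThan_Suc)
  qed
  ultimately show ?thesis by (simp only:)
qed

text \<open>Lifts an identity for single items to the whole list, exchanging the sum over items with
  the sum over \<open>J\<close>.\<close>

lemma sum_list_prod_linear:
  fixes F C D :: "'a \<Rightarrow> 'b \<Rightarrow> real"
  assumes "\<And>s g. (s, g) \<in> set xs \<Longrightarrow> F s g = C s g + ((\<Sum>j\<in>J. E j s g) - D s g) / d"
  shows "(\<Sum>(s, g)\<leftarrow>xs. F s g) =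
    (\<Sum>(s, g)\<leftarrow>xs. C s g) + ((\<Sum>j\<in>J. \<Sum>(s, g)\<leftarrow>xs. E j s g) - (\<Sum>(s, g)\<leftarrow>xs. D s g)) / d"
  using assms
proof (induction xs)
  case (Cons x xs)
  obtain s g where x: "x = (s, g)" by force
  have "F s g = C s g + ((\<Sum>j\<in>J. E j s g) - D s g) / d"
    by (rule Cons.prems) (simp add: x)
  moreover have "(\<Sum>(s, g)\<leftarrow>xs. F s g) =
    (\<Sum>(s, g)\<leftarrow>xs. C s g) + ((\<Sum>j\<in>J. \<Sum>(s, g)\<leftarrow>xs. E j s g) - (\<Sum>(s, g)\<leftarrow>xs. D s g)) / d"
    by (rule Cons.IH) (use Cons.prems in auto)
  ultimately show ?case
    by (simp add: x sum.distrib add_divide_distrib diff_divide_distrib)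
qed simp

fun score :: "(nat list \<times> (nat list \<Rightarrow> real)) list \<Rightarrow> nat list \<Rightarrow> real" where
  "score [] vs = 0"
| "score ((s, g) # its) vs = g (take (length s) vs) + score its (drop (length s) vs)"

definition urns :: "(nat \<Rightarrow> nat) \<Rightarrow> (nat \<Rightarrow> nat) \<Rightarrow> nat list \<Rightarrow> nat \<Rightarrow> nat list" where
  "urns w \<sigma> pool i = map \<sigma> (filter (\<lambda>u. w u = i) pool)"

text \<open>Separates the lowest mixed-radix digit, which decides the first draw, from the rest of
  the number.\<close>

lemma sum_mod_div:
  fixes F :: "nat \<Rightarrow> nat \<Rightarrow> real"
  assumes "m > 0"
  shows "(\<Sum>R<m * Q. F (R mod m) (R div m)) = (\<Sum>j<m. \<Sum>R<Q. F j R)"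
proof -
  have "(\<Sum>j<m. \<Sum>R<Q. F j R) = (\<Sum>(j, R)\<in>{..<m} \<times> {..<Q}. F j R)"
    by (simp add: sum.cartesian_product)
  also have "\<dots> = (\<Sum>R<m * Q. F (R mod m) (R div m))"
  proof (rule sum.reindex_bij_witness[where i = "\<lambda>R. (R mod m, R div m)" and j = "\<lambda>(j, R). j + m * R"])
    fix z assume z: "z \<in> {..<m} \<times> {..<Q}"
    then obtain j R where jR: "z = (j, R)" "j < m" "R < Q" by auto
    then have "j + m * R < m * Suc R" by simp
    also have "\<dots> \<le> m * Q" using jR by (intro mult_left_mono) auto
    finally show "(case z of (j, R) \<Rightarrow> j + m * R) \<in> {..<m * Q}" using jR by simp
  qed (use assms in \<open>auto simp: div_mult2_eq less_mult_imp_div_less mult.commute\<close>)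
  finally show ?thesis ..
qed

lemma count_list_distinct: "distinct xs \<Longrightarrow> count_list xs x = of_bool (x \<in> set xs)"
  by (induction xs) auto

text \<open>The sum of the \<open>avg\<close> terms over the current urns is the conditional
  expectation of the score. Induction reveals one draw at a time, each costing a factor
  \<open>exp (l^2 / 2)\<close>. The number of items is part of the measure because an item whose
  variables are all drawn is removed without a draw.\<close>

lemma exp_moment_draws:
  fixes its :: "(nat list \<times> (nat list \<Rightarrow> real)) list"
  assumes "l > 0"
    and "\<And>s g. (s, g) \<in> set its \<Longrightarrow> distinct s \<and> (\<forall>vs. 0 \<le> g vs \<and> g vs \<le> 1)"
    and "balanced w pool (concat (map fst its))"
  shows "(\<Sum>R<num_draws (concat (map fst its)).
      exp (l * score its (map \<sigma> (draws w R pool (concat (map fst its)))))) \<le>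
    real (num_draws (concat (map fst its))) *
      exp (l * (\<Sum>(s, g)\<leftarrow>its. avg (urns w \<sigma> pool) s g) + l\<^sup>2 / 2 * real (length (concat (map fst its))))"
  using assms(2,3)
proof (induction "length its + length (concat (map fst its))" arbitrary: its pool rule: less_induct)
  case less
  note items = less.prems(1) and bal = less.prems(2)
  consider "its = []" | g rest where "its = ([], g) # rest" | i s g rest where "its = (i # s, g) # rest"
    by (cases its) (auto, metis list.exhaust)
  then show ?case
  proof cases
    case 1
    then show ?thesis by simp
  next
    case 2
    \<comment> \<open>All variables of the first item are drawn, so its value \<open>g []\<close> is
      settled and only contributes a constant factor.\<close>
    have IH: "(\<Sum>R<num_draws (concat (map fst rest)).
        exp (l * score rest (map \<sigma> (draws w R pool (concat (map fst rest)))))) \<le>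
      real (num_draws (concat (map fst rest))) *
        exp (l * (\<Sum>(s, g)\<leftarrow>rest. avg (urns w \<sigma> pool) s g) + l\<^sup>2 / 2 * real (length (concat (map fst rest))))"
      by (rule less.hyps) (use 2 bal items in auto)
    have "(\<Sum>R<num_draws (concat (map fst its)).
        exp (l * score its (map \<sigma> (draws w R pool (concat (map fst its)))))) =
      exp (l * g []) * (\<Sum>R<num_draws (concat (map fst rest)).
        exp (l * score rest (map \<sigma> (draws w R pool (concat (map fst rest))))))"
      by (simp add: 2 distrib_left exp_add sum_distrib_left)
    also have "\<dots> \<le> exp (l * g []) * (real (num_draws (concat (map fst rest))) *
        exp (l * (\<Sum>(s, g)\<leftarrow>rest. avg (urns w \<sigma> pool) s g) + l\<^sup>2 / 2 * real (length (concat (map fst rest)))))"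
      by (rule mult_left_mono[OF IH]) simp
    also have "\<dots> = real (num_draws (concat (map fst its))) *
        exp (l * (\<Sum>(s, g)\<leftarrow>its. avg (urns w \<sigma> pool) s g) + l\<^sup>2 / 2 * real (length (concat (map fst its))))"
      by (simp add: 2 distrib_left exp_add)
    finally show ?thesis .
  next
    case 3
    define T where "T = s @ concat (map fst rest)"
    have slots: "concat (map fst its) = i # T"
      by (simp add: 3 T_def)
    have s: "distinct s" "i \<notin> set s" and g: "\<And>vs. 0 \<le> g vs" "\<And>vs. g vs \<le> 1"
      using items[of "i # s" g] 3 by auto
    have rest: "\<And>s g. (s, g) \<in> set rest \<Longrightarrow> distinct s \<and> (\<forall>vs. 0 \<le> g vs \<and> g vs \<le> 1)"
      using items 3 by auto
    define m where "m = count_list T i"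
    define Q where "Q = num_draws T"
    define urn where "urn = filter (\<lambda>u. w u = i) pool"
    define pool' where "pool' j = remove1 (urn ! j) pool" for j
    define v where "v j = \<sigma> (urn ! j)" for j
    define U where "U = urns w \<sigma> pool"
    define U' where "U' j = urns w \<sigma> (pool' j)" for j
    have lurn: "length urn = Suc m"
      using bal unfolding slots urn_def m_def by (rule balanced_ConsE(1)[where j = 0]) simp
    have urn: "urn ! j \<in> set pool" "w (urn ! j) = i" if "j < Suc m" for j
      using bal that unfolding slots urn_def m_def by (blast dest: balanced_ConsE)+
    have bal': "balanced w (pool' j) T" if "j < Suc m" for j
      unfolding pool'_def by (rule balanced_remove1) (use bal urn[OF that] slots in auto)
    \<comment> \<open>The items after the first draw has produced copy \<open>j\<close>: the first
      argument of the first item is fixed to the value \<open>v j\<close>.\<close>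
    define its' where "its' j = (s, \<lambda>vs. g (v j # vs)) # rest" for j
    define Y where "Y j = (\<Sum>(s, g)\<leftarrow>its' j. avg (U' j) s g)" for j
    have IH: "(\<Sum>R<Q. exp (l * score (its' j) (map \<sigma> (draws w R (pool' j) T)))) \<le>
        real Q * exp (l * Y j + l\<^sup>2 / 2 * real (length T))" if j: "j < Suc m" for j
    proof -
      have *: "concat (map fst (its' j)) = T"
        by (simp add: its'_def T_def)
      show ?thesis
        unfolding Q_def Y_def U'_def
        by (rule less.hyps[of "its' j" "pool' j", unfolded *])
          (use bal'[OF j] s g rest in \<open>auto simp: its'_def 3 T_def\<close>)
    qed
    have score: "score its (map \<sigma> (draws w R pool (i # T))) =
        score (its' (R mod Suc m)) (map \<sigma> (draws w (R div Suc m) (pool' (R mod Suc m)) T))" for R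
      using draws_balanced_Cons[OF bal[unfolded slots], of R]
      by (simp add: 3 its'_def v_def pool'_def urn_def m_def)

    have U'_other: "U' j i' = U i'" if "j < Suc m" "i' \<noteq> i" for j i'
      using urn[OF that(1)] that(2) by (simp add: U'_def U_def urns_def pool'_def filter_remove1_commute)
    have U'_upd: "(U' j)(i := xs) = U(i := xs)" if "j < Suc m" for j xs
      using U'_other[OF that] by auto
    have Ui: "U i = map v [0..<Suc m]"
      unfolding U_def urns_def urn_def[symmetric] v_def lurn[symmetric]
      by (metis map_map map_nth comp_def map_cong)
    have U'i: "U' j i = map \<sigma> (remove1 (urn ! j) urn)" if "j < Suc m" for j
      using urn[OF that] by (simp add: U'_def urns_def pool'_def filter_remove1_commute urn_def)
    have sumU: "(\<Sum>a\<leftarrow>U i. F a) = (\<Sum>j<Suc m. F (v j))" for F :: "nat \<Rightarrow> real"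
      unfolding Ui by (simp add: sum_list_sum_nth atLeast0LessThan del: upt_Suc sum.lessThan_Suc)
    have sumU': "(\<Sum>a\<leftarrow>U' j i. F a) = (\<Sum>j<Suc m. F (v j)) - F (v j)" if "j < Suc m" for j and F :: "nat \<Rightarrow> real"
    proof -
      have "(\<Sum>a\<leftarrow>U i. F a) = (\<Sum>u\<leftarrow>urn. F (\<sigma> u))"
        by (simp add: U_def urns_def urn_def comp_def)
      also have "\<dots> = F (\<sigma> (urn ! j)) + (\<Sum>u\<leftarrow>remove1 (urn ! j) urn. F (\<sigma> u))"
        using that lurn by (intro sum_list_map_remove1) simp
      finally show ?thesis
        using sumU[of F] U'i[OF that] by (simp add: v_def comp_def del: sum.lessThan_Suc)
    qed
    have lU': "length (U' j i) = m" if "j < Suc m" for j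
      using U'i[OF that] that lurn by (simp add: length_remove1)

    \<comment> \<open>The later items are separated according to whether they contain
      \<open>i\<close>, since removing a copy from the urn of \<open>i\<close> changes only the
      averages of those that do.\<close>
    define f where "f a = (\<Sum>(s, g)\<leftarrow>rest. if i \<in> set s then avg (U(i := [a])) s g else 0)" for a
    define c where "c = (\<Sum>(s, g)\<leftarrow>rest. if i \<in> set s then 0 else avg U s g)"
    define h where "h a = avg U s (\<lambda>vs. g (a # vs))" for a
    define A where "A = (\<Sum>j<Suc m. f (v j))"
    have rest_U: "(\<Sum>(s, g)\<leftarrow>rest. avg U s g) = c + A / real (Suc m)"
    proof -
      have "avg U s g = (if i \<in> set s then 0 else avg U s g) +
          (\<Sum>j<Suc m. if i \<in> set s then avg (U(i := [v j])) s g else 0) / real (Suc m)" if "distinct s" for s g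
        using avg_split[OF that, of i U g] sumU[of "\<lambda>a. avg (U(i := [a])) s g"] Ui
        by (simp del: upt_Suc sum.lessThan_Suc)
      then have "(\<Sum>(s, g)\<leftarrow>rest. avg U s g) = (\<Sum>(s, g)\<leftarrow>rest. if i \<in> set s then 0 else avg U s g) +
          ((\<Sum>j<Suc m. \<Sum>(s, g)\<leftarrow>rest. if i \<in> set s then avg (U(i := [v j])) s g else 0) -
           (\<Sum>(s, g)\<leftarrow>rest. 0)) / real (Suc m)"
        using rest by (intro sum_list_prod_linear) (simp only: diff_0_right)
      moreover have "(\<Sum>(s, g)\<leftarrow>rest. 0) = (0 :: real)"
        by (induction rest) auto
      ultimately show ?thesis
        by (simp only: c_def A_def f_def diff_0_right)
    qed
    have rest_U': "(\<Sum>(s, g)\<leftarrow>rest. avg (U' j) s g) = c + (A - f (v j)) / real m" if j: "j < Suc m" for j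
    proof -
      have 1: "avg (U' j) s g = (if i \<in> set s then 0 else avg U s g) +
          ((\<Sum>j<Suc m. if i \<in> set s then avg (U(i := [v j])) s g else 0) -
            (if i \<in> set s then avg (U(i := [v j])) s g else 0)) / real m" if "distinct s" for s g
      proof (cases "i \<in> set s")
        case True
        have "avg (U' j) s g = (\<Sum>a\<leftarrow>U' j i. avg (U(i := [a])) s g) / real m"
          using avg_split[OF that True, of "U' j" g] unfolding U'_upd[OF j] lU'[OF j] .
        then show ?thesis
          using True by (simp add: sumU'[OF j] del: sum.lessThan_Suc)
      next
        case False
        then show ?thesis
          using avg_cong[of s "U' j" U g] U'_other[OF j] by (simp del: sum.lessThan_Suc) metis
      qed
      then have "(\<Sum>(s, g)\<leftarrow>rest. avg (U' j) s g) = (\<Sum>(s, g)\<leftarrow>rest. if i \<in> set s then 0 else avg U s g) +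
          ((\<Sum>j<Suc m. \<Sum>(s, g)\<leftarrow>rest. if i \<in> set s then avg (U(i := [v j])) s g else 0) -
            (\<Sum>(s, g)\<leftarrow>rest. if i \<in> set s then avg (U(i := [v j])) s g else 0)) / real m"
        using rest by (intro sum_list_prod_linear) blast
      then show ?thesis
        by (simp only: c_def A_def f_def)
    qed
    have h: "0 \<le> h a \<and> h a \<le> 1" for a
      unfolding h_def by (rule avg_bounds) (use g in auto)
    have f: "0 \<le> f a \<and> f a \<le> real m" for a
    proof -
      \<comment> \<open>A distinct scope contains \<open>i\<close> at most once, so each item
        contributes at most 1 and only if it takes one of the remaining slots of \<open>i\<close>,
        of which there are \<open>m\<close>.\<close>
      have "0 \<le> f a \<and> f a \<le> real (count_list (concat (map fst rest)) i)"
        unfolding f_def using rest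
      proof (induction rest)
        case (Cons x rest)
        obtain s g where x: "x = (s, g)" by force
        have s: "distinct s" "\<And>vs. 0 \<le> g vs" "\<And>vs. g vs \<le> 1" using Cons.prems(1)[of s g] x by simp_all
        have IH: "0 \<le> (\<Sum>(s, g)\<leftarrow>rest. if i \<in> set s then avg (U(i := [a])) s g else 0) \<and>
            (\<Sum>(s, g)\<leftarrow>rest. if i \<in> set s then avg (U(i := [a])) s g else 0) \<le>
              real (count_list (concat (map fst rest)) i)"
          by (rule Cons.IH) (use Cons.prems in auto)
        show ?case
          using IH avg_bounds[of g "U(i := [a])" s, OF s(2,3)] s(1)
          unfolding x by (cases "i \<in> set s") (simp_all add: count_list_distinct del: fun_upd_apply)
      qed simp
      moreover have "m = count_list (concat (map fst rest)) i"
        using s by (simp add: m_def T_def count_list_distinct)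
      ultimately show ?thesis by simp
    qed
    have Y: "Y j = h (v j) + c + (A - f (v j)) / real m" if j: "j < Suc m" for j
    proof -
      have "avg (U' j) s (\<lambda>vs. g (v j # vs)) = h (v j)"
        unfolding h_def by (rule avg_cong) (use s U'_other[OF j] in metis)
      then show ?thesis
        unfolding Y_def its'_def using rest_U'[OF j] by simp
    qed
    have total: "(\<Sum>(s, g)\<leftarrow>its. avg U s g) = (\<Sum>j<Suc m. h (v j)) / real (Suc m) + c + A / real (Suc m)"
      using rest_U sumU[of h] Ui unfolding 3 h_def by (simp del: upt_Suc sum.lessThan_Suc)

    \<comment> \<open>The lowest digit of \<open>R\<close> is the first draw \<open>j\<close>. For
      fixed \<open>j\<close> the rest ranges over all runs on the remaining slots, where the
      induction hypothesis applies.\<close>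
    have "(\<Sum>R<num_draws (i # T). exp (l * score its (map \<sigma> (draws w R pool (i # T))))) =
        (\<Sum>R<Suc m * Q. exp (l * score (its' (R mod Suc m)) (map \<sigma> (draws w (R div Suc m) (pool' (R mod Suc m)) T))))"
      unfolding score by (simp add: m_def Q_def)
    also have "\<dots> = (\<Sum>j<Suc m. \<Sum>R<Q. exp (l * score (its' j) (map \<sigma> (draws w R (pool' j) T))))"
      by (rule sum_mod_div) simp
    also have "\<dots> \<le> (\<Sum>j<Suc m. real Q * exp (l * Y j + l\<^sup>2 / 2 * real (length T)))"
      by (intro sum_mono IH) simp
    also have "\<dots> = real Q * exp (l\<^sup>2 / 2 * real (length T)) * (\<Sum>j<Suc m. exp (l * Y j))"
      by (simp add: sum_distrib_left sum_distrib_right exp_add mult_ac del: sum.lessThan_Suc)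
    also have "(\<Sum>j<Suc m. exp (l * Y j)) = (\<Sum>j<Suc m. exp (l * (h (v j) + c + (A - f (v j)) / real m)))"
      by (intro sum.cong refl) (simp add: Y)
    also have "real Q * exp (l\<^sup>2 / 2 * real (length T)) * \<dots> \<le> real Q * exp (l\<^sup>2 / 2 * real (length T)) *
        (real (Suc m) * exp (l * (\<Sum>(s, g)\<leftarrow>its. avg U s g) + l\<^sup>2 / 2))"
      unfolding total A_def
      by (intro mult_left_mono exp_sum_without_replacement assms(1) h f) simp
    also have "\<dots> = real (num_draws (i # T)) *
        exp (l * (\<Sum>(s, g)\<leftarrow>its. avg U s g) + l\<^sup>2 / 2 * real (length (i # T)))"
      by (simp add: m_def Q_def exp_add algebra_simps add_divide_distrib)
    finally show ?thesis
      unfolding slots U_def .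
  qed
qed

section \<open>Derandomized rounding\<close>

type_synonym table = "(nat \<times> nat list) list"

definition sat :: "table \<Rightarrow> nat \<Rightarrow> nat list \<Rightarrow> real" where
  "sat T p vs = of_bool ((p, vs) \<in> set T)"

lemma sat_bounds [simp]: "0 \<le> sat T p vs" "sat T p vs \<le> 1"
  by (simp_all add: sat_def)

text \<open>
  For \<open>length s \<le> k\<close> this is \<open>Z ^ k\<close> times the probability that \<open>p\<close> is satisfied by independent
  draws from the lists \<open>U ! i\<close>, whose lengths divide \<open>Z\<close>; the recursion on \<open>k\<close> instead of \<open>s\<close>
  keeps it polynomial on malformed inputs.
\<close>

primrec tally :: "table \<Rightarrow> nat \<Rightarrow> nat \<Rightarrow> nat list list \<Rightarrow> nat \<Rightarrow> nat list \<Rightarrow> nat list \<Rightarrow> nat" where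
  "tally T 0 Z U p s acc = of_bool ((p, acc) \<in> set T)"
| "tally T (Suc k) Z U p s acc =
     (if s = [] then Z * tally T k Z U p [] acc
      else Z div length (hd (drop (hd s) U)) *
        (\<Sum>v\<leftarrow>hd (drop (hd s) U). tally T k Z U p (tl s) (acc @ [v])))"

text \<open>On well-formed input this is the expected number of satisfied constraints scaled to a
  natural number, so that candidates are compared exactly.\<close>

definition potential :: "table \<Rightarrow> nat \<Rightarrow> nat \<Rightarrow> (nat \<times> nat list) list \<Rightarrow> nat list list \<Rightarrow> nat" where
  "potential T k Z cs U = (\<Sum>c\<leftarrow>cs. tally T k Z U (fst c) (snd c) [])"

definition round_step ::
  "table \<Rightarrow> nat \<Rightarrow> nat \<Rightarrow> (nat \<times> nat list) list \<Rightarrow> nat list list \<Rightarrow> nat \<Rightarrow> nat \<times> nat list list" where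
  "round_step T k Z cs U i =
     (let a = hd (filter (\<lambda>a. potential T k Z cs U \<le> potential T k Z cs (U[i := [a]])) (hd (drop i U)))
      in (a, U[i := [a]]))"

text \<open>The scale is computed once from the initial lists. It remains valid for the lists fixed
  along the way, as the length 1 of a singleton divides everything, so all potentials are
  comparable.\<close>

definition greedy_round :: "table \<Rightarrow> nat \<Rightarrow> (nat \<times> nat list) list \<Rightarrow> nat list list \<Rightarrow> nat list" where
  "greedy_round T k cs U = mapaccum (round_step T k (prod_list (map length U)) cs) U [0..<length U]"

text \<open>Divisibility makes each truncating division in \<open>tally\<close> exact, and the extra
  factors \<open>Z\<close> for the missing positions of a short scope put all arities on the common
  scale \<open>Z ^ k\<close>.\<close>

lemma real_tally:
  assumes "length s \<le> k" "\<And>i. i \<in> set s \<Longrightarrow> i < length U \<and> U ! i \<noteq> [] \<and> length (U ! i) dvd Z"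
  shows "real (tally T k Z U p s acc) = real Z ^ k * avg ((!) U) s (\<lambda>vs. sat T p (acc @ vs))"
  using assms
proof (induction k arbitrary: s acc)
  case 0
  then show ?case by (simp add: sat_def)
next
  case (Suc k)
  show ?case
  proof (cases s)
    case Nil
    then show ?thesis using Suc.IH[of "[]" acc] by simp
  next
    case (Cons i s')
    have i: "hd (drop i U) = U ! i" "U ! i \<noteq> []" "length (U ! i) dvd Z"
      using Suc.prems(2)[of i] Cons by (simp_all add: hd_drop_conv_nth)
    have IH: "real (tally T k Z U p s' (acc @ [v])) = real Z ^ k * avg ((!) U) s' (\<lambda>vs. sat T p (acc @ v # vs))" for v
      using Suc.IH[of s' "acc @ [v]"] Suc.prems Cons by simp
    have "real (tally T (Suc k) Z U p s acc) =
        real Z / real (length (U ! i)) * (\<Sum>v\<leftarrow>U ! i. real (tally T k Z U p s' (acc @ [v])))"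
      using i by (simp add: Cons real_of_nat_div sum_list_of_nat[symmetric] comp_def)
    then show ?thesis
      by (simp add: IH Cons sum_list_const_mult)
  qed
qed

lemma real_potential:
  assumes "\<And>c. c \<in> set cs \<Longrightarrow> length (snd c) \<le> k \<and> set (snd c) \<subseteq> {..<length U}"
    and "\<And>i. i < length U \<Longrightarrow> U ! i \<noteq> [] \<and> length (U ! i) dvd Z"
  shows "real (potential T k Z cs U) = real Z ^ k * (\<Sum>c\<leftarrow>cs. avg ((!) U) (snd c) (sat T (fst c)))"
  using assms(1)
proof (induction cs)
  case (Cons c cs)
  have "real (tally T k Z U (fst c) (snd c) []) = real Z ^ k * avg ((!) U) (snd c) (\<lambda>vs. sat T (fst c) ([] @ vs))"
    using Cons.prems[of c] assms(2) by (intro real_tally) auto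
  then show ?case
    using Cons by (simp add: potential_def distrib_left)
qed (simp add: potential_def)

lemma nth_list_update_fun: "i < length U \<Longrightarrow> (!) (U[i := x]) = ((!) U)(i := x)"
  by (auto simp: fun_eq_iff nth_list_update)

text \<open>Generalized to an arbitrary starting position for the induction. The lists before
  \<open>j\<close> are left as they are; each later one is replaced by the singleton of the chosen
  value.\<close>

lemma greedy_round_from:
  fixes T :: table
  assumes cs: "\<And>c. c \<in> set cs \<Longrightarrow> distinct (snd c) \<and> length (snd c) \<le> k \<and> set (snd c) \<subseteq> {..<length U}"
    and U: "\<And>i. i < length U \<Longrightarrow> U ! i \<noteq> [] \<and> length (U ! i) dvd Z" and "Z > 0" "j \<le> length U"
  defines "\<xi> \<equiv> mapaccum (round_step T k Z cs) U [j..<length U]"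
  shows "length \<xi> = length U - j \<and> (\<forall>i<length U - j. \<xi> ! i \<in> set (U ! (j + i))) \<and>
    (\<Sum>c\<leftarrow>cs. avg ((!) U) (snd c) (sat T (fst c))) \<le>
      (\<Sum>c\<leftarrow>cs. avg ((!) (take j U @ map (\<lambda>a. [a]) \<xi>)) (snd c) (sat T (fst c)))"
  using cs U \<open>j \<le> length U\<close> unfolding \<xi>_def
proof (induction "length U - j" arbitrary: j U)
  case 0
  then show ?case by simp
next
  case (Suc n)
  then have j: "j < length U" by simp
  define ok where "ok a \<longleftrightarrow> potential T k Z cs U \<le> potential T k Z cs (U[j := [a]])" for a
  have ok_iff: "ok a \<longleftrightarrow> (\<Sum>c\<leftarrow>cs. avg ((!) U) (snd c) (sat T (fst c))) \<le>
      (\<Sum>c\<leftarrow>cs. avg ((!) (U[j := [a]])) (snd c) (sat T (fst c)))" for a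
  proof -
    have 1: "real (potential T k Z cs U) = real Z ^ k * (\<Sum>c\<leftarrow>cs. avg ((!) U) (snd c) (sat T (fst c)))"
      by (rule real_potential) (use Suc.prems in auto)
    have 2: "real (potential T k Z cs (U[j := [a]])) =
        real Z ^ k * (\<Sum>c\<leftarrow>cs. avg ((!) (U[j := [a]])) (snd c) (sat T (fst c)))"
      by (rule real_potential) (use Suc.prems j in \<open>auto simp: nth_list_update\<close>)
    show ?thesis
      unfolding ok_def of_nat_le_iff[symmetric, where 'a = real] 1 2
      using \<open>Z > 0\<close> by (intro mult_le_cancel_left_pos) simp
  qed
  \<comment> \<open>By conditional expectations some candidate does not lower the potential, so the
    \<open>hd\<close> in \<open>round_step\<close> is applied to a nonempty list.\<close>
  have "\<exists>a \<in> set (U ! j). ok a"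
    unfolding ok_iff nth_list_update_fun[OF j]
    using conditional_choice[of "(!) U" j "map (\<lambda>c. (snd c, sat T (fst c))) cs"] Suc.prems(1,2) j
    by (simp add: comp_def del: fun_upd_apply) blast
  then have ne: "filter ok (U ! j) \<noteq> []"
    by (auto simp: filter_empty_conv)
  define a where "a = hd (filter ok (U ! j))"
  have a: "a \<in> set (U ! j)" "ok a"
    using hd_in_set[OF ne] unfolding a_def[symmetric] by auto
  have step: "round_step T k Z cs U j = (a, U[j := [a]])"
    unfolding round_step_def ok_def[symmetric] using j by (simp add: hd_drop_conv_nth a_def[symmetric])
  let ?U = "U[j := [a]]"
  let ?\<xi> = "mapaccum (round_step T k Z cs) ?U [Suc j..<length ?U]"
  have \<xi>: "mapaccum (round_step T k Z cs) U [j..<length U] = a # ?\<xi>"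
    using j by (simp add: upt_conv_Cons step)
  have IH: "length ?\<xi> = length ?U - Suc j \<and> (\<forall>i<length ?U - Suc j. ?\<xi> ! i \<in> set (?U ! (Suc j + i))) \<and>
    (\<Sum>c\<leftarrow>cs. avg ((!) ?U) (snd c) (sat T (fst c))) \<le>
      (\<Sum>c\<leftarrow>cs. avg ((!) (take (Suc j) ?U @ map (\<lambda>a. [a]) ?\<xi>)) (snd c) (sat T (fst c)))"
    by (rule Suc.hyps(1)) (use Suc.hyps(2) Suc.prems j in \<open>auto simp: nth_list_update\<close>)
  have tk: "take (Suc j) ?U @ map (\<lambda>a. [a]) ?\<xi> = take j U @ map (\<lambda>a. [a]) (a # ?\<xi>)"
    using j by (simp add: take_Suc_conv_app_nth)
  have "(\<Sum>c\<leftarrow>cs. avg ((!) U) (snd c) (sat T (fst c))) \<le>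
      (\<Sum>c\<leftarrow>cs. avg ((!) (take j U @ map (\<lambda>a. [a]) (a # ?\<xi>))) (snd c) (sat T (fst c)))"
    using IH a(2) unfolding ok_iff tk by linarith
  moreover have "(a # ?\<xi>) ! i \<in> set (U ! (j + i))" if "i < length U - j" for i
    using that IH a(1) by (cases i) auto
  ultimately show ?case
    unfolding \<xi> using IH j by auto
qed

lemma greedy_round_correct:
  assumes "\<And>c. c \<in> set cs \<Longrightarrow> distinct (snd c) \<and> length (snd c) \<le> k \<and> set (snd c) \<subseteq> {..<length U}"
    and "\<And>i. i < length U \<Longrightarrow> U ! i \<noteq> []"
  shows "length (greedy_round T k cs U) = length U" "\<And>i. i < length U \<Longrightarrow> greedy_round T k cs U ! i \<in> set (U ! i)"
    "(\<Sum>c\<leftarrow>cs. avg ((!) U) (snd c) (sat T (fst c))) \<le>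
      (\<Sum>c\<leftarrow>cs. sat T (fst c) (map ((!) (greedy_round T k cs U)) (snd c)))"
proof -
  let ?Z = "prod_list (map length U)"
  have Z: "?Z > 0"
  proof -
    have "0 \<notin> set (map length U)"
      using assms(2) by (auto simp: in_set_conv_nth)
    then show ?thesis
      using prod_list_zero_iff[of "map length U"] by blast
  qed
  have dvd: "length (U ! i) dvd ?Z" if "i < length U" for i
  proof -
    have "x dvd prod_list xs" if "x \<in> set xs" for x :: nat and xs
      using that by (induction xs) auto
    then show ?thesis
      using that by simp
  qed
  have 1: "length (greedy_round T k cs U) = length U - 0 \<and>
      (\<forall>i<length U - 0. greedy_round T k cs U ! i \<in> set (U ! (0 + i))) \<and>
      (\<Sum>c\<leftarrow>cs. avg ((!) U) (snd c) (sat T (fst c))) \<le>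
      (\<Sum>c\<leftarrow>cs. avg ((!) (take 0 U @ map (\<lambda>a. [a]) (greedy_round T k cs U))) (snd c) (sat T (fst c)))"
    unfolding greedy_round_def by (rule greedy_round_from) (use assms dvd Z in auto)
  then show l: "length (greedy_round T k cs U) = length U" and "\<And>i. i < length U \<Longrightarrow> greedy_round T k cs U ! i \<in> set (U ! i)"
    by simp_all
  have "avg ((!) (map (\<lambda>a. [a]) (greedy_round T k cs U))) (snd c) (sat T (fst c)) =
      sat T (fst c) (map ((!) (greedy_round T k cs U)) (snd c))" if "c \<in> set cs" for c
    by (rule avg_singletons) (use assms(1)[OF that] l in auto)
  then have "(\<Sum>c\<leftarrow>cs. avg ((!) (map (\<lambda>a. [a]) (greedy_round T k cs U))) (snd c) (sat T (fst c))) =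
      (\<Sum>c\<leftarrow>cs. sat T (fst c) (map ((!) (greedy_round T k cs U)) (snd c)))"
    by (intro arg_cong[of _ _ sum_list] map_cong) auto
  then show "(\<Sum>c\<leftarrow>cs. avg ((!) U) (snd c) (sat T (fst c))) \<le>
      (\<Sum>c\<leftarrow>cs. sat T (fst c) (map ((!) (greedy_round T k cs U)) (snd c)))"
    using 1 by simp
qed

section \<open>The rounding runs in polynomial time\<close>

lemma ptime_comp5:
  assumes "ptime (\<lambda>z. F (fst z) (fst (snd z)) (fst (snd (snd z))) (fst (snd (snd (snd z)))) (snd (snd (snd (snd z)))))"
    and "ptime a" "ptime b" "ptime c" "ptime d" "ptime e"
  shows "ptime (\<lambda>x. F (a x) (b x) (c x) (d x) (e x))"
  using ptime_comp[OF assms(1), of "\<lambda>x. (a x, b x, c x, d x, e x)"] assms(2-) by (simp add: ptime_Pair)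

lemma ptime_tally_tuple:
  "ptime (\<lambda>z. tally T k (fst z) (fst (snd z)) (fst (snd (snd z))) (fst (snd (snd (snd z)))) (snd (snd (snd (snd z)))))"
proof (induction k)
  case 0
  show ?case
    unfolding tally.simps by (intro ptime_intros ptime_mem_const)
next
  case (Suc k)
  show ?case
    unfolding tally.simps by (intro ptime_intros ptime_comp5[OF Suc])
qed

lemmas ptime_tally = ptime_comp5[OF ptime_tally_tuple]

lemma ptime_potential:
  assumes "ptime Z" "ptime cs" "ptime U"
  shows "ptime (\<lambda>x. potential T k (Z x) (cs x) (U x))"
  unfolding potential_def
  by (intro ptime_intros ptime_tally ptime_comp[OF assms(1) ptime_fst[OF ptime_id]]
      ptime_comp[OF assms(3) ptime_fst[OF ptime_id]] assms)

lemma esize_list_update: "i < length xs \<Longrightarrow> esize (xs[i := v]) + esize (xs ! i) = esize xs + esize v"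
  by (induction xs arbitrary: i) (auto simp: nth_Cons split: nat.splits)

lemma esize_singleton_le: "a \<in> set xs \<Longrightarrow> esize [a] \<le> esize xs"
  by (induction xs) (auto simp: floorlog_def Suc_le_eq)

text \<open>A list is replaced by a singleton of one of its entries, which is not larger. On
  malformed input no candidate may survive the filter; the additive constant pays for the default
  value \<open>hd []\<close>.\<close>

lemma esize_update_hd_filter:
  fixes U :: "nat list list"
  shows "esize (U[i := [hd (filter P (hd (drop i U)))]]) \<le> esize U + esize [hd [] :: nat]"
proof (cases "i < length U")
  case True
  define a where "a = hd (filter P (hd (drop i U)))"
  have "esize [a] \<le> esize (U ! i) + esize [hd [] :: nat]"
  proof (cases "filter P (U ! i)")
    case Nil
    then show ?thesis using True by (simp add: a_def hd_drop_conv_nth)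
  next
    case (Cons b bs)
    then have "b \<in> set (filter P (U ! i))" "a = b"
      using True by (simp_all add: a_def hd_drop_conv_nth)
    then have "a \<in> set (U ! i)"
      by simp
    then show ?thesis
      using esize_singleton_le[of a "U ! i"] by linarith
  qed
  then show ?thesis
    using esize_list_update[OF True, of "[a]"] unfolding a_def[symmetric] by linarith
qed (simp add: list_update_beyond)

lemma ptime_greedy_round:
  assumes "ptime cs" "ptime U"
  shows "ptime (\<lambda>x. greedy_round T k (cs x) (U x))"
  unfolding greedy_round_def
proof (rule ptime_mapaccum[where b = "[:esize [hd [] :: nat]:]"])
  show "ptime (\<lambda>z. round_step T k (prod_list (map length (U (fst z)))) (cs (fst z)) (fst (snd z)) (snd (snd z)))"
    unfolding round_step_def Let_def
    by (intro ptime_intros ptime_potential ptime_comp[OF assms(1)] ptime_comp[OF assms(2)])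
  show "esize (snd (round_step T k (prod_list (map length (U e))) (cs e) V i))
      \<le> esize V + poly [:esize [hd [] :: nat]:] (esize e + esize i)" for e V i
    unfolding round_step_def Let_def snd_conv using esize_update_hd_filter[of V i] by simp
qed (intro ptime_intros assms)+

section \<open>Discretizing the weights\<close>

text \<open>The predicates are arbitrary functions, so a program can use them only through this
  finite list of satisfying tuples, which is built into it as a constant.\<close>

definition table :: "nat \<Rightarrow> csp \<Rightarrow> table" where
  "table q \<Lambda> = concat (map (\<lambda>p. map (Pair p)
     (filter (holds (\<Lambda> ! p)) (List.n_lists (arity (\<Lambda> ! p)) [0..<q]))) [0..<length \<Lambda>])"

lemma mem_table: "(p, vs) \<in> set (table q \<Lambda>) \<longleftrightarrow>
    p < length \<Lambda> \<and> length vs = arity (\<Lambda> ! p) \<and> set vs \<subseteq> {..<q} \<and> holds (\<Lambda> ! p) vs"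
proof -
  have "set (table q \<Lambda>) = (\<Union>p<length \<Lambda>. Pair p ` {vs. length vs = arity (\<Lambda> ! p) \<and> set vs \<subseteq> {..<q} \<and> holds (\<Lambda> ! p) vs})"
    by (simp add: table_def set_n_lists atLeast0LessThan)
  then show ?thesis by auto
qed

type_synonym constr_rep = "nat \<times> nat list \<times> nat \<times> nat"
type_synonym inst_rep = "nat list \<times> constr_rep list"

definition constr_rep :: "constr \<Rightarrow> constr_rep" where
  "constr_rep c = (pred_ix c, scope c,
     nat (fst (quotient_of (weight c))), nat (snd (quotient_of (weight c))))"

definition inst_rep :: "inst \<Rightarrow> inst_rep" where
  "inst_rep F = ([0..<nvars F], map constr_rep (constrs F))"

text \<open>Identifies the prescribed input format with an \<open>encodable\<close> type, so that
  the calculus of \<open>ptime\<close> applies to instances.\<close>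

lemma enc_inst_rep: "enc (inst_rep F) = enc_inst F"
proof -
  have *: "enc (constr_rep c) = enc_constr c" for c
    by (simp add: constr_rep_def enc_constr_def enc_rat_def enc_nats_def case_prod_beta)
  show ?thesis
    unfolding inst_rep_def enc_inst_def enc_prod_eq fst_conv snd_conv
    by (simp add: enc_nats_def comp_def * del: enc_prod_eq)
qed

abbreviation wnum :: "constr_rep \<Rightarrow> nat" where "wnum c \<equiv> fst (snd (snd c))"
abbreviation wden :: "constr_rep \<Rightarrow> nat" where "wden c \<equiv> snd (snd (snd c))"

definition satisfiable :: "table \<Rightarrow> inst_rep \<Rightarrow> constr_rep list" where
  "satisfiable T I = filter (\<lambda>c. fst c \<in> set (map fst T)) (snd I)"

text \<open>Fractions are compared by cross-multiplication: a constraint qualifies if no other has a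
  strictly larger weight.\<close>

definition heaviest :: "table \<Rightarrow> inst_rep \<Rightarrow> constr_rep" where
  "heaviest T I =
     hd (filter (\<lambda>c. filter (\<lambda>d. wnum c * wden d < wnum d * wden c) (satisfiable T I) = []) (satisfiable T I))"

text \<open>A unary number: its length is \<open>L\<close> times the number of variables and
  constraints. The constraints keep the total rounding error small, the variables make the expanded
  list long enough for the failure probability.\<close>

definition ticks :: "nat \<Rightarrow> inst_rep \<Rightarrow> nat list" where
  "ticks L I = concat (map (\<lambda>_. map (\<lambda>_. 0) (fst I) @ map (\<lambda>_. 0) (snd I)) [0..<L])"

text \<open>The weight relative to the largest one, in multiples of
  \<open>1 / length (ticks L I)\<close>, rounded down.\<close>

definition copies :: "table \<Rightarrow> nat \<Rightarrow> inst_rep \<Rightarrow> constr_rep \<Rightarrow> nat" where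
  "copies T L I c =
     (wnum c * wden (heaviest T I) * length (ticks L I)) div (wden c * wnum (heaviest T I))"

text \<open>The number of copies is in binary and on malformed input may be huge, so the copies are
  produced by filtering a list of polynomial length. On proper instances this cap is never active,
  as no weight exceeds the largest.\<close>

definition expand :: "table \<Rightarrow> nat \<Rightarrow> inst_rep \<Rightarrow> (nat \<times> nat list) list" where
  "expand T L I = concat (map (\<lambda>c. map (\<lambda>_. (fst c, fst (snd c)))
     (filter (\<lambda>j. j < copies T L I c) [0..<length (ticks L I)])) (satisfiable T I))"

lemma ptime_satisfiable: "ptime I \<Longrightarrow> ptime (\<lambda>x. satisfiable T (I x))"
  unfolding satisfiable_def by (intro ptime_intros ptime_mem_const_nats)

lemma ptime_expand: "ptime I \<Longrightarrow> ptime (\<lambda>x. expand T L (I x))"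
proof (rule ptime_comp[where f = "expand T L"])
  have "ptime (\<lambda>x. heaviest T (I x))" if "ptime I" for I :: "'b::encodable \<Rightarrow> inst_rep"
  proof (rule ptime_comp[OF _ that, where f = "heaviest T"])
    show "ptime (heaviest T)"
      unfolding heaviest_def by (intro ptime_intros ptime_satisfiable)
  qed
  note 1 = this
  have 2: "ptime (\<lambda>x. ticks L (I x))" if "ptime I" for I :: "'b::encodable \<Rightarrow> inst_rep"
  proof (rule ptime_comp[OF _ that, where f = "ticks L"])
    show "ptime (ticks L)"
      unfolding ticks_def by (intro ptime_intros)
  qed
  show "ptime (expand T L)"
    unfolding expand_def copies_def by (intro ptime_intros ptime_satisfiable 1 2)
qed

definition sat_count :: "table \<Rightarrow> (nat \<times> nat list) list \<Rightarrow> nat list \<Rightarrow> real" where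
  "sat_count T cs \<xi> = (\<Sum>c\<leftarrow>cs. sat T (fst c) (map ((!) \<xi>) (snd c)))"

lemma finite_assignments: "finite (assignments q F)"
  unfolding assignments_def using finite_lists_length_eq[of "{..<q}" "nvars F"] by (simp add: conj_commute)

lemma Val_le_Opt: "\<xi> \<in> assignments q F \<Longrightarrow> Val \<Lambda> F \<xi> \<le> Opt q \<Lambda> F"
  unfolding Opt_def by (intro Max_ge) (auto simp: finite_assignments)

lemma Opt_attained:
  assumes "q \<ge> 1"
  obtains \<xi> where "\<xi> \<in> assignments q F" "Opt q \<Lambda> F = Val \<Lambda> F \<xi>"
proof -
  have "replicate (nvars F) 0 \<in> assignments q F"
    using assms by (auto simp: assignments_def)
  then have "Opt q \<Lambda> F \<in> Val \<Lambda> F ` assignments q F"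
    unfolding Opt_def by (intro Max_in) (auto simp: finite_assignments)
  then show thesis using that by blast
qed

lemma length_filter_less_upt: "length (filter (\<lambda>j. j < k) [0..<b]) = min k b"
proof -
  have "filter (\<lambda>j. j < k) [0..<b] = [0..<min k b]"
    by (induction b) (auto simp: min_def le_Suc_eq not_le)
  then show ?thesis by simp
qed

lemma sum_list_replicated:
  "(\<Sum>c\<leftarrow>concat (map (\<lambda>c. map (\<lambda>_. h c) (filter (\<lambda>j. j < k c) [0..<b])) cs). f c) =
    (\<Sum>c\<leftarrow>cs. real (min (k c) b) * f (h c))"
  by (induction cs) (simp_all add: comp_def sum_list_triv length_filter_less_upt)

lemma length_expand:
  "length (expand T L I) = (\<Sum>c\<leftarrow>satisfiable T I. min (copies T L I c) (length (ticks L I)))"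
  by (simp add: expand_def length_concat comp_def length_filter_less_upt)

lemma sat_count_expand_min:
  "sat_count T (expand T L I) \<xi> = (\<Sum>c\<leftarrow>satisfiable T I. real (min (copies T L I c) (length (ticks L I))) *
     sat T (fst c) (map ((!) \<xi>) (fst (snd c))))"
  unfolding sat_count_def expand_def sum_list_replicated by simp

lemma exists_satisfying_assignment:
  fixes q :: nat
  assumes "distinct s" "set s \<subseteq> {..<n}" "length vs = length s" "set vs \<subseteq> {..<q}" "q \<ge> 1"
  obtains \<xi> where "length \<xi> = n" "set \<xi> \<subseteq> {..<q}" "map ((!) \<xi>) s = vs"
proof
  let ?\<xi> = "map (\<lambda>i. case map_of (zip s vs) i of Some v \<Rightarrow> v | None \<Rightarrow> 0) [0..<n]"
  show "length ?\<xi> = n" by simp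
  show "set ?\<xi> \<subseteq> {..<q}"
  proof -
    have "v < q" if "map_of (zip s vs) i = Some v" for i v
      using map_of_SomeD[OF that] set_zip_rightD assms(4) by fastforce
    then show ?thesis
      using assms(5) by (auto split: option.splits)
  qed
  show "map ((!) ?\<xi>) s = vs"
  proof (rule nth_equalityI)
    fix j assume "j < length (map ((!) ?\<xi>) s)"
    then have "j < length s" by simp
    moreover then have "s ! j < n" using assms(2) nth_mem by fastforce
    moreover have "map_of (zip s vs) (s ! j) = Some (vs ! j)"
      using assms(1,3) \<open>j < length s\<close> by (simp add: map_of_zip_nth)
    ultimately show "map ((!) ?\<xi>) s ! j = vs ! j" by simp
  qed (use assms in simp)
qed

lemma sum_list_filter_zero:
  fixes f :: "'a \<Rightarrow> real"
  assumes "\<And>x. x \<in> set xs \<Longrightarrow> \<not> P x \<Longrightarrow> f x = 0"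
  shows "(\<Sum>x\<leftarrow>filter P xs. f x) = (\<Sum>x\<leftarrow>xs. f x)"
  using assms by (induction xs) auto

section \<open>Error analysis of the discretization\<close>

locale discretized =
  fixes q :: nat and \<Lambda> :: csp and F :: inst and L :: nat
  assumes q: "q \<ge> 1" and L: "L \<ge> 1" and F: "weighted_instance \<Lambda> F"
begin

abbreviation "T \<equiv> table q \<Lambda>"
abbreviation "I \<equiv> inst_rep F"
abbreviation "cs \<equiv> expand T L I"
definition "W c = real (wnum c) / real (wden c)"
definition "B = length (ticks L I)"

lemma B_eq: "B = L * (nvars F + length (constrs F))"
  by (simp add: B_def ticks_def length_concat inst_rep_def comp_def sum_list_triv)

lemma B_pos: "B > 0"
proof -
  have "constrs F \<noteq> []"
    using F by (auto simp: weighted_instance_def)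
  then show ?thesis
    using L by (simp add: B_eq)
qed

lemma weight_rep:
  assumes "c \<in> set (constrs F)"
  shows "wden (constr_rep c) > 0" "of_rat (weight c) = W (constr_rep c)"
proof -
  obtain a b where ab: "quotient_of (weight c) = (a, b)" by force
  have "weight c \<ge> 0"
    using F assms by (auto simp: weighted_instance_def)
  moreover have "weight c = of_int a / of_int b" "b > 0"
    using ab by (simp_all add: quotient_of_div quotient_of_denom_pos)
  ultimately have "a \<ge> 0"
    by (simp add: zero_le_divide_iff)
  show "wden (constr_rep c) > 0"
    using ab \<open>b > 0\<close> by (simp add: constr_rep_def)
  show "of_rat (weight c) = W (constr_rep c)"
    using ab \<open>b > 0\<close> \<open>a \<ge> 0\<close> \<open>weight c = _\<close>
    by (simp add: constr_rep_def W_def of_rat_divide)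
qed

lemma constrD:
  assumes "c \<in> set (constrs F)"
  shows "pred_ix c < length \<Lambda>" "length (scope c) = arity (\<Lambda> ! pred_ix c)" "distinct (scope c)"
    "set (scope c) \<subseteq> {..<nvars F}"
  using F assms by (simp_all add: weighted_instance_def)

lemma satisfiableD:
  assumes "c \<in> set (satisfiable T I)"
  shows "fst c < length \<Lambda>" "length (fst (snd c)) = arity (\<Lambda> ! fst c)" "distinct (fst (snd c))"
    "set (fst (snd c)) \<subseteq> {..<nvars F}" "\<exists>vs. (fst c, vs) \<in> set T" "wden c > 0"
proof -
  obtain d where d: "d \<in> set (constrs F)" "c = constr_rep d"
    using assms by (auto simp: satisfiable_def inst_rep_def)
  show "fst c < length \<Lambda>" "length (fst (snd c)) = arity (\<Lambda> ! fst c)" "distinct (fst (snd c))"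
    "set (fst (snd c)) \<subseteq> {..<nvars F}" "wden c > 0"
    using constrD[OF d(1)] weight_rep(1)[OF d(1)] unfolding d(2) by (simp_all add: constr_rep_def)
  show "\<exists>vs. (fst c, vs) \<in> set T"
    using assms by (auto simp: satisfiable_def)
qed

lemma expandD:
  assumes "c \<in> set cs"
  shows "fst c < length \<Lambda>" "length (snd c) = arity (\<Lambda> ! fst c)" "distinct (snd c)"
    "set (snd c) \<subseteq> {..<nvars F}" "\<exists>vs. (fst c, vs) \<in> set T"
proof -
  obtain d where "d \<in> set (satisfiable T I)" "c = (fst d, fst (snd d))"
    using assms by (auto simp: expand_def)
  then show "fst c < length \<Lambda>" "length (snd c) = arity (\<Lambda> ! fst c)" "distinct (snd c)"
    "set (snd c) \<subseteq> {..<nvars F}" "\<exists>vs. (fst c, vs) \<in> set T"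
    using satisfiableD[of d] by simp_all
qed

lemma Val_eq:
  assumes "\<xi> \<in> assignments q F"
  shows "Val \<Lambda> F \<xi> = (\<Sum>c\<leftarrow>satisfiable T I. W c * sat T (fst c) (map ((!) \<xi>) (fst (snd c))))"
proof -
  have "of_rat (weight c) * of_bool (holds (\<Lambda> ! pred_ix c) (map ((!) \<xi>) (scope c))) =
      W (constr_rep c) * sat T (fst (constr_rep c)) (map ((!) \<xi>) (fst (snd (constr_rep c))))"
    if c: "c \<in> set (constrs F)" for c
  proof -
    have "set (map ((!) \<xi>) (scope c)) \<subseteq> set \<xi>"
      using assms constrD(4)[OF c] by (auto simp: assignments_def)
    then have "set (map ((!) \<xi>) (scope c)) \<subseteq> {..<q}"
      using assms by (auto simp: assignments_def)
    then have "(pred_ix c, map ((!) \<xi>) (scope c)) \<in> set T \<longleftrightarrow> holds (\<Lambda> ! pred_ix c) (map ((!) \<xi>) (scope c))"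
      using constrD[OF c] by (simp add: mem_table)
    then show ?thesis
      using weight_rep(2)[OF c] by (simp add: sat_def constr_rep_def)
  qed
  then have "Val \<Lambda> F \<xi> = (\<Sum>c\<leftarrow>snd I. W c * sat T (fst c) (map ((!) \<xi>) (fst (snd c))))"
    unfolding Val_def inst_rep_def by (simp add: comp_def cong: map_cong)
  also have "\<dots> = (\<Sum>c\<leftarrow>satisfiable T I. W c * sat T (fst c) (map ((!) \<xi>) (fst (snd c))))"
    unfolding satisfiable_def by (rule sum_list_filter_zero[symmetric]) (force simp: sat_def)
  finally show ?thesis .
qed

lemma Val_nonneg: "\<xi> \<in> assignments q F \<Longrightarrow> 0 \<le> Val \<Lambda> F \<xi>"
  unfolding Val_eq by (intro sum_list_nonneg) (auto simp: W_def)

lemma heaviest: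
  assumes "satisfiable T I \<noteq> []"
  shows "heaviest T I \<in> set (satisfiable T I)" "\<And>c. c \<in> set (satisfiable T I) \<Longrightarrow> W c \<le> W (heaviest T I)"
proof -
  let ?S = "satisfiable T I"
  have less: "wnum c * wden d < wnum d * wden c \<longleftrightarrow> W c < W d" if "c \<in> set ?S" "d \<in> set ?S" for c d
  proof -
    have "W c < W d \<longleftrightarrow> real (wnum c) * real (wden d) < real (wnum d) * real (wden c)"
      using satisfiableD(6)[OF that(1)] satisfiableD(6)[OF that(2)] by (simp add: W_def field_simps)
    then show ?thesis
      by (metis of_nat_less_iff of_nat_mult)
  qed
  define xs where "xs = filter (\<lambda>c. filter (\<lambda>d. wnum c * wden d < wnum d * wden c) ?S = []) ?S"
  have "Max (W ` set ?S) \<in> W ` set ?S"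
    using assms by (intro Max_in) auto
  then obtain c where c: "c \<in> set ?S" "W c = Max (W ` set ?S)" by auto
  have "\<not> wnum c * wden d < wnum d * wden c" if "d \<in> set ?S" for d
    unfolding less[OF c(1) that] not_less c(2) using that by simp
  then have "c \<in> set xs"
    using c(1) unfolding xs_def by (simp add: filter_empty_conv)
  then have "xs \<noteq> []" by auto
  from hd_in_set[OF this] have "heaviest T I \<in> set xs"
    by (simp add: heaviest_def xs_def)
  then have h: "heaviest T I \<in> set ?S" and "\<And>d. d \<in> set ?S \<Longrightarrow> \<not> wnum (heaviest T I) * wden d < wnum d * wden (heaviest T I)"
    unfolding xs_def by (auto simp: filter_empty_conv)
  with less[OF h] show "heaviest T I \<in> set ?S" "\<And>c. c \<in> set ?S \<Longrightarrow> W c \<le> W (heaviest T I)"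
    by (simp_all add: not_less)
qed

lemma copies_heaviest:
  assumes "satisfiable T I \<noteq> []" "wnum (heaviest T I) > 0"
  shows "copies T L I (heaviest T I) = B"
  using assms(2) satisfiableD(6)[OF heaviest(1)[OF assms(1)]]
  by (simp add: copies_def B_def ac_simps)

text \<open>The heaviest satisfiable constraint receives \<open>B > 0\<close> copies unless its
  weight is 0. So an empty expansion means that all weight lies on unsatisfiable
  constraints.\<close>

lemma expand_empty:
  assumes "cs = []" "\<xi> \<in> assignments q F"
  shows "Val \<Lambda> F \<xi> = 0"
proof (cases "satisfiable T I = []")
  case True
  then show ?thesis using assms(2) by (simp add: Val_eq)
next
  case False
  let ?h = "heaviest T I"
  have "length cs = 0" using assms(1) by simp
  then have "min (copies T L I ?h) B = 0"
    using heaviest(1)[OF False] unfolding length_expand B_def by (simp add: sum_list_eq_0_iff)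
  then have "copies T L I ?h = 0"
    using B_pos by simp
  then have "wnum ?h = 0"
    using copies_heaviest[OF False] B_pos by force
  then have "W c = 0" if "c \<in> set (satisfiable T I)" for c
    using heaviest(2)[OF False that] by (auto simp: W_def divide_le_0_iff)
  then have "(\<Sum>c\<leftarrow>satisfiable T I. W c * sat T (fst c) (map ((!) \<xi>) (fst (snd c)))) = (\<Sum>c\<leftarrow>satisfiable T I. 0)"
    by (intro arg_cong[of _ _ sum_list] map_cong) auto
  then show ?thesis
    using assms(2) by (simp add: Val_eq)
qed

text \<open>The weight that a single copy stands for; rounding down loses at most this much per
  constraint.\<close>

definition "unit_weight = W (heaviest T I) / real B"

context
  assumes cs: "cs \<noteq> []"
begin

lemma satisfiable_nonempty: "satisfiable T I \<noteq> []"
  using cs by (auto simp: expand_def)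

lemma heaviest_pos: "wnum (heaviest T I) > 0"
proof (rule ccontr)
  assume "\<not> ?thesis"
  then have "copies T L I c = 0" for c by (simp add: copies_def)
  then have "cs = []" by (simp add: expand_def)
  with cs show False ..
qed

lemma unit_weight_pos: "unit_weight > 0"
  using heaviest_pos satisfiableD(6)[OF heaviest(1)[OF satisfiable_nonempty]] B_pos
  by (simp add: unit_weight_def W_def)

lemma copies_bounds:
  assumes "c \<in> set (satisfiable T I)"
  shows "copies T L I c \<le> B" "unit_weight * real (copies T L I c) \<le> W c"
    "W c \<le> unit_weight * (real (copies T L I c) + 1)"
proof -
  let ?h = "heaviest T I"
  have d: "wden c > 0" "wden ?h > 0"
    using satisfiableD(6)[OF assms] satisfiableD(6)[OF heaviest(1)[OF satisfiable_nonempty]] by auto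
  define x where "x = real (wnum c * wden ?h * B) / real (wden c * wnum ?h)"
  have x: "x = W c / unit_weight"
    using d heaviest_pos B_pos by (simp add: x_def W_def unit_weight_def field_simps)
  have fl: "real (copies T L I c) = of_int \<lfloor>x\<rfloor>"
    unfolding copies_def x_def B_def[symmetric] floor_divide_of_nat_eq by simp
  have "x \<le> real B"
    unfolding x pos_divide_le_eq[OF unit_weight_pos]
    using heaviest(2)[OF satisfiable_nonempty assms] B_pos by (simp add: unit_weight_def)
  then show "copies T L I c \<le> B"
    using fl of_int_floor_le[of x] by linarith
  have "real (copies T L I c) \<le> x" "x \<le> real (copies T L I c) + 1"
    using fl by linarith+
  then show "unit_weight * real (copies T L I c) \<le> W c" "W c \<le> unit_weight * (real (copies T L I c) + 1)"
    using unit_weight_pos unfolding x by (simp_all add: le_divide_eq divide_le_eq mult.commute)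
qed

lemma sat_count_expand:
  "sat_count T cs \<xi> = (\<Sum>c\<leftarrow>satisfiable T I. real (copies T L I c) * sat T (fst c) (map ((!) \<xi>) (fst (snd c))))"
  unfolding sat_count_expand_min B_def[symmetric] using copies_bounds(1)
  by (intro arg_cong[of _ _ sum_list] map_cong) auto

lemma Val_bounds:
  assumes "\<xi> \<in> assignments q F"
  shows "unit_weight * sat_count T cs \<xi> \<le> Val \<Lambda> F \<xi>"
    "Val \<Lambda> F \<xi> \<le> unit_weight * (sat_count T cs \<xi> + real (length (constrs F)))"
proof -
  let ?s = "\<lambda>c. sat T (fst c) (map ((!) \<xi>) (fst (snd c)))"
  show "unit_weight * sat_count T cs \<xi> \<le> Val \<Lambda> F \<xi>"
    unfolding Val_eq[OF assms] sat_count_expand sum_list_const_mult[symmetric] mult.assoc[symmetric]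
    by (intro sum_list_mono mult_right_mono copies_bounds) auto
  have "Val \<Lambda> F \<xi> \<le> (\<Sum>c\<leftarrow>satisfiable T I. unit_weight * (real (copies T L I c) * ?s c + 1))"
    unfolding Val_eq[OF assms]
  proof (rule sum_list_mono)
    fix c assume "c \<in> set (satisfiable T I)"
    then have "W c * ?s c \<le> unit_weight * (real (copies T L I c) + 1) * ?s c"
      by (intro mult_right_mono copies_bounds) auto
    also have "\<dots> \<le> unit_weight * (real (copies T L I c) * ?s c + 1)"
      using unit_weight_pos by (simp add: algebra_simps)
    finally show "W c * ?s c \<le> unit_weight * (real (copies T L I c) * ?s c + 1)" .
  qed
  also have "\<dots> = unit_weight * (sat_count T cs \<xi> + real (length (satisfiable T I)))"
    by (simp add: sum_list_const_mult sum_list_addf sum_list_triv sat_count_expand)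
  also have "\<dots> \<le> unit_weight * (sat_count T cs \<xi> + real (length (constrs F)))"
    using unit_weight_pos by (simp add: satisfiable_def inst_rep_def)
  finally show "Val \<Lambda> F \<xi> \<le> unit_weight * (sat_count T cs \<xi> + real (length (constrs F)))" .
qed

text \<open>The heaviest constraint is satisfiable and its scope is distinct, so some assignment
  satisfies at least this constraint.\<close>

lemma Opt_ge_heaviest: "unit_weight * real B \<le> Opt q \<Lambda> F"
proof -
  let ?h = "heaviest T I"
  note h = satisfiableD[OF heaviest(1)[OF satisfiable_nonempty]]
  obtain vs where vs: "(fst ?h, vs) \<in> set T" using h(5) by blast
  obtain \<xi> where \<xi>: "length \<xi> = nvars F" "set \<xi> \<subseteq> {..<q}" "map ((!) \<xi>) (fst (snd ?h)) = vs"
    using vs h by (auto simp: mem_table intro: exists_satisfying_assignment[OF h(3,4) _ _ q])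
  then have a: "\<xi> \<in> assignments q F" by (simp add: assignments_def)
  have "unit_weight * real B = W ?h * sat T (fst ?h) (map ((!) \<xi>) (fst (snd ?h)))"
    using B_pos vs \<xi>(3) by (simp add: unit_weight_def sat_def)
  also have "\<dots> \<le> Val \<Lambda> F \<xi>"
    unfolding Val_eq[OF a] using heaviest(1)[OF satisfiable_nonempty]
    by (intro member_le_sum_list) (auto simp: W_def)
  also have "\<dots> \<le> Opt q \<Lambda> F"
    by (rule Val_le_Opt[OF a])
  finally show ?thesis .
qed

text \<open>The copies of the heaviest constraint alone account for this.\<close>

lemma B_le_length: "B \<le> length cs"
proof -
  let ?h = "heaviest T I"
  have "copies T L I ?h = B"
    by (rule copies_heaviest[OF satisfiable_nonempty heaviest_pos])
  then have "B = min (copies T L I ?h) B" by simp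
  also have "\<dots> \<le> length cs"
    unfolding length_expand B_def[symmetric] using heaviest(1)[OF satisfiable_nonempty]
    by (intro member_le_sum_list) auto
  finally show ?thesis .
qed

end

end

section \<open>The sampled regular instance\<close>

definition repeat :: "nat \<Rightarrow> 'a list \<Rightarrow> 'a list" where
  "repeat D xs = concat (map (\<lambda>_. xs) [0..<D])"

lemma repeat_simps [simp]:
  "repeat 0 xs = []" "repeat (Suc D) xs = repeat D xs @ xs"
  by (simp_all add: repeat_def)

lemma length_repeat [simp]: "length (repeat D xs) = D * length xs"
  by (induction D) auto

lemma map_repeat: "map f (repeat D xs) = repeat D (map f xs)"
  by (induction D) auto

lemma filter_repeat: "filter P (repeat D xs) = repeat D (filter P xs)"
  by (induction D) auto

lemma concat_repeat: "concat (repeat D xs) = repeat D (concat xs)"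
  by (induction D) auto

lemma count_list_repeat: "count_list (repeat D xs) i = D * count_list xs i"
  by (induction D) auto

lemma sum_list_repeat: "sum_list (repeat D xs) = real D * sum_list xs"
  by (induction D) (auto simp: algebra_simps)

lemma set_repeat: "set (repeat D xs) \<subseteq> set xs"
  by (induction D) auto

lemma ptime_repeat: "ptime xs \<Longrightarrow> ptime (\<lambda>x. repeat D (xs x))"
proof (rule ptime_comp[where f = "repeat D"])
  show "ptime (repeat D :: 'b list \<Rightarrow> _)"
    unfolding repeat_def by (intro ptime_intros)
qed

text \<open>
  The copies of the variables are the positions in the list of all occurrences of variables;
  a copy belongs to the variable that occurs at its position.
\<close>

definition slots :: "(nat \<times> nat list) list \<Rightarrow> nat list" where
  "slots cs = concat (map snd cs)"

definition owner :: "nat list \<Rightarrow> nat \<Rightarrow> nat" where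
  "owner sl u = hd (drop u sl)"

definition tokens :: "nat \<Rightarrow> nat list \<Rightarrow> nat \<Rightarrow> nat list" where
  "tokens D sl R = draws (owner sl) R (repeat D [0..<length sl]) (repeat D sl)"

definition regroup :: "(nat \<times> nat list) list \<Rightarrow> nat list \<Rightarrow> (nat \<times> nat list) list" where
  "regroup cs ts = mapaccum (\<lambda>ts c. ((fst c, take (length (snd c)) ts), drop (length (snd c)) ts)) ts cs"

definition sample :: "nat \<Rightarrow> (nat \<times> nat list) list \<Rightarrow> nat \<Rightarrow> (nat \<times> nat list) list" where
  "sample D cs R = regroup (repeat D cs) (tokens D (slots cs) R)"

text \<open>The form in which a program builds the sampled instance; the analysis works with
  \<open>sample_inst\<close>.\<close>

definition sample_rep :: "nat \<Rightarrow> (nat \<times> nat list) list \<Rightarrow> nat \<Rightarrow> inst_rep" where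
  "sample_rep D cs R = ([0..<length (slots cs)], map (\<lambda>c. (fst c, snd c, 1, length (repeat D cs))) (sample D cs R))"

definition sample_inst :: "nat \<Rightarrow> (nat \<times> nat list) list \<Rightarrow> nat \<Rightarrow> inst" where
  "sample_inst D cs R = \<lparr>nvars = length (slots cs),
     constrs = map (\<lambda>c. \<lparr>pred_ix = fst c, scope = snd c, weight = 1 / of_nat (length (repeat D cs))\<rparr>) (sample D cs R)\<rparr>"

definition cloud :: "nat list \<Rightarrow> nat list \<Rightarrow> nat \<Rightarrow> nat list" where
  "cloud sl \<sigma> i = map (\<lambda>z. hd (drop (fst z) \<sigma>)) (filter (\<lambda>z. snd z = i) (List.enumerate 0 sl))"

text \<open>A variable that occurs in no expanded constraint has no copies. It gets the default
  \<open>[0]\<close>, since the rounding needs nonempty lists and 0 is always in the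
  alphabet.\<close>

definition clouds :: "nat list \<Rightarrow> nat list \<Rightarrow> nat list \<Rightarrow> nat list list" where
  "clouds sl \<sigma> vars = map (\<lambda>i. if cloud sl \<sigma> i = [] then [0] else cloud sl \<sigma> i) vars"

section \<open>Sampling and clouds in polynomial time\<close>

lemma ptime_slots: "ptime cs \<Longrightarrow> ptime (\<lambda>x. slots (cs x))"
  unfolding slots_def by (intro ptime_intros)

lemma ptime_clouds:
  assumes "ptime sl" "ptime \<sigma>" "ptime vars"
  shows "ptime (\<lambda>x. clouds (sl x) (\<sigma> x) (vars x))"
proof -
  have "ptime (\<lambda>z. cloud (sl (fst z)) (\<sigma> (fst z)) (snd z))"
    unfolding cloud_def by (intro ptime_intros ptime_comp[OF assms(1)] ptime_comp[OF assms(2)])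
  then show ?thesis
    unfolding clouds_def by (intro ptime_intros assms)
qed

lemma esize_remove1: "esize (remove1 x xs) \<le> esize xs"
  by (induction xs) auto

lemma ptime_tokens:
  assumes "ptime sl" "ptime R"
  shows "ptime (\<lambda>x. tokens D (sl x) (R x))"
  unfolding tokens_def draws_def
proof (rule ptime_mapaccum[where b = 0])
  show "ptime (\<lambda>z. draw_step (owner (sl (fst z))) (fst (snd z)) (snd (snd z)))"
    unfolding draw_step_def owner_def Let_def by (intro ptime_intros ptime_comp[OF assms(1)])
  show "esize (snd (draw_step (owner (sl e)) s x)) \<le> esize s + poly 0 (esize e + esize x)" for e s x
    unfolding draw_step_def Let_def
    using esize_remove1[of _ "snd s"] by (auto intro!: add_mono floorlog_mono)
qed (intro ptime_intros ptime_repeat assms)+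

lemma ptime_sample_rep:
  assumes "ptime cs" "ptime R"
  shows "ptime (\<lambda>x. sample_rep D (cs x) (R x))"
proof -
  have "ptime (\<lambda>x. sample D (cs x) (R x))"
    unfolding sample_def regroup_def
  proof (rule ptime_mapaccum[where b = 0])
    show "ptime (\<lambda>z. ((fst (snd (snd z)), take (length (snd (snd (snd z)))) (fst (snd z))), drop (length (snd (snd (snd z)))) (fst (snd z))))"
      by (intro ptime_intros)
    show "esize (snd ((fst c, take (length (snd c)) ts), drop (length (snd c)) ts)) \<le> esize ts + poly 0 (esize e + esize c)"
      for ts :: "nat list" and c :: "nat \<times> nat list" and e :: 'a
      using esize_drop[of "length (snd c)" ts] by simp
  qed (intro ptime_tokens ptime_slots ptime_repeat assms)+
  then show ?thesis
    unfolding sample_rep_def length_repeat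
    by (intro ptime_intros ptime_slots ptime_repeat assms ptime_comp[OF assms(1)])
qed

text \<open>The encoding demands fractions in lowest terms; with numerator 1 this is automatic, so
  the program needs no greatest common divisor.\<close>

lemma sample_rep_eq:
  assumes "D > 0" "cs \<noteq> []"
  shows "inst_rep (sample_inst D cs R) = sample_rep D cs R"
proof -
  have "quotient_of (1 / of_nat m) = (1, int m)" if "m > 0" for m
    using that quotient_of_Fract[of 1 "int m"]
    by (simp add: Fract_of_int_quotient Rat.normalize_def)
  from this[of "D * length cs"] show ?thesis
    using assms by (simp add: inst_rep_def sample_inst_def sample_rep_def constr_rep_def comp_def nat_mult_distrib)
qed

section \<open>Structure, regularity and value of the sample\<close>

lemma owner_nth: "u < length sl \<Longrightarrow> owner sl u = sl ! u"
  by (simp add: owner_def hd_drop_conv_nth)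

lemma map_owner: "map (owner sl) [0..<length sl] = sl"
  by (rule nth_equalityI) (auto simp: owner_nth)

lemma balanced_owner: "balanced (owner sl) (repeat D [0..<length sl]) (repeat D sl)"
  unfolding balanced_def
proof
  fix i
  have "length (filter (\<lambda>u. owner sl u = i) [0..<length sl]) = length (filter (\<lambda>v. v = i) (map (owner sl) [0..<length sl]))"
    by (simp add: filter_map comp_def)
  also have "\<dots> = count_list sl i"
    unfolding map_owner by (induction sl) auto
  finally show "length (filter (\<lambda>u. owner sl u = i) (repeat D [0..<length sl])) = count_list (repeat D sl) i"
    by (simp add: filter_repeat count_list_repeat)
qed

lemma regroup:
  assumes "map w ts = concat (map snd cs)"
  shows "map (\<lambda>c. (fst c, map w (snd c))) (regroup cs ts) = cs" "concat (map snd (regroup cs ts)) = ts"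
  using assms unfolding regroup_def
proof (induction cs arbitrary: ts)
  case (Cons c cs)
  {
    case 1
    then show ?case
      using Cons.IH(1)[of "drop (length (snd c)) ts"] by (simp add: take_map[symmetric] drop_map[symmetric])
  next
    case 2
    then show ?case
      using Cons.IH(2)[of "drop (length (snd c)) ts"] by (simp add: drop_map[symmetric])
  }
qed auto

lemma score_regroup:
  "score (map (\<lambda>c. (snd c, sat T (fst c))) cs) (map f ts) = (\<Sum>c\<leftarrow>regroup cs ts. sat T (fst c) (map f (snd c)))"
  unfolding regroup_def by (induction cs arbitrary: ts) (auto simp: take_map drop_map)

lemma slots_repeat: "concat (map snd (repeat D cs)) = repeat D (slots cs)"
  by (simp add: map_repeat concat_repeat slots_def)

text \<open>For every outcome \<open>R\<close>, forgetting which copies were drawn gives back the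
  original constraints, and forgetting the constraints gives back the list of draws. The structural
  properties of the sample follow from these two views.\<close>

lemma sample_regroup:
  "map (\<lambda>c. (fst c, map (owner (slots cs)) (snd c))) (sample D cs R) = repeat D cs"
  "concat (map snd (sample D cs R)) = tokens D (slots cs) R"
proof -
  have "map (owner (slots cs)) (tokens D (slots cs) R) = concat (map snd (repeat D cs))"
    unfolding slots_repeat tokens_def by (rule owners_draws[OF balanced_owner])
  from regroup[OF this] show "map (\<lambda>c. (fst c, map (owner (slots cs)) (snd c))) (sample D cs R) = repeat D cs"
    "concat (map snd (sample D cs R)) = tokens D (slots cs) R"
    by (simp_all add: sample_def)
qed

lemma mset_tokens: "mset (tokens D sl R) = mset (repeat D [0..<length sl])"
  unfolding tokens_def by (rule mset_draws[OF balanced_owner])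

lemma length_sample [simp]: "length (sample D cs R) = D * length cs"
  using arg_cong[OF sample_regroup(1), of length] by simp

lemma sampleD:
  assumes "c \<in> set (sample D cs R)"
  shows "(fst c, map (owner (slots cs)) (snd c)) \<in> set cs" "set (snd c) \<subseteq> {..<length (slots cs)}"
proof -
  have "(fst c, map (owner (slots cs)) (snd c)) \<in> set (repeat D cs)"
    unfolding sample_regroup(1)[of cs D R, symmetric] set_map by (rule imageI[OF assms])
  then show "(fst c, map (owner (slots cs)) (snd c)) \<in> set cs"
    by (rule subsetD[OF set_repeat])
  have "set (snd c) \<subseteq> set (concat (map snd (sample D cs R)))"
    unfolding set_concat set_map image_image by (rule UN_upper[OF assms])
  also have "\<dots> = set (repeat D [0..<length (slots cs)])"
    unfolding sample_regroup(2) by (rule mset_eq_setD[OF mset_tokens])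
  also have "\<dots> \<subseteq> {..<length (slots cs)}"
    using set_repeat[of D "[0..<length (slots cs)]"] by (simp add: atLeast0LessThan)
  finally show "set (snd c) \<subseteq> {..<length (slots cs)}" .
qed

lemma length_filter_mem_concat:
  "(\<And>xs. xs \<in> set xss \<Longrightarrow> distinct xs) \<Longrightarrow> length (filter (\<lambda>xs. u \<in> set xs) xss) = count_list (concat xss) u"
  by (induction xss) (auto simp: count_list_distinct)

locale sampled =
  fixes q :: nat and \<Lambda> :: csp and cs :: "(nat \<times> nat list) list" and D :: nat
  assumes cs: "\<And>c. c \<in> set cs \<Longrightarrow>
      fst c < length \<Lambda> \<and> length (snd c) = arity (\<Lambda> ! fst c) \<and> distinct (snd c)"
    and cs_nonempty: "cs \<noteq> []" and D: "D > 0"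
begin

text \<open>The owners of the drawn copies form an original scope. As these owners are distinct, so
  are the copies.\<close>

lemma sample_scope:
  assumes "c \<in> set (sample D cs R)"
  shows "fst c < length \<Lambda>" "length (snd c) = arity (\<Lambda> ! fst c)" "distinct (snd c)"
  using cs[OF sampleD(1)[OF assms]] by (auto simp: distinct_map)

text \<open>Scopes being distinct, the degree of a copy is the number of times it was drawn, and
  every copy lies exactly \<open>D\<close> times in the exhausted pool.\<close>

lemma sample_inst_regular: "regular_of_degree (sample_inst D cs R) D"
  unfolding regular_of_degree_def
proof (intro allI impI)
  fix u assume "u < nvars (sample_inst D cs R)"
  then have u: "u < length (slots cs)" by (simp add: sample_inst_def)
  have "var_degree (sample_inst D cs R) u = length (filter (\<lambda>xs. u \<in> set xs) (map snd (sample D cs R)))"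
    by (simp add: var_degree_def sample_inst_def filter_map comp_def)
  also have "\<dots> = count_list (tokens D (slots cs) R) u"
    unfolding sample_regroup(2)[symmetric] by (rule length_filter_mem_concat) (auto dest: sample_scope(3))
  also have "\<dots> = count (mset (repeat D [0..<length (slots cs)])) u"
    unfolding mset_tokens[of D "slots cs" R, symmetric] by (simp add: count_mset)
  also have "\<dots> = D * count_list [0..<length (slots cs)] u"
    by (simp add: count_mset count_list_repeat)
  also have "\<dots> = D"
    using u by (simp add: count_list_distinct)
  finally show "var_degree (sample_inst D cs R) u = D" .
qed

lemma sample_inst_unweighted: "unweighted_instance \<Lambda> (sample_inst D cs R)"
proof -
  have "D * length cs > 0"
    using D cs_nonempty by simp
  then have "(\<Sum>c\<leftarrow>sample D cs R. 1 / of_nat (D * length cs)) = (1 :: rat)"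
    by (simp add: sum_list_triv)
  then show ?thesis
    using sample_scope sampleD(2)
    by (fastforce simp: unweighted_instance_def weighted_instance_def sample_inst_def comp_def)
qed

lemma Val_sample:
  assumes "\<sigma> \<in> assignments q (sample_inst D cs R)"
  shows "Val \<Lambda> (sample_inst D cs R) \<sigma> =
    (\<Sum>c\<leftarrow>sample D cs R. sat (table q \<Lambda>) (fst c) (map ((!) \<sigma>) (snd c))) / real (D * length cs)"
proof -
  have "of_bool (holds (\<Lambda> ! fst c) (map ((!) \<sigma>) (snd c))) = sat (table q \<Lambda>) (fst c) (map ((!) \<sigma>) (snd c))"
    if c: "c \<in> set (sample D cs R)" for c
  proof -
    have "set (map ((!) \<sigma>) (snd c)) \<subseteq> set \<sigma>"
      using assms sampleD(2)[OF c] by (auto simp: assignments_def sample_inst_def)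
    then have "set (map ((!) \<sigma>) (snd c)) \<subseteq> {..<q}"
      using assms by (auto simp: assignments_def)
    then show ?thesis
      using sample_scope[OF c] by (simp add: sat_def mem_table)
  qed
  then have "(\<Sum>c\<leftarrow>sample D cs R. 1 / real (D * length cs) * of_bool (holds (\<Lambda> ! fst c) (map ((!) \<sigma>) (snd c)))) =
      (\<Sum>c\<leftarrow>sample D cs R. 1 / real (D * length cs) * sat (table q \<Lambda>) (fst c) (map ((!) \<sigma>) (snd c)))"
    by (intro arg_cong[of _ _ sum_list] map_cong) auto
  then show ?thesis
    by (simp add: Val_def sample_inst_def comp_def of_rat_divide of_rat_mult sum_list_const_mult sum_list_divide_distrib)
qed

text \<open>Holds for every outcome \<open>R\<close>: under an assignment that is constant on clouds
  a sampled constraint has the same value as the original one that it comes from.\<close>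

lemma Val_lift:
  assumes "set \<xi> \<subseteq> {..<q}" "set (slots cs) \<subseteq> {..<length \<xi>}"
  defines "\<sigma> \<equiv> map ((!) \<xi>) (slots cs)"
  shows "\<sigma> \<in> assignments q (sample_inst D cs R)"
    "Val \<Lambda> (sample_inst D cs R) \<sigma> = sat_count (table q \<Lambda>) cs \<xi> / real (length cs)"
proof -
  have "set \<sigma> \<subseteq> set \<xi>"
    using assms(2) by (auto simp: \<sigma>_def)
  then show \<sigma>: "\<sigma> \<in> assignments q (sample_inst D cs R)"
    using assms(1) by (auto simp: assignments_def sample_inst_def \<sigma>_def)
  have "map ((!) \<sigma>) (snd c) = map ((!) \<xi>) (map (owner (slots cs)) (snd c))" if "c \<in> set (sample D cs R)" for c
    using sampleD(2)[OF that] by (auto simp: \<sigma>_def owner_nth)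
  then have "(\<Sum>c\<leftarrow>sample D cs R. sat (table q \<Lambda>) (fst c) (map ((!) \<sigma>) (snd c))) =
      (\<Sum>c\<leftarrow>sample D cs R. sat (table q \<Lambda>) (fst c) (map ((!) \<xi>) (map (owner (slots cs)) (snd c))))"
    by (intro arg_cong[of _ _ sum_list] map_cong refl) (simp only:)
  also have "\<dots> = (\<Sum>c\<leftarrow>repeat D cs. sat (table q \<Lambda>) (fst c) (map ((!) \<xi>) (snd c)))"
    unfolding sample_regroup(1)[of cs D R, symmetric] by (simp add: comp_def)
  also have "\<dots> = real D * sat_count (table q \<Lambda>) cs \<xi>"
    by (simp add: map_repeat sum_list_repeat sat_count_def)
  finally show "Val \<Lambda> (sample_inst D cs R) \<sigma> = sat_count (table q \<Lambda>) cs \<xi> / real (length cs)"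
    using D by (simp add: Val_sample[OF \<sigma>])
qed

end

lemma avg_repeat:
  assumes "D > 0"
  shows "avg (\<lambda>i. repeat D (U i)) s g = avg U s g"
  using assms by (induction s arbitrary: g) (simp_all add: map_repeat sum_list_repeat)

text \<open>The random copies used in the rounding and the urns used in the concentration bound
  define the same expectation. The default value in \<open>clouds\<close> does not interfere, since
  the variables of \<open>s\<close> do occur in \<open>sl\<close>.\<close>

lemma clouds_avg:
  assumes "set s \<subseteq> set sl" "set s \<subseteq> {..<n}" "length \<sigma> = length sl"
  shows "avg ((!) (clouds sl \<sigma> [0..<n])) s g = avg (urns (owner sl) ((!) \<sigma>) [0..<length sl]) s g"
proof (rule avg_cong)
  fix i assume i: "i \<in> set s"
  have "cloud sl \<sigma> i = map (\<lambda>z. \<sigma> ! fst z) (filter (\<lambda>z. owner sl (fst z) = i) (List.enumerate 0 sl))"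
  proof -
    have *: "fst z < length sl \<and> snd z = owner sl (fst z)" if "z \<in> set (List.enumerate 0 sl)" for z
      using that by (auto simp: in_set_enumerate_eq owner_nth)
    have "filter (\<lambda>z. snd z = i) (List.enumerate 0 sl) = filter (\<lambda>z. owner sl (fst z) = i) (List.enumerate 0 sl)"
      by (rule filter_cong) (use * in auto)
    then show ?thesis
      unfolding cloud_def using * assms(3) by (auto simp: hd_drop_conv_nth)
  qed
  also have "\<dots> = map ((!) \<sigma>) (filter (\<lambda>u. owner sl u = i) (map fst (List.enumerate 0 sl)))"
    unfolding filter_map map_map comp_def ..
  finally have "cloud sl \<sigma> i = urns (owner sl) ((!) \<sigma>) [0..<length sl] i"
    by (simp add: urns_def)
  moreover have "urns (owner sl) ((!) \<sigma>) [0..<length sl] i \<noteq> []"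
  proof -
    obtain u where "u < length sl" "sl ! u = i"
      using i assms(1) by (metis in_set_conv_nth subsetD)
    then show ?thesis
      by (auto simp: urns_def filter_empty_conv owner_nth intro!: bexI[of _ u])
  qed
  ultimately show "clouds sl \<sigma> [0..<n] ! i = urns (owner sl) ((!) \<sigma>) [0..<length sl] i"
    using i assms(2) by (auto simp: clouds_def)
qed

text \<open>Chernoff's argument: Markov's inequality for the exponential moment, counting outcomes
  instead of measuring probability. There are at most \<open>k\<close> draws per sampled constraint,
  which explains the \<open>k\<close> in the exponent.\<close>

lemma card_overestimates:
  fixes cs :: "(nat \<times> nat list) list" and \<sigma> :: "nat \<Rightarrow> nat" and T :: table
  assumes cs: "\<And>c. c \<in> set cs \<Longrightarrow> distinct (snd c) \<and> length (snd c) \<le> k"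
    and "k > 0" "D > 0" "\<epsilon> > 0"
  defines "P \<equiv> (\<Sum>c\<leftarrow>cs. avg (urns (owner (slots cs)) \<sigma> [0..<length (slots cs)]) (snd c) (sat T (fst c)))"
  shows "real (card {R \<in> {..<num_draws (repeat D (slots cs))}.
      real D * P + \<epsilon> * real (D * length cs) \<le> (\<Sum>c\<leftarrow>sample D cs R. sat T (fst c) (map \<sigma> (snd c)))})
    \<le> real (num_draws (repeat D (slots cs))) * exp (- (\<epsilon>\<^sup>2 * real (D * length cs) / (2 * real k)))"
proof -
  define its where "its = map (\<lambda>c. (snd c, sat T (fst c))) (repeat D cs)"
  define Q where "Q = num_draws (repeat D (slots cs))"
  define M where "M = real (D * length cs)"
  \<comment> \<open>The minimizer of \<open>l^2 / 2 * k * M - l * \<epsilon> * M\<close>.\<close>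
  define l where "l = \<epsilon> / real k"
  define S where "S R = (\<Sum>c\<leftarrow>sample D cs R. sat T (fst c) (map \<sigma> (snd c)))" for R
  have l: "l > 0" using assms by (simp add: l_def)
  have its_slots: "concat (map fst its) = repeat D (slots cs)"
    by (simp add: its_def comp_def slots_repeat)
  have score: "score its (map \<sigma> (draws (owner (slots cs)) R (repeat D [0..<length (slots cs)]) (repeat D (slots cs)))) = S R" for R
    unfolding its_def score_regroup S_def sample_def tokens_def ..
  have "(\<Sum>(s, g)\<leftarrow>its. avg (urns (owner (slots cs)) \<sigma> (repeat D [0..<length (slots cs)])) s g) = real D * P"
  proof -
    have "avg (urns (owner (slots cs)) \<sigma> (repeat D [0..<length (slots cs)])) s g =
        avg (urns (owner (slots cs)) \<sigma> [0..<length (slots cs)]) s g" for s g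
      using avg_repeat[OF \<open>D > 0\<close>, of "urns (owner (slots cs)) \<sigma> [0..<length (slots cs)]" s g]
      by (simp add: urns_def[abs_def] filter_repeat map_repeat)
    then show ?thesis
      by (simp add: its_def comp_def P_def map_repeat sum_list_repeat)
  qed
  note avg_its = this
  have "distinct s \<and> (\<forall>vs. 0 \<le> g vs \<and> g vs \<le> 1)" if "(s, g) \<in> set its" for s g
  proof -
    obtain c where c: "c \<in> set (repeat D cs)" "s = snd c" "g = sat T (fst c)"
      using \<open>(s, g) \<in> set its\<close> by (auto simp: its_def)
    have "c \<in> set cs"
      by (rule subsetD[OF set_repeat c(1)])
    then show ?thesis
      using cs c by simp
  qed
  note items = this
  have moment: "(\<Sum>R<Q. exp (l * S R)) \<le> real Q * exp (l * (real D * P) + l\<^sup>2 / 2 * real (length (repeat D (slots cs))))"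
    using exp_moment_draws[OF l, of its "owner (slots cs)" "repeat D [0..<length (slots cs)]" \<sigma>, OF items]
      balanced_owner[of "slots cs" D]
    unfolding its_slots score Q_def[symmetric] avg_its by blast
  have "length (slots cs) \<le> k * length cs"
    using cs unfolding slots_def by (induction cs) (auto simp: add_mono)
  then have "D * length (slots cs) \<le> D * (k * length cs)"
    by (rule mult_left_mono) simp
  then have len: "real (length (repeat D (slots cs))) \<le> real k * M"
    unfolding M_def of_nat_mult[symmetric] of_nat_le_iff by (simp add: ac_simps)
  define A where "A = {R \<in> {..<Q}. real D * P + \<epsilon> * M \<le> S R}"
  have "real (card A) * exp (l * (real D * P + \<epsilon> * M)) = (\<Sum>R\<in>A. exp (l * (real D * P + \<epsilon> * M)))"
    by simp
  also have "\<dots> \<le> (\<Sum>R\<in>A. exp (l * S R))"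
    using l by (intro sum_mono) (auto simp: A_def)
  also have "\<dots> \<le> (\<Sum>R<Q. exp (l * S R))"
    by (intro sum_mono2) (auto simp: A_def)
  also have "\<dots> \<le> real Q * exp (l * (real D * P) + l\<^sup>2 / 2 * real (length (repeat D (slots cs))))"
    by (rule moment)
  also have "\<dots> \<le> real Q * exp (l * (real D * P) + l\<^sup>2 / 2 * (real k * M))"
    by (intro mult_left_mono[of "exp _"] iffD2[OF exp_le_cancel_iff] add_left_mono mult_left_mono[OF len]) auto
  finally have "real (card A) \<le> real Q * exp (l * (real D * P) + l\<^sup>2 / 2 * (real k * M)) / exp (l * (real D * P + \<epsilon> * M))"
    by (simp add: le_divide_eq)
  also have "\<dots> = real Q * exp (- (\<epsilon>\<^sup>2 * M / (2 * real k)))"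
  proof -
    have "l * (real D * P) + l\<^sup>2 / 2 * (real k * M) - l * (real D * P + \<epsilon> * M) = - (\<epsilon>\<^sup>2 * M / (2 * real k))"
      using \<open>k > 0\<close> by (simp add: l_def power2_eq_square field_simps)
    then show ?thesis
      by (simp only: times_divide_eq_right[symmetric] exp_diff[symmetric])
  qed
  finally show ?thesis
    unfolding A_def Q_def M_def S_def .
qed

section \<open>Random bits\<close>

lemma bits_to_nat_snoc [simp]: "bits_to_nat [] = 0" "bits_to_nat (r @ [b]) = 2 * bits_to_nat r + of_bool b"
  by (simp_all add: bits_to_nat_def)

lemma bij_betw_bits_to_nat: "bij_betw bits_to_nat {r. length r = l} {..<2 ^ l}"
proof -
  have less: "bits_to_nat r < 2 ^ length r" for r
    by (induction r rule: rev_induct) (auto simp: of_bool_def)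
  have "r = r'" if "length r = length r'" "bits_to_nat r = bits_to_nat r'" for r r'
    using that
  proof (induction r arbitrary: r' rule: rev_induct)
    case (snoc b r)
    then obtain s c where r': "r' = s @ [c]"
      by (cases r' rule: rev_cases) auto
    have eq: "2 * bits_to_nat r + of_bool b = 2 * bits_to_nat s + of_bool c"
      using snoc.prems(2) r' by simp
    then have "b = c"
      by (cases b; cases c; simp; presburger)
    with eq snoc r' show ?case by simp
  qed simp
  then have inj: "inj_on bits_to_nat {r. length r = l}"
    by (auto intro: inj_onI)
  have "card {r :: bool list. length r = l} = 2 ^ l"
    using card_lists_length_eq[of "UNIV :: bool set" l] by simp
  then have "bits_to_nat ` {r. length r = l} = {..<2 ^ l}"
    using less by (intro card_subset_eq) (auto simp: card_image[OF inj])
  with inj show ?thesis by (simp add: bij_betw_def)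
qed

lemma prob_random_bits:
  "measure_pmf.prob (random_bits l) {r. E (bits_to_nat r)} = real (card {R \<in> {..<2 ^ l}. E R}) / 2 ^ l"
proof -
  let ?A = "{r :: bool list. length r = l}"
  have fin: "finite ?A" and ne: "?A \<noteq> {}"
    using finite_lists_length_eq[of "UNIV :: bool set" l] Ex_list_of_length[of l] by auto
  have card: "card ?A = 2 ^ l"
    using bij_betw_same_card[OF bij_betw_bits_to_nat[of l]] by simp
  have "bij_betw bits_to_nat (?A \<inter> {r. E (bits_to_nat r)}) {R \<in> {..<2 ^ l}. E R}"
    using bij_betw_bits_to_nat[of l] unfolding bij_betw_def
    by (auto intro: inj_on_subset)
  then have "card (?A \<inter> {r. E (bits_to_nat r)}) = card {R \<in> {..<2 ^ l}. E R}"
    by (rule bij_betw_same_card)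
  then show ?thesis
    unfolding random_bits_def measure_pmf_of_set[OF ne fin] card by simp
qed

text \<open>The last period may be incomplete, so at most \<open>X div Q + 1\<close> periods are
  met; as there is at least one full period, this is at most twice \<open>X / Q\<close>.\<close>

lemma card_periodic_le:
  assumes "\<And>R. E R \<longleftrightarrow> E (R mod Q)" "0 < Q" "Q \<le> X"
  shows "real (card {R \<in> {..<X}. E R}) \<le> 2 * real X / real Q * real (card {R \<in> {..<Q}. E R})"
proof -
  let ?f = "\<lambda>R. (R div Q, R mod Q)"
  have "card {R \<in> {..<X}. E R} \<le> card ({..X div Q} \<times> {R \<in> {..<Q}. E R})"
  proof (rule card_inj_on_le[where f = ?f])
    show "inj_on ?f {R \<in> {..<X}. E R}"
      by (rule inj_onI) (metis div_mult_mod_eq prod.inject)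
    show "?f ` {R \<in> {..<X}. E R} \<subseteq> {..X div Q} \<times> {R \<in> {..<Q}. E R}"
      using assms by (auto intro: div_le_mono)
  qed simp
  also have "\<dots> = (X div Q + 1) * card {R \<in> {..<Q}. E R}"
    by (simp add: card_cartesian_product)
  finally have "real (card {R \<in> {..<X}. E R}) \<le> real (X div Q + 1) * real (card {R \<in> {..<Q}. E R})"
    by (metis of_nat_le_iff of_nat_mult)
  also have "real (X div Q + 1) \<le> 2 * real X / real Q"
  proof -
    have "real (X div Q) \<le> real X / real Q"
      by (rule of_nat_div_le_of_nat)
    moreover have "1 \<le> real X / real Q"
      using assms by simp
    ultimately show ?thesis by simp
  qed
  finally show ?thesis
    by (simp add: mult_right_mono)
qed

section \<open>The reduction\<close>

text \<open>The successor makes it positive, as is needed for dividing by it in the tail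
  bound.\<close>

definition arity_bound :: "csp \<Rightarrow> nat" where
  "arity_bound \<Lambda> = Suc (\<Sum>P\<leftarrow>\<Lambda>. arity P)"

lemma arity_le_bound: "p < length \<Lambda> \<Longrightarrow> arity (\<Lambda> ! p) \<le> arity_bound \<Lambda>"
  unfolding arity_bound_def by (intro le_SucI member_le_sum_list) auto

context discretized
begin

abbreviation "K \<equiv> arity_bound \<Lambda>"

lemma round_assignment:
  assumes "length U = nvars F" "\<And>i. i < nvars F \<Longrightarrow> U ! i \<noteq> [] \<and> set (U ! i) \<subseteq> {..<q}"
  shows "greedy_round T K cs U \<in> assignments q F"
    "(\<Sum>c\<leftarrow>cs. avg ((!) U) (snd c) (sat T (fst c))) \<le> sat_count T cs (greedy_round T K cs U)"
proof -
  have 1: "distinct (snd c) \<and> length (snd c) \<le> K \<and> set (snd c) \<subseteq> {..<length U}" if "c \<in> set cs" for c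
    using expandD[OF that] arity_le_bound assms(1) by simp
  have 2: "U ! i \<noteq> []" if "i < length U" for i
    using that assms by simp
  note * = greedy_round_correct[where cs = cs and k = K and U = U and T = T, OF 1 2]
  show "greedy_round T K cs U \<in> assignments q F"
    using *(1,2) assms unfolding assignments_def by (fastforce simp: in_set_conv_nth)
  show "(\<Sum>c\<leftarrow>cs. avg ((!) U) (snd c) (sat T (fst c))) \<le> sat_count T cs (greedy_round T K cs U)"
    using *(3) by (simp add: sat_count_def)
qed

text \<open>Every constraint that survived is satisfiable, so a uniform assignment satisfies it with
  probability at least q^-K. Conditional expectations find an assignment at least as good as this
  average.\<close>

lemma uniform_rounding:
  defines "\<xi> \<equiv> greedy_round T K cs (map (\<lambda>_. [0..<q]) (fst I))"
  shows "\<xi> \<in> assignments q F" "real (length cs) / real q ^ K \<le> sat_count T cs \<xi>"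
proof -
  define U where "U = map (\<lambda>_. [0..<q]) (fst I)"
  have U: "length U = nvars F" "\<And>i. i < nvars F \<Longrightarrow> U ! i = [0..<q]"
    by (simp_all add: U_def inst_rep_def)
  have *: "U ! i \<noteq> [] \<and> set (U ! i) \<subseteq> {..<q}" if "i < nvars F" for i
    using U(2)[OF that] q by auto
  show "\<xi> \<in> assignments q F"
    unfolding \<xi>_def U_def[symmetric] by (rule round_assignment(1)[OF U(1) *])
  have "1 / real q ^ K \<le> avg ((!) U) (snd c) (sat T (fst c))" if c: "c \<in> set cs" for c
  proof -
    obtain vs where vs: "(fst c, vs) \<in> set T" using expandD(5)[OF c] by blast
    have "1 / real q ^ K \<le> 1 / real q ^ length (snd c)"
      using q expandD(1,2)[OF c] arity_le_bound by (intro divide_left_mono power_increasing) auto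
    also have "\<dots> \<le> avg ((!) U) (snd c) (sat T (fst c))"
      by (rule avg_uniform_ge[of _ _ _ _ vs])
        (use vs expandD[OF c] U(2) in \<open>auto simp: sat_def mem_table\<close>)
    finally show ?thesis .
  qed
  then have "(\<Sum>c\<leftarrow>cs. 1 / real q ^ K) \<le> (\<Sum>c\<leftarrow>cs. avg ((!) U) (snd c) (sat T (fst c)))"
    by (rule sum_list_mono)
  also have "\<dots> \<le> sat_count T cs \<xi>"
    unfolding \<xi>_def U_def[symmetric] by (rule round_assignment(2)[OF U(1) *])
  finally show "real (length cs) / real q ^ K \<le> sat_count T cs \<xi>"
    by (simp add: sum_list_triv)
qed

lemma Opt_nonneg: "0 \<le> Opt q \<Lambda> F"
  using Opt_attained[OF q, of F \<Lambda>] Val_nonneg by metis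

lemma Opt_eq_0: "cs = [] \<Longrightarrow> Opt q \<Lambda> F = 0"
  using Opt_attained[OF q, of F \<Lambda>] expand_empty by metis

text \<open>The total rounding error is at most one unit per constraint, while the heaviest
  constraint alone is worth \<open>B\<close> units, at least \<open>L\<close> times as many.\<close>

lemma Opt_ge_constrs:
  assumes "cs \<noteq> []"
  shows "unit_weight * real (length (constrs F)) \<le> Opt q \<Lambda> F / real L"
proof -
  have "unit_weight * (real L * real (length (constrs F))) \<le> unit_weight * real B"
    using unit_weight_pos[OF assms] by (intro mult_left_mono) (auto simp: B_eq algebra_simps)
  also have "\<dots> \<le> Opt q \<Lambda> F"
    by (rule Opt_ge_heaviest[OF assms])
  finally show ?thesis
    using L by (simp add: field_simps)
qed

lemma sat_count_near_Opt:
  assumes "cs \<noteq> []"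
  obtains \<xi> where "\<xi> \<in> assignments q F" "Opt q \<Lambda> F * (1 - 1 / real L) \<le> unit_weight * sat_count T cs \<xi>"
proof -
  obtain \<xi> where \<xi>: "\<xi> \<in> assignments q F" "Opt q \<Lambda> F = Val \<Lambda> F \<xi>"
    by (rule Opt_attained[OF q])
  have "Opt q \<Lambda> F * (1 - 1 / real L) \<le> unit_weight * sat_count T cs \<xi>"
    using Val_bounds(2)[OF assms \<xi>(1)] Opt_ge_constrs[OF assms] \<xi>(2) by (simp add: algebra_simps)
  with \<xi>(1) show thesis by (rule that)
qed

lemma sat_count_le: "sat_count T cs \<xi> \<le> real (length cs)"
  unfolding sat_count_def by (rule sum_list_unit_interval) auto

text \<open>No assignment satisfies more than all expanded constraints, so the uniform one loses at
  most a factor q^K against the optimum of the expansion.\<close>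

lemma uniform_rounding_Val:
  "(1 / real q ^ K - 1 / real L) * Opt q \<Lambda> F \<le> Val \<Lambda> F (greedy_round T K cs (map (\<lambda>_. [0..<q]) (fst I)))"
proof (cases "cs = []")
  case True
  then show ?thesis
    using Opt_eq_0 Val_nonneg[OF uniform_rounding(1)] by simp
next
  case False
  let ?\<xi> = "greedy_round T K cs (map (\<lambda>_. [0..<q]) (fst I))"
  have qK0: "real q ^ K > 0" and qK: "real q ^ K \<ge> 1" using q by simp_all
  obtain \<xi> where \<xi>: "Opt q \<Lambda> F * (1 - 1 / real L) \<le> unit_weight * sat_count T cs \<xi>"
    by (rule sat_count_near_Opt[OF False])
  also have "\<dots> \<le> unit_weight * (sat_count T cs ?\<xi> * real q ^ K)"
  proof (rule mult_left_mono)
    have "sat_count T cs \<xi> \<le> real (length cs)" by (rule sat_count_le)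
    also have "\<dots> \<le> sat_count T cs ?\<xi> * real q ^ K"
      using uniform_rounding(2) qK0 by (simp only: pos_divide_le_eq)
    finally show "sat_count T cs \<xi> \<le> sat_count T cs ?\<xi> * real q ^ K" .
  qed (use unit_weight_pos[OF False] in simp)
  also have "\<dots> \<le> Val \<Lambda> F ?\<xi> * real q ^ K"
    unfolding mult.assoc[symmetric] using Val_bounds(1)[OF False uniform_rounding(1)] qK
    by (intro mult_right_mono) auto
  finally have "Opt q \<Lambda> F * (1 - 1 / real L) / real q ^ K \<le> Val \<Lambda> F ?\<xi>"
    using qK0 by (simp only: pos_divide_le_eq)
  moreover have "(1 / real q ^ K - 1 / real L) * Opt q \<Lambda> F \<le> Opt q \<Lambda> F * (1 - 1 / real L) / real q ^ K"
  proof -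
    have "Opt q \<Lambda> F / real L / real q ^ K \<le> Opt q \<Lambda> F / real L"
      using mult_left_mono[OF qK, of "Opt q \<Lambda> F / real L"] Opt_nonneg qK0 by (simp only: pos_divide_le_eq) simp
    then show ?thesis
      by (simp add: algebra_simps diff_divide_distrib)
  qed
  ultimately show ?thesis by linarith
qed

text \<open>Converts an additive error, a fraction of all expanded constraints, into a
  multiplicative one at the cost of a factor q^K.\<close>

lemma length_le_Opt:
  assumes "cs \<noteq> []"
  shows "unit_weight * real (length cs) \<le> real q ^ K * Opt q \<Lambda> F"
proof -
  let ?\<xi> = "greedy_round T K cs (map (\<lambda>_. [0..<q]) (fst I))"
  have qK: "real q ^ K > 0" using q by simp
  have "real (length cs) \<le> real q ^ K * sat_count T cs ?\<xi>"
    using uniform_rounding(2) qK by (simp only: pos_divide_le_eq mult.commute)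
  then have "unit_weight * real (length cs) \<le> real q ^ K * (unit_weight * sat_count T cs ?\<xi>)"
    using unit_weight_pos[OF assms] by (simp add: mult.left_commute)
  also have "\<dots> \<le> real q ^ K * Opt q \<Lambda> F"
    using Val_bounds(1)[OF assms uniform_rounding(1)] Val_le_Opt[OF uniform_rounding(1), of \<Lambda>] qK
    by (intro mult_left_mono) linarith+
  finally show ?thesis .
qed

abbreviation "N \<equiv> length (slots cs)"

lemma slots_vars: "set (slots cs) \<subseteq> {..<nvars F}"
  using expandD(4) by (fastforce simp: slots_def)

lemma sampled: "cs \<noteq> [] \<Longrightarrow> D > 0 \<Longrightarrow> sampled \<Lambda> cs D"
  by unfold_locales (use expandD in auto)

definition decode :: "nat list \<Rightarrow> nat list" where
  "decode \<sigma> = greedy_round T K cs (clouds (slots cs) \<sigma> (fst I))"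

text \<open>For an assignment \<sigma> of the copies, the expected number of satisfied constraints
  when each variable takes the value of a random copy; \<open>D\<close> times this is the mean of
  the sampled count under \<sigma>.\<close>

definition blowup :: "nat list \<Rightarrow> real" where
  "blowup \<sigma> = (\<Sum>c\<leftarrow>cs. avg (urns (owner (slots cs)) ((!) \<sigma>) [0..<N]) (snd c) (sat T (fst c)))"

lemma decode:
  assumes "length \<sigma> = N" "set \<sigma> \<subseteq> {..<q}"
  shows "decode \<sigma> \<in> assignments q F" "blowup \<sigma> \<le> sat_count T cs (decode \<sigma>)"
proof -
  let ?U = "clouds (slots cs) \<sigma> [0..<nvars F]"
  have I: "fst I = [0..<nvars F]" by (simp add: inst_rep_def)
  have 1: "length ?U = nvars F" by (simp add: clouds_def)
  have 2: "?U ! i \<noteq> [] \<and> set (?U ! i) \<subseteq> {..<q}" if "i < nvars F" for i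
  proof -
    have "set (cloud (slots cs) \<sigma> i) \<subseteq> set \<sigma>"
      using assms(1) by (auto simp: cloud_def in_set_enumerate_eq hd_drop_conv_nth)
    then show ?thesis
      using that assms(2) q by (auto simp: clouds_def)
  qed
  show "decode \<sigma> \<in> assignments q F"
    unfolding decode_def I by (rule round_assignment(1)[OF 1 2])
  have "blowup \<sigma> = (\<Sum>c\<leftarrow>cs. avg ((!) ?U) (snd c) (sat T (fst c)))"
    unfolding blowup_def
  proof (intro arg_cong[of _ _ sum_list] map_cong refl)
    fix c assume c: "c \<in> set cs"
    then have "set (snd c) \<subseteq> set (slots cs)" by (auto simp: slots_def)
    then show "avg (urns (owner (slots cs)) ((!) \<sigma>) [0..<N]) (snd c) (sat T (fst c)) =
        avg ((!) ?U) (snd c) (sat T (fst c))"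
      using clouds_avg[OF _ expandD(4)[OF c] assms(1)] by simp
  qed
  also have "\<dots> \<le> sat_count T cs (decode \<sigma>)"
    unfolding decode_def I by (rule round_assignment(2)[OF 1 2])
  finally show "blowup \<sigma> \<le> sat_count T cs (decode \<sigma>)" .
qed

text \<open>Deterministic once the sample does not overestimate the particular \<sigma>. The losses
  are \<open>1 / L\<close> from rounding the weights and \<open>\<epsilon> * q ^ K\<close> from
  sampling.\<close>

lemma decode_Val:
  assumes cs: "cs \<noteq> []" and D: "D > 0" and \<alpha>: "0 < \<alpha>" "\<alpha> \<le> 1" and "\<epsilon> \<ge> 0"
    and \<sigma>: "\<sigma> \<in> assignments q (sample_inst D cs R)"
    and approx: "\<alpha> * Opt q \<Lambda> (sample_inst D cs R) \<le> Val \<Lambda> (sample_inst D cs R) \<sigma>"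
    and good: "(\<Sum>c\<leftarrow>sample D cs R. sat T (fst c) (map ((!) \<sigma>) (snd c))) \<le>
      real D * blowup \<sigma> + \<epsilon> * real (D * length cs)"
  shows "(\<alpha> - 1 / real L - \<epsilon> * real q ^ K) * Opt q \<Lambda> F \<le> Val \<Lambda> F (decode \<sigma>)"
proof -
  interpret S: sampled q \<Lambda> cs D by (rule sampled[OF cs D])
  let ?u = unit_weight and ?M = "real (length cs)" and ?O = "Opt q \<Lambda> F"
  have M: "?M > 0" using cs by simp
  have \<sigma>': "length \<sigma> = N" "set \<sigma> \<subseteq> {..<q}"
    using \<sigma> by (simp_all add: assignments_def sample_inst_def)
  obtain \<xi> where \<xi>: "\<xi> \<in> assignments q F" "?O * (1 - 1 / real L) \<le> ?u * sat_count T cs \<xi>"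
    by (rule sat_count_near_Opt[OF cs])
  have lift: "set \<xi> \<subseteq> {..<q}" "set (slots cs) \<subseteq> {..<length \<xi>}"
    using \<xi>(1) slots_vars by (simp_all add: assignments_def)
  have "\<alpha> * (sat_count T cs \<xi> / ?M) \<le> \<alpha> * Opt q \<Lambda> (sample_inst D cs R)"
    using Val_le_Opt[OF S.Val_lift(1)[OF lift, of R], of \<Lambda>] \<alpha> unfolding S.Val_lift(2)[OF lift]
    by (intro mult_left_mono) auto
  also have "\<dots> \<le> (\<Sum>c\<leftarrow>sample D cs R. sat T (fst c) (map ((!) \<sigma>) (snd c))) / real (D * length cs)"
    using approx unfolding S.Val_sample[OF \<sigma>] .
  also have "\<dots> \<le> (real D * blowup \<sigma> + \<epsilon> * real (D * length cs)) / real (D * length cs)"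
    by (rule divide_right_mono[OF good]) simp
  also have "\<dots> = (blowup \<sigma> + \<epsilon> * ?M) / ?M"
    using D M by (simp add: field_simps)
  finally have "\<alpha> * sat_count T cs \<xi> \<le> blowup \<sigma> + \<epsilon> * ?M"
    using M by (simp add: divide_le_cancel)
  then have "\<alpha> * sat_count T cs \<xi> \<le> sat_count T cs (decode \<sigma>) + \<epsilon> * ?M"
    using decode(2)[OF \<sigma>'] by linarith
  then have "?u * (\<alpha> * sat_count T cs \<xi>) \<le> ?u * (sat_count T cs (decode \<sigma>) + \<epsilon> * ?M)"
    using unit_weight_pos[OF cs] by (intro mult_left_mono) auto
  then have "\<alpha> * (?u * sat_count T cs \<xi>) \<le> ?u * sat_count T cs (decode \<sigma>) + \<epsilon> * (?u * ?M)"
    by (simp add: algebra_simps)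
  moreover have "\<alpha> * (?O * (1 - 1 / real L)) \<le> \<alpha> * (?u * sat_count T cs \<xi>)"
    using \<xi>(2) \<alpha> by (intro mult_left_mono) auto
  moreover have "?u * sat_count T cs (decode \<sigma>) \<le> Val \<Lambda> F (decode \<sigma>)"
    by (rule Val_bounds(1)[OF cs decode(1)[OF \<sigma>']])
  moreover have "\<epsilon> * (?u * ?M) \<le> \<epsilon> * (real q ^ K * ?O)"
    by (intro mult_left_mono length_le_Opt[OF cs] \<open>\<epsilon> \<ge> 0\<close>)
  moreover have "\<alpha> * (?O / real L) \<le> 1 * (?O / real L)"
    using \<alpha> Opt_nonneg by (intro mult_right_mono) auto
  ultimately show ?thesis
    by (simp add: algebra_simps)
qed

text \<open>The assignment returned on the sample depends on the sample, hence a union bound over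
  all assignments of the copies. The largeness of \<open>D\<close> lets the exponential tail absorb
  their number and still leave a factor 1/2 for every expanded constraint.\<close>

lemma prob_overestimate:
  fixes D l :: nat and \<epsilon> :: real
  assumes cs: "cs \<noteq> []" and D: "D > 0" and \<epsilon>: "\<epsilon> > 0"
    and D_large: "real K * ln (real q) + ln 2 \<le> \<epsilon>\<^sup>2 * real D / (2 * real K)"
    and l: "num_draws (repeat D (slots cs)) \<le> 2 ^ l"
  shows "measure_pmf.prob (random_bits l) {r. \<exists>\<sigma>. length \<sigma> = N \<and> set \<sigma> \<subseteq> {..<q} \<and>
      real D * blowup \<sigma> + \<epsilon> * real (D * length cs) \<le>
        (\<Sum>c\<leftarrow>sample D cs (bits_to_nat r). sat T (fst c) (map ((!) \<sigma>) (snd c)))}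
    \<le> 2 * 2 powr (- real (nvars F))"
proof -
  define bad where "bad R \<sigma> \<longleftrightarrow> real D * blowup \<sigma> + \<epsilon> * real (D * length cs) \<le>
      (\<Sum>c\<leftarrow>sample D cs R. sat T (fst c) (map ((!) \<sigma>) (snd c)))" for R \<sigma>
  define A where "A = {\<sigma>. set \<sigma> \<subseteq> {..<q} \<and> length \<sigma> = N}"
  define Q where "Q = num_draws (repeat D (slots cs))"
  define M where "M = length cs"
  define e where "e = exp (- (\<epsilon>\<^sup>2 * real (D * M) / (2 * real K)))"
  have A: "finite A" "card A = q ^ N"
    unfolding A_def by (simp_all add: finite_lists_length_eq card_lists_length_eq)
  have K: "K > 0" by (simp add: arity_bound_def)
  have card_bad: "real (card {R \<in> {..<Q}. bad R \<sigma>}) \<le> real Q * e" for \<sigma>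
    unfolding Q_def bad_def e_def M_def blowup_def
    by (rule card_overestimates) (use expandD arity_le_bound K D \<epsilon> in auto)
  have "real (card {R \<in> {..<Q}. \<exists>\<sigma>\<in>A. bad R \<sigma>}) \<le> real (\<Sum>\<sigma>\<in>A. card {R \<in> {..<Q}. bad R \<sigma>})"
  proof -
    have "{R \<in> {..<Q}. \<exists>\<sigma>\<in>A. bad R \<sigma>} = (\<Union>\<sigma>\<in>A. {R \<in> {..<Q}. bad R \<sigma>})" by auto
    then show ?thesis
      using card_UN_le[OF A(1), of "\<lambda>\<sigma>. {R \<in> {..<Q}. bad R \<sigma>}"]
      by (simp only: of_nat_le_iff)
  qed
  also have "\<dots> \<le> (\<Sum>\<sigma>\<in>A. real Q * e)"
    unfolding of_nat_sum by (intro sum_mono card_bad)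
  finally have cardQ: "real (card {R \<in> {..<Q}. \<exists>\<sigma>\<in>A. bad R \<sigma>}) \<le> real q ^ N * real Q * e"
    by (simp add: A(2))

  have tail: "real q ^ N * e \<le> 2 powr (- real (nvars F))"
  proof -
    \<comment> \<open>Here it matters that \<open>ticks\<close> counts the variables besides the
      constraints.\<close>
    have M: "nvars F \<le> M"
    proof -
      have "nvars F + length (constrs F) \<le> L * (nvars F + length (constrs F))"
        using L by simp
      also have "\<dots> \<le> M"
        using B_le_length[OF cs] unfolding B_eq M_def .
      finally show ?thesis by simp
    qed
    have "length (concat (map snd xs)) \<le> K * length xs" if "set xs \<subseteq> set cs" for xs
      using that
    proof (induction xs)
      case (Cons x xs)
      then have "length (snd x) \<le> K"
        using expandD(1,2)[of x] arity_le_bound by simp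
      with Cons show ?case by simp
    qed simp
    then have N: "N \<le> K * M"
      unfolding slots_def M_def by simp
    have "real q ^ N = exp (real N * ln (real q))"
      using q by (simp add: exp_of_nat_mult)
    also have "\<dots> \<le> exp (real (K * M) * ln (real q))"
      using N q by (intro iffD2[OF exp_le_cancel_iff] mult_right_mono of_nat_mono) auto
    finally have "real q ^ N * e \<le> exp (real (K * M) * ln (real q)) * e"
      by (simp add: e_def)
    also have "\<dots> = exp (real M * (real K * ln (real q) - \<epsilon>\<^sup>2 * real D / (2 * real K)))"
      unfolding e_def exp_add[symmetric] by (simp add: algebra_simps)
    also have "\<dots> \<le> exp (real (nvars F) * (- ln 2))"
    proof -
      have "real M * (real K * ln (real q) - \<epsilon>\<^sup>2 * real D / (2 * real K)) \<le> real M * (- ln 2)"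
        using D_large by (intro mult_left_mono) auto
      also have "\<dots> \<le> real (nvars F) * (- ln 2)"
        using M by simp
      finally show ?thesis by simp
    qed
    also have "\<dots> = 2 powr (- real (nvars F))"
      by (simp add: powr_def)
    finally show ?thesis .
  qed

  have Q: "0 < Q" "Q \<le> 2 ^ l"
    using l by (simp_all add: Q_def)
  \<comment> \<open>The sample reads only the digits of \<open>R\<close>, so being bad depends on
    \<open>R\<close> modulo the number of outcomes.\<close>
  have per: "(\<exists>\<sigma>\<in>A. bad R \<sigma>) \<longleftrightarrow> (\<exists>\<sigma>\<in>A. bad (R mod Q) \<sigma>)" for R
  proof -
    have "tokens D (slots cs) (R mod Q + R div Q * Q) = tokens D (slots cs) (R mod Q)"
      unfolding tokens_def Q_def by (rule draws_periodic[OF balanced_owner])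
    then show ?thesis
      by (simp add: bad_def sample_def)
  qed
  have "{r. \<exists>\<sigma>. length \<sigma> = N \<and> set \<sigma> \<subseteq> {..<q} \<and> bad (bits_to_nat r) \<sigma>} = {r. \<exists>\<sigma>\<in>A. bad (bits_to_nat r) \<sigma>}"
    by (auto simp: A_def)
  then have "measure_pmf.prob (random_bits l) {r. \<exists>\<sigma>. length \<sigma> = N \<and> set \<sigma> \<subseteq> {..<q} \<and> bad (bits_to_nat r) \<sigma>} =
      real (card {R \<in> {..<2 ^ l}. \<exists>\<sigma>\<in>A. bad R \<sigma>}) / 2 ^ l"
    by (simp only: prob_random_bits[of l "\<lambda>R. \<exists>\<sigma>\<in>A. bad R \<sigma>"])
  also have "\<dots> \<le> 2 * real (2 ^ l) / real Q * real (card {R \<in> {..<Q}. \<exists>\<sigma>\<in>A. bad R \<sigma>}) / 2 ^ l"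
    by (intro divide_right_mono card_periodic_le[where E = "\<lambda>R. \<exists>\<sigma>\<in>A. bad R \<sigma>", OF per Q]) simp
  also have "\<dots> = 2 / real Q * real (card {R \<in> {..<Q}. \<exists>\<sigma>\<in>A. bad R \<sigma>})"
    by simp
  also have "\<dots> \<le> 2 / real Q * (real q ^ N * real Q * e)"
    by (intro mult_left_mono cardQ) simp
  also have "\<dots> = 2 * (real q ^ N * e)"
    using Q(1) by simp
  also have "\<dots> \<le> 2 * 2 powr (- real (nvars F))"
    using tail by simp
  finally show ?thesis
    unfolding bad_def .
qed

end

section \<open>Programs that call the given algorithm\<close>

text \<open>The given program is known to be fast only on its class of instances, so it is not
  covered by \<open>ptime\<close>. Its run on the single input \<open>f x\<close> is a hypothesis
  instead, and the test \<open>c\<close> allows the call to be skipped when \<open>f x\<close> would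
  lie outside the class.\<close>

lemma run_with_oracle:
  fixes f :: "'a::encodable \<Rightarrow> 'b::encodable" and g :: "'a \<times> 'c::encodable \<Rightarrow> 'd::encodable" and b :: "nat poly"
  assumes "ptime c" "ptime f" "ptime g" "ptime h"
  shows "\<exists>P. \<exists>b' :: nat poly.
    (\<forall>x. \<not> c x \<longrightarrow> (\<exists>t. run P (enc x) (enc (h x)) t \<and> t \<le> poly b' (esize x))) \<and>
    (\<forall>x y t'. c x \<longrightarrow> run p (enc (f x)) (enc y) t' \<longrightarrow> t' \<le> poly b (esize (f x)) \<longrightarrow>
      (\<exists>t. run P (enc x) (enc (g (x, y))) t \<and> t \<le> poly b' (esize x)))"
proof -
  have "ptime (\<lambda>x. (x, f x))" by (intro ptime_intros assms)
  then obtain pf bf where pf: "\<And>x. \<exists>t. run pf (enc x) (enc (x, f x)) t \<and> t \<le> poly bf (esize x)"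
    unfolding ptime_def by blast
  obtain pc bc where pc: "\<And>x. \<exists>t. run pc (enc x) (enc (c x)) t \<and> t \<le> poly bc (esize x)"
    using assms(1) unfolding ptime_def by blast
  obtain pg bg where pg: "\<And>x. \<exists>t. run pg (enc x) (enc (g x)) t \<and> t \<le> poly bg (esize x)"
    using assms(3) unfolding ptime_def by blast
  obtain ph bh where ph: "\<And>x. \<exists>t. run ph (enc x) (enc (h x)) t \<and> t \<le> poly bh (esize x)"
    using assms(4) unfolding ptime_def by blast
  \<comment> \<open>The first component of the fork preserves \<open>x\<close> during the call,
    because \<open>g\<close> needs the original input besides the answer.\<close>
  define P where "P = Cond pc (Seq pf (Seq (Fork (Prim Fst) (Seq (Prim Snd) p)) pg)) ph"
  define b1 where "b1 = pcompose b bf"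
  define b' where "b' = [:10, 1:] + bc + bh + bf * [:5:] + b1 + pcompose bg ([:1, 1:] + b1)"
  show ?thesis
  proof (rule exI[of _ P], rule exI[of _ b'], intro conjI allI impI)
    fix x assume "\<not> c x"
    obtain s where s: "run pc (enc x) (Num 0) s" "s \<le> poly bc (esize x)"
      using pc[of x] \<open>\<not> c x\<close> by auto
    obtain t where t: "run ph (enc x) (enc (h x)) t" "t \<le> poly bh (esize x)"
      using ph by blast
    show "\<exists>t. run P (enc x) (enc (h x)) t \<and> t \<le> poly b' (esize x)"
      unfolding P_def using run_Cond_False[OF s(1) t(1)] s(2) t(2)
      by (intro exI[of _ "1 + s + t"] conjI) (auto simp: b'_def)
  next
    fix x and y :: 'c and t' assume "c x" and t': "run p (enc (f x)) (enc y) t'" "t' \<le> poly b (esize (f x))"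
    obtain s where s: "run pc (enc x) (enc (c x)) s" "s \<le> poly bc (esize x)" "enc (c x) \<noteq> Num 0"
      using pc[of x] \<open>c x\<close> by auto
    obtain t where t: "run pf (enc x) (Pr (enc x) (enc (f x))) t" "t \<le> poly bf (esize x)"
      using pf[of x] by auto
    have sz: "1 + esize x + esize (f x) \<le> poly bf (esize x)"
      using dsize_le_time[OF t(1)] t(2) by simp
    have "poly b (esize (f x)) \<le> poly b (poly bf (esize x))"
      using sz by (intro poly_nat_mono) simp
    then have t'_le: "t' \<le> poly b1 (esize x)"
      using t'(2) by (simp add: b1_def poly_pcompose)
    obtain u where u: "run pg (Pr (enc x) (enc y)) (enc (g (x, y))) u" "u \<le> poly bg (1 + esize x + esize y)"
      using pg[of "(x, y)"] by auto
    have "poly bg (1 + esize x + esize y) \<le> poly bg (1 + esize x + poly b1 (esize x))"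
      using dsize_le_time[OF t'(1)] t'_le by (intro poly_nat_mono) simp
    then have u_le: "u \<le> poly (pcompose bg ([:1, 1:] + b1)) (esize x)"
      using u(2) by (simp add: poly_pcompose)
    have fst: "run (Prim Fst) (Pr (enc x) (enc (f x))) (enc x) (1 + (1 + esize x + esize (f x)) + esize x)"
      using run_Prim[of Fst "Pr (enc x) (enc (f x))"] by simp
    have snd: "run (Prim Snd) (Pr (enc x) (enc (f x))) (enc (f x)) (1 + (1 + esize x + esize (f x)) + esize (f x))"
      using run_Prim[of Snd "Pr (enc x) (enc (f x))"] by simp
    note r = run_Cond_True[OF s(1,3) run_Seq[OF t(1) run_Seq[OF run_Fork[OF fst run_Seq[OF snd t'(1)]] u(1)]], of ph]
    show "\<exists>t. run P (enc x) (enc (g (x, y))) t \<and> t \<le> poly b' (esize x)"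
      unfolding P_def using r
    proof (intro exI conjI)
      show "1 + s + (1 + t + (1 + (1 + (1 + (1 + esize x + esize (f x)) + esize x) +
          (1 + (1 + (1 + esize x + esize (f x)) + esize (f x)) + t')) + u)) \<le> poly b' (esize x)"
        using s(2) t(2) t'_le u_le sz by (simp add: b'_def)
    qed
  qed
qed

lemma esize_bits: "esize (r :: bool list) \<le> 1 + 3 * length r"
proof (induction r)
  case (Cons b r)
  then show ?case
    using esize_bool[of b] unfolding esize_Cons by simp
qed (simp add: floorlog_def)

lemma enc_bits_eq: "enc_bits r = enc r"
  by (simp add: enc_bits_def enc_nats_def comp_def enc_bool_eq[abs_def])

lemma enc_Pair: "enc (x, y) = Pr (enc x) (enc y)"
  by simp

lemma enc_input: "Pr (enc_inst F) (enc_bits r) = enc (inst_rep F, r)"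
  by (simp only: enc_Pair enc_inst_rep enc_bits_eq)

lemma enc_nats_eq: "enc_nats xs = enc xs"
  by (simp add: enc_nats_def)

lemma esize_input_le:
  fixes r :: "bool list"
  assumes "length r = poly l (dsize (enc_inst F))"
  shows "esize (inst_rep F, r) \<le> poly ([:2, 1:] + [:3:] * l) (dsize (enc_inst F))"
proof -
  have "esize (inst_rep F, r) = 1 + dsize (enc_inst F) + esize r"
    by (simp only: enc_Pair enc_inst_rep dsize.simps)
  then show ?thesis
    using esize_bits[of r] by (simp add: assms)
qed

lemma num_draws_le_power: "length xs \<le> n \<Longrightarrow> num_draws xs \<le> 2 ^ (n * n)"
proof -
  assume "length xs \<le> n"
  have "num_draws xs \<le> fact (length xs)" by (rule num_draws_le_fact)
  also have "\<dots> \<le> fact n" using \<open>length xs \<le> n\<close> by (rule fact_mono)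
  also have "\<dots> \<le> n ^ n" using fact_le_power[of n, where 'a = nat] by simp
  also have "\<dots> \<le> (2 ^ n) ^ n" by (intro power_mono) (auto simp: less_imp_le)
  finally show ?thesis by (simp add: power_mult)
qed

lemma divide_le_swap:
  fixes x y :: real
  assumes "1 / y \<le> x" "0 < y"
  shows "1 / x \<le> y"
  using le_imp_inverse_le[OF assms(1)] assms(2) by (simp add: inverse_eq_divide)

section \<open>The two algorithms and their combination\<close>

text \<open>No random bits are requested and success is certain. \<open>L\<close> is chosen so large
  that the rounding error \<open>1 / L\<close> fits into the gap between \<beta> and q^-K.\<close>

lemma uniform_algorithm:
  assumes q: "q \<ge> 1" and "\<beta> < 1 / real q ^ arity_bound \<Lambda>" and "\<And>F. \<rho> F \<le> 1"
  shows "\<exists>p. rand_approx_algorithm q \<Lambda> {F. weighted_instance \<Lambda> F} \<beta> \<rho> p"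
proof -
  define K where "K = arity_bound \<Lambda>"
  define L where "L = nat \<lceil>1 / (1 / real q ^ K - \<beta>)\<rceil> + 1"
  have gap: "1 / real q ^ K - \<beta> > 0"
    using assms(2) by (simp add: K_def)
  have "1 / (1 / real q ^ K - \<beta>) \<le> real L"
    unfolding L_def by linarith
  then have L_bounds: "1 / real L \<le> 1 / real q ^ K - \<beta>" "L \<ge> 1"
    by (rule divide_le_swap[OF _ gap]) (simp add: L_def)
  define alg where "alg x = greedy_round (table q \<Lambda>) K (expand (table q \<Lambda>) L (fst x)) (map (\<lambda>_. [0..<q]) (fst (fst x)))"
    for x :: "inst_rep \<times> bool list"
  have "ptime alg"
    unfolding alg_def by (intro ptime_greedy_round ptime_expand ptime_intros)
  then obtain p b where p: "\<And>x. \<exists>t. run p (enc x) (enc (alg x)) t \<and> t \<le> poly b (esize x)"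
    unfolding ptime_def by blast
  have "rand_approx_algorithm q \<Lambda> {F. weighted_instance \<Lambda> F} \<beta> \<rho> p"
    unfolding rand_approx_algorithm_def
  proof (rule exI[of _ "pcompose b ([:2, 1:] + [:3:] * 0)"], rule exI[of _ 0], intro ballI conjI allI impI)
    fix F and r :: "bool list"
    assume "length r = poly 0 (dsize (enc_inst F))"
    then have "esize (inst_rep F, r) \<le> poly ([:2, 1:] + [:3:] * 0) (dsize (enc_inst F))"
      by (rule esize_input_le)
    then have "poly b (esize (inst_rep F, r)) \<le> poly (pcompose b ([:2, 1:] + [:3:] * 0)) (dsize (enc_inst F))"
      unfolding poly_pcompose by (rule poly_nat_mono)
    then show "\<exists>y t. run p (Pr (enc_inst F) (enc_bits r)) y t \<and>
        t \<le> poly (pcompose b ([:2, 1:] + [:3:] * 0)) (dsize (enc_inst F))"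
      unfolding enc_input using p[of "(inst_rep F, r)"] by (meson le_trans)
  next
    fix F assume "F \<in> {F. weighted_instance \<Lambda> F}"
    then interpret discretized q \<Lambda> F L
      using q L_bounds(2) by unfold_locales auto
    have "\<beta> * Opt q \<Lambda> F \<le> (1 / real q ^ K - 1 / real L) * Opt q \<Lambda> F"
      using L_bounds(1) Opt_nonneg by (intro mult_right_mono) auto
    then have Val: "\<beta> * Opt q \<Lambda> F \<le> Val \<Lambda> F (alg (inst_rep F, r))" for r
      using uniform_rounding_Val unfolding alg_def K_def by simp
    have "{r. \<exists>\<xi>\<in>assignments q F. \<exists>t. run p (Pr (enc_inst F) (enc_bits r)) (enc_nats \<xi>) t \<and> \<beta> * Opt q \<Lambda> F \<le> Val \<Lambda> F \<xi>} = UNIV"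
    proof (intro equalityI subset_UNIV subsetI CollectI)
      fix r
      obtain t where "run p (enc (inst_rep F, r)) (enc (alg (inst_rep F, r))) t"
        using p by blast
      moreover have "alg (inst_rep F, r) \<in> assignments q F"
        using uniform_rounding(1) by (simp add: alg_def K_def)
      ultimately show "\<exists>\<xi>\<in>assignments q F. \<exists>t. run p (Pr (enc_inst F) (enc_bits r)) (enc_nats \<xi>) t \<and> \<beta> * Opt q \<Lambda> F \<le> Val \<Lambda> F \<xi>"
        unfolding enc_input enc_nats_eq using Val by blast
    qed
    then show "\<rho> F \<le> measure_pmf.prob (random_bits (poly 0 (dsize (enc_inst F))))
        {r. \<exists>\<xi>\<in>assignments q F. \<exists>t. run p (Pr (enc_inst F) (enc_bits r)) (enc_nats \<xi>) t \<and> \<beta> * Opt q \<Lambda> F \<le> Val \<Lambda> F \<xi>}"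
      using assms(3) by simp
  qed
  then show ?thesis by blast
qed

text \<open>The class matters only through its unweighted \<open>D\<close>-regular members, as every
  sampled instance is one of them. The loss \<delta> is divided evenly between rounding the weights
  and sampling.\<close>

lemma reduction_algorithm:
  fixes q :: nat and \<Lambda> :: csp and D :: nat and \<alpha> \<delta> :: real
  defines "K \<equiv> arity_bound \<Lambda>"
  assumes q: "q \<ge> 1" and \<alpha>: "0 < \<alpha>" "\<alpha> < 1" and \<delta>: "\<delta> > 0" and D: "D > 0"
    and D_large: "8 * real K * real q ^ (2 * K) * (real K * ln (real q) + ln 2) / \<delta>\<^sup>2 \<le> real D"
    and p: "approx_algorithm q \<Lambda> \<F> \<alpha> p"
    and \<F>: "\<And>F. unweighted_instance \<Lambda> F \<Longrightarrow> regular_of_degree F D \<Longrightarrow> F \<in> \<F>"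
  shows "\<exists>p'. rand_approx_algorithm q \<Lambda> {F. weighted_instance \<Lambda> F} (\<alpha> - \<delta>)
    (\<lambda>F. 1 - 2 * 2 powr (- real (nvars F))) p'"
proof -
  let ?T = "table q \<Lambda>"
  define L where "L = nat \<lceil>2 / \<delta>\<rceil> + 1"
  have "1 / (\<delta> / 2) \<le> real L"
    unfolding L_def by simp linarith
  then have L_bounds: "1 / real L \<le> \<delta> / 2" "L \<ge> 1"
    by (rule divide_le_swap) (use \<delta> in \<open>simp_all add: L_def\<close>)
  define \<epsilon> where "\<epsilon> = \<delta> / (2 * real q ^ K)"
  have qK: "real q ^ K > 0" using q by simp
  have K: "K > 0" by (simp add: K_def arity_bound_def)
  have \<epsilon>: "\<epsilon> > 0" "\<epsilon> * real q ^ K = \<delta> / 2"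
    using \<delta> qK by (simp_all add: \<epsilon>_def)
  \<comment> \<open>With \<epsilon>^2 = \<delta>^2 / (4 q^(2K)), the constant
    \<open>8 * K * q ^ (2 * K)\<close> in the assumption on \<open>D\<close> is exactly what this
    requires.\<close>
  have D_large': "real K * ln (real q) + ln 2 \<le> \<epsilon>\<^sup>2 * real D / (2 * real K)"
  proof -
    have pos: "0 < 8 * real K * real q ^ (2 * K)" "0 < \<delta>\<^sup>2"
      using K q \<delta> by simp_all
    have "8 * real K * real q ^ (2 * K) * (real K * ln (real q) + ln 2) \<le> real D * \<delta>\<^sup>2"
      using D_large pos(2) by (simp only: pos_divide_le_eq)
    then have "real K * ln (real q) + ln 2 \<le> real D * \<delta>\<^sup>2 / (8 * real K * real q ^ (2 * K))"
      using pos(1) by (simp only: pos_le_divide_eq mult.commute)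
    also have "\<dots> = \<epsilon>\<^sup>2 * real D / (2 * real K)"
      unfolding power_even_eq by (simp add: \<epsilon>_def power_divide power_mult_distrib mult_ac)
    finally show ?thesis .
  qed
  obtain b :: "nat poly" where b: "\<And>F. F \<in> \<F> \<Longrightarrow> \<exists>\<xi> \<in> assignments q F. \<exists>t.
      run p (enc_inst F) (enc_nats \<xi>) t \<and> t \<le> poly b (dsize (enc_inst F)) \<and> Val \<Lambda> F \<xi> \<ge> \<alpha> * Opt q \<Lambda> F"
    using p unfolding approx_algorithm_def by blast

  define cs where "cs = (\<lambda>x :: inst_rep \<times> bool list. expand ?T L (fst x))"
  define f where "f = (\<lambda>x. sample_rep D (cs x) (bits_to_nat (snd x)))"
  define g where "g = (\<lambda>z. greedy_round ?T K (cs (fst z)) (clouds (slots (cs (fst z))) (snd z) (fst (fst (fst z)))))"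
  have cs: "ptime cs"
    unfolding cs_def by (intro ptime_expand ptime_intros)
  have f: "ptime f"
    unfolding f_def by (intro ptime_sample_rep ptime_intros cs)
  have g: "ptime g"
    unfolding g_def by (intro ptime_greedy_round ptime_clouds ptime_slots ptime_comp[OF cs] ptime_intros)
  have h: "ptime (\<lambda>x. g (x, []))"
    by (rule ptime_comp[OF g]) (intro ptime_intros)
  have ne: "ptime (\<lambda>x. cs x \<noteq> [])"
    by (intro ptime_intros cs)
  obtain P and b' :: "nat poly" where
    P_empty: "\<And>x. \<not> cs x \<noteq> [] \<Longrightarrow> \<exists>t. run P (enc x) (enc (g (x, []))) t \<and> t \<le> poly b' (esize x)" and
    P: "\<And>x y t'. cs x \<noteq> [] \<Longrightarrow> run p (enc (f x)) (enc y) t' \<Longrightarrow> t' \<le> poly b (esize (f x)) \<Longrightarrow>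
      \<exists>t. run P (enc x) (enc (g (x, y))) t \<and> t \<le> poly b' (esize x)"
    using run_with_oracle[OF ne f g h, of p b] by blast

  have slots: "ptime (\<lambda>I. repeat D (slots (expand ?T L I)))"
    by (intro ptime_repeat ptime_slots ptime_expand ptime_intros)
  obtain e where e: "\<And>I. esize (repeat D (slots (expand ?T L I))) \<le> poly e (esize I)"
    using ptime_esize_bound[OF slots] by blast
  \<comment> \<open>\<open>poly e\<close> bounds the number of slots, and a number of outcomes below
    \<open>n ^ n\<close> is covered by \<open>n * n\<close> bits.\<close>
  define l where "l = e * e"
  define b'' where "b'' = pcompose b' ([:2, 1:] + [:3:] * l)"

  \<comment> \<open>Everything about a fixed outcome \<open>r\<close>: the program always halts in
    time with an assignment, and the assignment is good whenever the sample overestimates no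
    assignment of the copies.\<close>
  have run_P: "\<exists>\<xi> \<in> assignments q F. \<exists>t. run P (enc (inst_rep F, r)) (enc \<xi>) t \<and> t \<le> poly b' (esize (inst_rep F, r)) \<and>
      ((\<forall>\<sigma>. length \<sigma> = length (slots (expand ?T L (inst_rep F))) \<longrightarrow> set \<sigma> \<subseteq> {..<q} \<longrightarrow>
        (\<Sum>c\<leftarrow>sample D (expand ?T L (inst_rep F)) (bits_to_nat r). sat ?T (fst c) (map ((!) \<sigma>) (snd c))) \<le>
          real D * discretized.blowup q \<Lambda> F L \<sigma> + \<epsilon> * real (D * length (expand ?T L (inst_rep F)))) \<longrightarrow>
       (\<alpha> - \<delta>) * Opt q \<Lambda> F \<le> Val \<Lambda> F \<xi>)"
    if F: "weighted_instance \<Lambda> F" for F r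
  proof -
    interpret discretized q \<Lambda> F L
      using q L_bounds(2) F by unfold_locales auto
    let ?x = "(inst_rep F, r)"
    have csx: "cs ?x = expand ?T L (inst_rep F)"
      by (simp add: cs_def)
    have gx: "g (?x, \<sigma>) = decode \<sigma>" for \<sigma>
      by (simp add: g_def decode_def csx K_def)
    show ?thesis
    proof (cases "cs ?x = []")
      \<comment> \<open>Without constraints the weights of the sampled instance could not add up to
        1, so the given program must not be called. The optimum is 0 then, and any assignment will
        do.\<close>
      case True
      obtain t where t: "run P (enc ?x) (enc (decode [])) t" "t \<le> poly b' (esize ?x)"
        using P_empty[of ?x] True gx by auto
      have "decode [] \<in> assignments q F"
        using True by (intro decode(1)) (auto simp: csx slots_def)
      moreover have "(\<alpha> - \<delta>) * Opt q \<Lambda> F \<le> Val \<Lambda> F (decode [])"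
        using Opt_eq_0 Val_nonneg[OF calculation] True csx by simp
      ultimately show ?thesis
        using t by blast
    next
      case False
      define R where "R = bits_to_nat r"
      have ne: "expand ?T L (inst_rep F) \<noteq> []"
        using False csx by simp
      interpret S: sampled q \<Lambda> "expand ?T L (inst_rep F)" D
        by (rule sampled[OF ne D])
      let ?F = "sample_inst D (expand ?T L (inst_rep F)) R"
      have fx: "enc_inst ?F = enc (f ?x)"
        unfolding enc_inst_rep[symmetric] sample_rep_eq[OF D ne] by (simp only: f_def csx R_def snd_conv)
      have "?F \<in> \<F>"
        by (rule \<F>[OF S.sample_inst_unweighted S.sample_inst_regular])
      then obtain \<sigma> t' where \<sigma>: "\<sigma> \<in> assignments q ?F" "run p (enc (f ?x)) (enc \<sigma>) t'"
        "t' \<le> poly b (esize (f ?x))" "\<alpha> * Opt q \<Lambda> ?F \<le> Val \<Lambda> ?F \<sigma>"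
        using b[of ?F] unfolding fx enc_nats_eq by blast
      have \<sigma>': "length \<sigma> = length (slots (expand ?T L (inst_rep F)))" "set \<sigma> \<subseteq> {..<q}"
        using \<sigma>(1) by (simp_all add: assignments_def sample_inst_def)
      obtain t where t: "run P (enc ?x) (enc (decode \<sigma>)) t" "t \<le> poly b' (esize ?x)"
        using P[OF False \<sigma>(2,3)] gx by auto
      have "(\<alpha> - \<delta>) * Opt q \<Lambda> F \<le> Val \<Lambda> F (decode \<sigma>)"
        if good: "(\<Sum>c\<leftarrow>sample D (expand ?T L (inst_rep F)) R. sat ?T (fst c) (map ((!) \<sigma>) (snd c))) \<le>
          real D * blowup \<sigma> + \<epsilon> * real (D * length (expand ?T L (inst_rep F)))"
      proof -
        have "(\<alpha> - \<delta>) * Opt q \<Lambda> F \<le> (\<alpha> - 1 / real L - \<epsilon> * real q ^ K) * Opt q \<Lambda> F"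
          using L_bounds(1) \<epsilon>(2) Opt_nonneg by (intro mult_right_mono) auto
        also have "\<dots> \<le> Val \<Lambda> F (decode \<sigma>)"
          unfolding K_def by (rule decode_Val[OF ne D \<alpha>(1) _ _ \<sigma>(1,4) good]) (use \<alpha> \<epsilon> in auto)
        finally show ?thesis .
      qed
      then show ?thesis
        using t decode(1)[OF \<sigma>'] \<sigma>' unfolding R_def by blast
    qed
  qed

  have "rand_approx_algorithm q \<Lambda> {F. weighted_instance \<Lambda> F} (\<alpha> - \<delta>) (\<lambda>F. 1 - 2 * 2 powr (- real (nvars F))) P"
    unfolding rand_approx_algorithm_def
  proof (rule exI[of _ b''], rule exI[of _ l], intro ballI conjI allI impI)
    fix F and r :: "bool list"
    assume F: "F \<in> {F. weighted_instance \<Lambda> F}" and "length r = poly l (dsize (enc_inst F))"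
    then have "esize (inst_rep F, r) \<le> poly ([:2, 1:] + [:3:] * l) (dsize (enc_inst F))"
      by (intro esize_input_le)
    then have "poly b' (esize (inst_rep F, r)) \<le> poly b'' (dsize (enc_inst F))"
      unfolding b''_def poly_pcompose by (rule poly_nat_mono)
    then show "\<exists>y t. run P (Pr (enc_inst F) (enc_bits r)) y t \<and> t \<le> poly b'' (dsize (enc_inst F))"
      unfolding enc_input using run_P[of F r] F by (meson le_trans mem_Collect_eq)
  next
    fix F assume F: "F \<in> {F. weighted_instance \<Lambda> F}"
    then interpret discretized q \<Lambda> F L
      using q L_bounds(2) by unfold_locales auto
    let ?l = "poly l (dsize (enc_inst F))" and ?C = "expand ?T L (inst_rep F)"
    let ?good = "{r. \<exists>\<xi>\<in>assignments q F. \<exists>t. run P (Pr (enc_inst F) (enc_bits r)) (enc_nats \<xi>) t \<and> (\<alpha> - \<delta>) * Opt q \<Lambda> F \<le> Val \<Lambda> F \<xi>}"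
    define bad where "bad = {r. \<exists>\<sigma>. length \<sigma> = N \<and> set \<sigma> \<subseteq> {..<q} \<and>
      real D * blowup \<sigma> + \<epsilon> * real (D * length ?C) \<le>
        (\<Sum>c\<leftarrow>sample D ?C (bits_to_nat r). sat ?T (fst c) (map ((!) \<sigma>) (snd c)))}"
    have sub: "- bad \<subseteq> ?good"
    proof
      fix r assume "r \<in> - bad"
      then have "\<forall>\<sigma>. length \<sigma> = N \<longrightarrow> set \<sigma> \<subseteq> {..<q} \<longrightarrow>
        (\<Sum>c\<leftarrow>sample D ?C (bits_to_nat r). sat ?T (fst c) (map ((!) \<sigma>) (snd c))) \<le>
          real D * blowup \<sigma> + \<epsilon> * real (D * length ?C)"
        unfolding bad_def by (auto simp: not_le less_imp_le)
      then show "r \<in> ?good"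
        using run_P[of F r] F unfolding enc_input enc_nats_eq by blast
    qed
    show "1 - 2 * 2 powr (- real (nvars F)) \<le> measure_pmf.prob (random_bits ?l) ?good"
    proof (cases "?C = []")
      case True
      have "?good = UNIV"
      proof (intro equalityI subset_UNIV subsetI CollectI)
        fix r :: "bool list"
        obtain \<xi> t where "\<xi> \<in> assignments q F" "run P (enc (inst_rep F, r)) (enc \<xi>) t"
          using run_P[of F r] F by blast
        then show "\<exists>\<xi>\<in>assignments q F. \<exists>t. run P (Pr (enc_inst F) (enc_bits r)) (enc_nats \<xi>) t \<and> (\<alpha> - \<delta>) * Opt q \<Lambda> F \<le> Val \<Lambda> F \<xi>"
          unfolding enc_input enc_nats_eq using Opt_eq_0[OF True] Val_nonneg by auto
      qed
      then show ?thesis by simp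
    next
      case False
      have "length (repeat D (slots ?C)) \<le> poly e (dsize (enc_inst F))"
        using length_le_esize[of "repeat D (slots ?C)"] e[of "inst_rep F"] unfolding enc_inst_rep by linarith
      then have "num_draws (repeat D (slots ?C)) \<le> 2 ^ ?l"
        using num_draws_le_power by (simp add: l_def)
      then have "measure_pmf.prob (random_bits ?l) bad \<le> 2 * 2 powr (- real (nvars F))"
        unfolding bad_def by (intro prob_overestimate[OF False D \<epsilon>(1)]) (use D_large' in \<open>simp_all add: K_def\<close>)
      then have "1 - 2 * 2 powr (- real (nvars F)) \<le> measure_pmf.prob (random_bits ?l) (- bad)"
        using measure_pmf.prob_compl[of bad "random_bits ?l"] by (simp add: Compl_eq_Diff_UNIV)
      also have "\<dots> \<le> measure_pmf.prob (random_bits ?l) ?good"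
        by (rule measure_pmf.finite_measure_mono[OF sub]) simp
      finally show ?thesis .
    qed
  qed
  then show ?thesis by blast
qed

theorem theorem3:
  fixes q :: nat and \<Lambda> :: csp
  assumes "q \<ge> 1"
  shows "\<exists>C > 0. \<exists>C' > 0. \<forall>\<delta> > 0. \<forall>\<alpha> < 1.
    (\<exists>p. approx_algorithm q \<Lambda>
       {F. unweighted_instance \<Lambda> F \<and>
           (\<exists>d. regular_of_degree F d \<and> real d \<le> C * (ln (1 / \<delta>) / \<delta>\<^sup>2))} \<alpha> p) \<longrightarrow>
    (\<exists>p'. rand_approx_algorithm q \<Lambda> {F. weighted_instance \<Lambda> F} (\<alpha> - \<delta>)
       (\<lambda>F. 1 - C' * 2 powr (- real (nvars F))) p')"
proof -
  define K where "K = arity_bound \<Lambda>"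
  \<comment> \<open>A degree of \<open>c / \<delta>^2\<close> suffices for the concentration bound
    to beat the union bound.\<close>
  define c where "c = 8 * real K * real q ^ (2 * K) * (real K * ln (real q) + ln 2)"
  \<comment> \<open>For \<alpha> < 1 and \<delta> at least this large, \<alpha> - \<delta> is below
    q^-K and the uniform assignment suffices. For smaller \<delta> the logarithm of 1/\<delta> is
    bounded away from 0.\<close>
  define \<delta>0 where "\<delta>0 = 1 - 1 / real q ^ K"
  \<comment> \<open>The 1 in the numerator absorbs rounding the degree up to an integer. The final 1
    keeps \<open>C\<close> positive even for \<open>q = 1\<close>, where
    \<open>\<delta>0 = 0\<close> and the quotient has no meaning; the reduction is not reached
    then.\<close>
  define C where "C = (c + 1) / ln (1 / \<delta>0) + 1"
  have qK: "real q ^ K \<ge> 1" using assms by simp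
  have K: "K > 0" by (simp add: K_def arity_bound_def)
  have c: "c > 0"
    unfolding c_def using assms K by (intro mult_pos_pos add_nonneg_pos) auto
  have \<delta>0: "0 \<le> \<delta>0" "\<delta>0 < 1"
    unfolding \<delta>0_def using divide_left_mono[of 1 "real q ^ K" 1] qK assms by simp_all
  have ln\<delta>0: "0 < ln (1 / \<delta>0)" if "\<delta>0 > 0"
    using that \<delta>0 by (intro ln_gt_zero) simp
  have "C > 0"
    using ln\<delta>0 \<delta>0 c by (cases "\<delta>0 = 0") (auto simp: C_def intro!: add_pos_pos)
  moreover have "\<exists>p'. rand_approx_algorithm q \<Lambda> {F. weighted_instance \<Lambda> F} (\<alpha> - \<delta>)
       (\<lambda>F. 1 - 2 * 2 powr (- real (nvars F))) p'"
    if \<delta>: "\<delta> > 0" and \<alpha>: "\<alpha> < 1" and p: "approx_algorithm q \<Lambda>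
       {F. unweighted_instance \<Lambda> F \<and>
           (\<exists>d. regular_of_degree F d \<and> real d \<le> C * (ln (1 / \<delta>) / \<delta>\<^sup>2))} \<alpha> p" for \<delta> \<alpha> p
  proof (cases "\<alpha> - \<delta> < 1 / real q ^ K")
    \<comment> \<open>Besides large \<delta> this covers every \<alpha> that is not
      positive.\<close>
    case True
    then show ?thesis
      unfolding K_def by (intro uniform_algorithm assms) auto
  next
    case False
    then have le: "\<delta> < \<delta>0"
      using \<alpha> by (simp add: \<delta>0_def)
    have "0 < 1 / real q ^ K" using assms by simp
    then have "\<alpha> > 0" using False \<delta> by linarith
    define D where "D = nat \<lceil>c / \<delta>\<^sup>2\<rceil>"
    have "c / \<delta>\<^sup>2 > 0" using c \<delta> by simp
    then have D: "D > 0" "c / \<delta>\<^sup>2 \<le> real D" "real D \<le> c / \<delta>\<^sup>2 + 1"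
      unfolding D_def by linarith+
    have "\<delta>0 > 0" using \<delta> le by simp
    have "\<delta>\<^sup>2 \<le> 1"
      using \<delta> le \<delta>0 by (intro power_le_one) auto
    then have "1 \<le> 1 / \<delta>\<^sup>2" using \<delta> by simp
    then have "real D \<le> (c + 1) / \<delta>\<^sup>2"
      using D(3) by (simp add: add_divide_distrib)
    also have "\<dots> = (c + 1) / ln (1 / \<delta>0) * ln (1 / \<delta>0) / \<delta>\<^sup>2"
      using ln\<delta>0[OF \<open>\<delta>0 > 0\<close>] by simp
    also have "\<dots> \<le> C * ln (1 / \<delta>) / \<delta>\<^sup>2"
    proof (intro divide_right_mono mult_mono)
      show "ln (1 / \<delta>0) \<le> ln (1 / \<delta>)"
        using \<delta> le \<open>\<delta>0 > 0\<close> by (simp add: ln_div)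
    qed (use \<open>C > 0\<close> ln\<delta>0[OF \<open>\<delta>0 > 0\<close>] in \<open>auto simp: C_def\<close>)
    finally have "real D \<le> C * (ln (1 / \<delta>) / \<delta>\<^sup>2)" by simp
    then show ?thesis
      by (intro reduction_algorithm[OF assms \<open>\<alpha> > 0\<close> \<alpha> \<delta> D(1) _ p])
        (use D(2) in \<open>auto simp: c_def K_def\<close>)
  qed
  ultimately show ?thesis
    by (intro exI[of _ C] conjI exI[of _ 2] allI impI) auto
qed

end
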